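(* Let $(\mathcal{A},\varphi)$ be a $W^*$-probability space. Let $U,V\in\mathcal{A}$ be free and such that $0<U<1$ and $V>0$. Assume that for some $b,c\in\mathbb{R}$ $$\mathbb{E}_{V^{1/2}UV^{1/2}}\left[V^{1/2}(1-U)V^{1/2}\right]=b\,1_{\mathcal{A}},$$ $$\mathbb{E}_{V^{1/2}UV^{1/2}}\left[\left(V^{1/2}(1-U)V^{1/2}\right)^{-1}\right]=c\,1_{\mathcal{A}}.$$ Then $b,c>0$, $bc>1$ and, with $\alpha=\varphi\left(U(1-U)^{-1}\right)>0$, \begin{itemize} \item $V$ has the free Poisson distribution $\mu\left(\frac{bc-1}{c},\,\frac{bc+\alpha}{bc-1}\right)$, \item $U$ has the free binomial distribution $\nu\left(\frac{\alpha}{bc-1},\,\frac{bc}{bc-1}\right)$. \end{itemize}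
   Context: A $W^*$-probability space is a pair $(\mathcal{A},\varphi)$ where $\mathcal{A}$ is a finite von Neumann algebra and $\varphi$ is a faithful normal tracial state; $1_{\mathcal{A}}$ (also written $1$) is the unit. Inequalities such as $0<U<1$ and $V>0$ are between self-adjoint elements. Free means free in the sense of Voiculescu with respect to $\varphi$. $\mathbb{E}_X$ denotes the $\varphi$-preserving conditional expectation onto the von Neumann subalgebra generated by $X$ and $1_{\mathcal{A}}$. Free Poisson (Marchenko–Pastur) distribution $\mu(\alpha,\lambda)$, $\alpha,\lambda>0$: $\mu=\max\{0,1-\lambda\}\delta_0+\tilde\mu$, where $\tilde\mu$ is supported on $(\alpha(1-\sqrt\lambda)^2,\alpha(1+\sqrt\lambda)^2)$ with density $\frac{1}{2\pi\alpha x}\sqrt{4\lambda\alpha^2-(x-\alpha(1+\lambda))^2}$. Its $S$-transform is $\frac{1}{\alpha\lambda+\alpha z}$. Free binomial distribution $\nu(\sigma,\theta)$, for $(\sigma,\theta)$ with $\frac{\sigma+\theta}{\sigma+\theta-1}>0$ and $\frac{\sigma\theta}{\sigma+\theta-1}>0$: $\nu=(1-\sigma)\mathbb{I}_{0<\sigma<1}\delta_0+\tilde\nu+(1-\theta)\mathbb{I}_{0<\theta<1}\delta_1$, where $\tilde\nu$ is supported on $(x_-,x_+)$, $x_\pm=\left(\sqrt{\frac{\sigma}{\sigma+\theta}\left(1-\frac{1}{\sigma+\theta}\right)}\pm\sqrt{\frac{1}{\sigma+\theta}\left(1-\frac{\sigma}{\sigma+\theta}\right)}\right)^2$, with density $(\sigma+\theta)\frac{\sqrt{(x-x_-)(x_+-x)}}{2\pi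 x(1-x)}$. Its $S$-transform is $1+\frac{\theta}{\sigma+z}$. Here the $S$-transform is $S_X(z)=\frac{1+z}{z}M_X^{\langle-1\rangle}(z)$ with $M_X(z)=\varphi(zX(1-zX)^{-1})$ and $M_X^{\langle -1\rangle}$ its compositional inverse. The number $\alpha$ in the claim is unrelated to the parameter name in $\mu(\alpha,\lambda)$.
   Formalization: It is additionally assumed that U and V are not both scalar multiples of the unit (for scalars bc = 1, so the claim bc > 1 fails), and the inverse of V^{1/2}(1-U)V^{1/2} in the second condition is explicitly assumed to exist as a bounded operator. *)

theory Defs
  imports "HOL-Probability.Probability"
begin

section \<open>Complex Hilbert spaces\<close>

class scaleC =
  fixes scaleC :: "complex \<Rightarrow> 'a \<Rightarrow> 'a"  (infixr \<open>*\<^sub>C\<close> 75)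

text \<open>The complex structure is put on top of the real Hilbert space structure of the library; the
  real inner product is the real part of the complex one. The sesquilinear form is linear in the
  second argument. The zero space is excluded, so that bounded operators form a ring with
  \<open>0 \<noteq> 1\<close>; no state exists on operators of the zero space anyway.\<close>

class chilbert_space = real_inner + complete_space + scaleC +
  fixes cinner :: "'a \<Rightarrow> 'a \<Rightarrow> complex"
  assumes scaleC_add_right: "a *\<^sub>C (x + y) = a *\<^sub>C x + a *\<^sub>C y"
    and scaleC_add_left: "(a + b) *\<^sub>C x = a *\<^sub>C x + b *\<^sub>C x"
    and scaleC_scaleC: "a *\<^sub>C b *\<^sub>C x = (a * b) *\<^sub>C x"
    and scaleC_of_real: "complex_of_real r *\<^sub>C x = r *\<^sub>R x"
    and cinner_commute: "cinner x y = cnj (cinner y x)"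
    and cinner_add_right: "cinner x (y + z) = cinner x y + cinner x z"
    and cinner_scaleC_right: "cinner x (a *\<^sub>C y) = a * cinner x y"
    and inner_eq_Re_cinner: "inner x y = Re (cinner x y)"
    and ex_nonzero: "\<exists>x. x \<noteq> 0"

instantiation complex :: chilbert_space
begin

definition scaleC_complex :: "complex \<Rightarrow> complex \<Rightarrow> complex"
  where "scaleC_complex a x = a * x"

definition cinner_complex :: "complex \<Rightarrow> complex \<Rightarrow> complex"
  where "cinner_complex x y = cnj x * y"

instance
  by standard
    (auto simp: scaleC_complex_def cinner_complex_def inner_complex_def algebra_simps scaleR_conv_of_real
      intro: exI[of _ 1])

end

context chilbert_space
begin

lemma cinner_add_left: "cinner (x + y) z = cinner x z + cinner y z"
  by (metis cinner_add_right cinner_commute complex_cnj_add)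

lemma cinner_scaleC_left: "cinner (a *\<^sub>C x) y = cnj a * cinner x y"
  by (metis cinner_commute cinner_scaleC_right complex_cnj_mult)

lemma norm_scaleC: "norm (a *\<^sub>C x) = cmod a * norm x"
proof -
  have "cinner (a *\<^sub>C x) (a *\<^sub>C x) = (cnj a * a) * cinner x x"
    by (simp add: cinner_scaleC_left cinner_scaleC_right)
  also have "cnj a * a = complex_of_real ((cmod a)\<^sup>2)"
    using complex_norm_square[of a] by (simp add: mult.commute)
  finally have "inner (a *\<^sub>C x) (a *\<^sub>C x) = (cmod a)\<^sup>2 * inner x x"
    by (simp add: inner_eq_Re_cinner)
  then show ?thesis
    by (simp add: norm_eq_sqrt_inner real_sqrt_mult)
qed

end

section \<open>Bounded operators\<close>

typedef (overloaded) 'h bounded_op =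
  "{f :: 'h \<Rightarrow> 'h::chilbert_space. bounded_linear f \<and> (\<forall>a x. f (a *\<^sub>C x) = a *\<^sub>C f x)}"
  morphisms op_apply Abs_bounded_op
proof -
  have "(\<lambda>x. x) \<in> {f :: 'h \<Rightarrow> 'h. bounded_linear f \<and> (\<forall>a x. f (a *\<^sub>C x) = a *\<^sub>C f x)}"
    by (simp add: bounded_linear_ident)
  then show ?thesis by blast
qed

setup_lifting type_definition_bounded_op

lemma op_eqI: "(\<And>x. op_apply S x = op_apply T x) \<Longrightarrow> S = T"
  by (metis ext op_apply_inject)

lemma bounded_linear_scaleC: "bounded_linear (\<lambda>x::'h::chilbert_space. a *\<^sub>C x)"
proof (rule bounded_linear_intro[where K = "cmod a"])
  show "a *\<^sub>C r *\<^sub>R x = r *\<^sub>R a *\<^sub>C x" for r and x :: 'h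
    by (metis scaleC_of_real scaleC_scaleC mult.commute)
qed (simp_all add: scaleC_add_right norm_scaleC mult.commute)

lemma scaleC_minus_right: "a *\<^sub>C (- x) = - (a *\<^sub>C (x::'h::chilbert_space))"
  by (rule linear_neg[OF bounded_linear.linear[OF bounded_linear_scaleC]])

lemma scaleC_diff_right: "a *\<^sub>C (x - y) = a *\<^sub>C x - a *\<^sub>C (y::'h::chilbert_space)"
  by (rule linear_diff[OF bounded_linear.linear[OF bounded_linear_scaleC]])

instantiation bounded_op :: (chilbert_space) "{real_algebra_1, scaleC}"
begin

lift_definition zero_bounded_op :: "'a bounded_op" is "\<lambda>x. 0"
  by (simp add: linear_0[OF bounded_linear.linear[OF bounded_linear_scaleC]])

lift_definition one_bounded_op :: "'a bounded_op" is "\<lambda>x. x"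
  by simp

lift_definition plus_bounded_op :: "'a bounded_op \<Rightarrow> 'a bounded_op \<Rightarrow> 'a bounded_op"
  is "\<lambda>f g x. f x + g x"
  by (simp add: bounded_linear_add scaleC_add_right)

lift_definition minus_bounded_op :: "'a bounded_op \<Rightarrow> 'a bounded_op \<Rightarrow> 'a bounded_op"
  is "\<lambda>f g x. f x - g x"
  by (simp add: bounded_linear_sub scaleC_diff_right)

lift_definition uminus_bounded_op :: "'a bounded_op \<Rightarrow> 'a bounded_op"
  is "\<lambda>f x. - f x"
  by (simp add: bounded_linear_minus scaleC_minus_right)

lift_definition times_bounded_op :: "'a bounded_op \<Rightarrow> 'a bounded_op \<Rightarrow> 'a bounded_op"
  is "\<lambda>f g x. f (g x)"
  by (simp add: bounded_linear_compose)

lift_definition scaleC_bounded_op :: "complex \<Rightarrow> 'a bounded_op \<Rightarrow> 'a bounded_op"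
  is "\<lambda>a f x. a *\<^sub>C f x"
  by (simp add: bounded_linear_compose[OF bounded_linear_scaleC] scaleC_scaleC mult.commute)

definition scaleR_bounded_op :: "real \<Rightarrow> 'a bounded_op \<Rightarrow> 'a bounded_op"
  where "scaleR_bounded_op r T = complex_of_real r *\<^sub>C T"

lemma op_apply_scaleR: "op_apply (r *\<^sub>R T) x = r *\<^sub>R op_apply T x"
  by (simp add: scaleR_bounded_op_def scaleC_bounded_op.rep_eq scaleC_of_real)

lemma op_apply_bounded_linear: "bounded_linear (op_apply T)"
  using op_apply[of T] by simp

instance
proof
  obtain x :: 'a where "x \<noteq> 0" using ex_nonzero by blast
  then have "op_apply 0 x \<noteq> op_apply 1 x"
    by (simp add: zero_bounded_op.rep_eq one_bounded_op.rep_eq)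
  then show "(0::'a bounded_op) \<noteq> 1" by metis
qed (auto intro!: op_eqI simp: zero_bounded_op.rep_eq one_bounded_op.rep_eq plus_bounded_op.rep_eq
       minus_bounded_op.rep_eq uminus_bounded_op.rep_eq times_bounded_op.rep_eq op_apply_scaleR
       linear_simps[OF op_apply_bounded_linear] algebra_simps)

end

definition adj :: "'h::chilbert_space bounded_op \<Rightarrow> 'h bounded_op"
  where "adj T = (THE S. \<forall>x y. cinner (op_apply S x) y = cinner x (op_apply T y))"

text \<open>Loewner order: \<open>T - S\<close> is a positive operator. On a complex Hilbert space the condition on
  the quadratic form entails that \<open>T - S\<close> is self-adjoint. The strict relation is the strict part of
  this partial order, so \<open>0 < T\<close> means that \<open>T\<close> is positive and \<open>T \<noteq> 0\<close>; invertibility is not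
  included.\<close>

instantiation bounded_op :: (chilbert_space) order
begin

definition less_eq_bounded_op :: "'a bounded_op \<Rightarrow> 'a bounded_op \<Rightarrow> bool"
  where "S \<le> T \<longleftrightarrow> (\<forall>x. cinner x (op_apply (T - S) x) \<in> nonneg_Reals)"

definition less_bounded_op :: "'a bounded_op \<Rightarrow> 'a bounded_op \<Rightarrow> bool"
  where "(S :: 'a bounded_op) < T \<longleftrightarrow> S \<le> T \<and> \<not> T \<le> S"

lemma quadratic_form_zero:
  fixes T :: "'a bounded_op"
  assumes q: "\<And>x. cinner x (op_apply T x) = 0"
  shows "T = 0"
proof (rule op_eqI)
  fix y :: 'a
  have C: "op_apply T (a *\<^sub>C u) = a *\<^sub>C op_apply T u" for a u
    using op_apply[of T] by simp
  have sym: "cinner u (op_apply T v) + cinner v (op_apply T u) = 0" for u v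
    using q[of "u + v"] q[of u] q[of v]
    by (simp add: cinner_add_left cinner_add_right linear_simps[OF op_apply_bounded_linear]
        add.commute)
  define x where "x = op_apply T y"
  have "\<i> * cinner x (op_apply T y) - \<i> * cinner y (op_apply T x) = 0"
    using sym[of x "\<i> *\<^sub>C y"] by (simp add: C cinner_scaleC_left cinner_scaleC_right)
  then have "cinner x (op_apply T y) = cinner y (op_apply T x)"
    by simp
  with sym[of x y] have "cinner x (op_apply T y) = 0"
    by simp
  then have "inner x x = 0"
    by (simp add: inner_eq_Re_cinner x_def)
  then show "op_apply T y = op_apply 0 y"
    by (simp add: x_def zero_bounded_op.rep_eq)
qed

instance
proof
  have add: "cinner x (op_apply (S + T) x) = cinner x (op_apply S x) + cinner x (op_apply T x)"
    for S T :: "'a bounded_op" and x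
    by (simp add: plus_bounded_op.rep_eq cinner_add_right)
  have zero: "cinner x (op_apply (0::'a bounded_op) x) = 0" for x :: 'a
    using add[of x 0 0] by simp
  fix S T R :: "'a bounded_op"
  show "S < T \<longleftrightarrow> S \<le> T \<and> \<not> T \<le> S"
    by (rule less_bounded_op_def)
  show "S \<le> S"
    by (simp add: less_eq_bounded_op_def zero)
  show "S \<le> R" if "S \<le> T" "T \<le> R"
  proof -
    have "R - S = (R - T) + (T - S)" by simp
    with that show ?thesis
      unfolding less_eq_bounded_op_def by (metis add nonneg_Reals_add_I)
  qed
  show "S = T" if "S \<le> T" "T \<le> S"
  proof -
    have "cinner x (op_apply (T - S) x) = 0" for x
    proof -
      have "cinner x (op_apply (T - S) x) + cinner x (op_apply (S - T) x) = 0"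
        using add[of x "T - S" "S - T"] zero by simp
      moreover have "cinner x (op_apply (T - S) x) \<in> nonneg_Reals"
        "cinner x (op_apply (S - T) x) \<in> nonneg_Reals"
        using that by (auto simp: less_eq_bounded_op_def)
      ultimately show ?thesis
        by (auto simp: complex_nonneg_Reals_iff complex_eq_iff)
    qed
    then have "T - S = 0" by (rule quadratic_form_zero)
    then show ?thesis by simp
  qed
qed

end

definition op_sqrt :: "'h::chilbert_space bounded_op \<Rightarrow> 'h bounded_op"
  where "op_sqrt T = (THE R. 0 \<le> R \<and> R * R = T)"

definition op_invertible :: "'h::chilbert_space bounded_op \<Rightarrow> bool"
  where "op_invertible T \<longleftrightarrow> (\<exists>S. S * T = 1 \<and> T * S = 1)"

definition op_inverse :: "'h::chilbert_space bounded_op \<Rightarrow> 'h bounded_op"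
  where "op_inverse T = (THE S. S * T = 1 \<and> T * S = 1)"

section \<open>Tracial W*-probability spaces\<close>

definition commutant :: "'h::chilbert_space bounded_op set \<Rightarrow> 'h bounded_op set"
  where "commutant A = {T. \<forall>S\<in>A. S * T = T * S}"

definition von_neumann_algebra :: "'h::chilbert_space bounded_op set \<Rightarrow> bool"
  where "von_neumann_algebra A \<longleftrightarrow> adj ` A \<subseteq> A \<and> commutant (commutant A) = A"

definition finite_von_neumann_algebra :: "'h::chilbert_space bounded_op set \<Rightarrow> bool"
  where "finite_von_neumann_algebra A \<longleftrightarrow>
    von_neumann_algebra A \<and> (\<forall>v\<in>A. adj v * v = 1 \<longrightarrow> v * adj v = 1)"

text \<open>In \<open>normal\<close>, the family \<open>D\<close> is an upward directed set with least upper bound \<open>T\<close> in the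
  self-adjoint part of \<open>A\<close> (an upper bound of a self-adjoint operator is itself self-adjoint).
  Values of \<open>\<phi>\<close> outside \<open>A\<close> are irrelevant.\<close>

locale wstar_prob_space =
  fixes A :: "'h::chilbert_space bounded_op set" and \<phi> :: "'h bounded_op \<Rightarrow> complex"
  assumes finite_vn: "finite_von_neumann_algebra A"
    and add: "S \<in> A \<Longrightarrow> T \<in> A \<Longrightarrow> \<phi> (S + T) = \<phi> S + \<phi> T"
    and scale: "T \<in> A \<Longrightarrow> \<phi> (a *\<^sub>C T) = a * \<phi> T"
    and unital: "\<phi> 1 = 1"
    and positive: "T \<in> A \<Longrightarrow> 0 \<le> T \<Longrightarrow> \<phi> T \<in> nonneg_Reals"
    and faithful: "T \<in> A \<Longrightarrow> \<phi> (adj T * T) = 0 \<Longrightarrow> T = 0"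
    and tracial: "S \<in> A \<Longrightarrow> T \<in> A \<Longrightarrow> \<phi> (S * T) = \<phi> (T * S)"
    and normal: "\<lbrakk>D \<subseteq> {S \<in> A. adj S = S}; D \<noteq> {}; \<forall>S\<in>D. \<forall>S'\<in>D. \<exists>R\<in>D. S \<le> R \<and> S' \<le> R;
      T \<in> A; \<forall>S\<in>D. S \<le> T; \<forall>R\<in>A. (\<forall>S\<in>D. S \<le> R) \<longrightarrow> T \<le> R\<rbrakk>
      \<Longrightarrow> Re (\<phi> T) = (SUP S\<in>D. Re (\<phi> S))"

text \<open>\<open>E\<close> is the \<open>\<phi>\<close>-preserving conditional expectation of \<open>A\<close> onto the von Neumann subalgebra
  \<open>B\<close>; these conditions determine \<open>E\<close> uniquely on \<open>A\<close>.\<close>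

definition conditional_expectation ::
    "'h::chilbert_space bounded_op set \<Rightarrow> ('h bounded_op \<Rightarrow> complex) \<Rightarrow> 'h bounded_op set
      \<Rightarrow> ('h bounded_op \<Rightarrow> 'h bounded_op) \<Rightarrow> bool"
  where "conditional_expectation A \<phi> B E \<longleftrightarrow>
    (\<forall>T\<in>A. E T \<in> B) \<and>
    (\<forall>S\<in>A. \<forall>T\<in>A. E (S + T) = E S + E T) \<and>
    (\<forall>a. \<forall>T\<in>A. E (a *\<^sub>C T) = a *\<^sub>C E T) \<and>
    (\<forall>T\<in>A. 0 \<le> T \<longrightarrow> 0 \<le> E T) \<and>
    (\<forall>T\<in>B. E T = T) \<and>
    (\<forall>T\<in>A. \<forall>S\<in>B. \<forall>R\<in>B. E (S * T * R) = S * E T * R) \<and>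
    (\<forall>T\<in>A. \<phi> (E T) = \<phi> T)"

definition vn_generated :: "'h::chilbert_space bounded_op set \<Rightarrow> 'h bounded_op set"
  where "vn_generated G = von_neumann_algebra hull G"

section \<open>Freeness\<close>

definition unital_subalgebra :: "'h::chilbert_space bounded_op set \<Rightarrow> bool"
  where "unital_subalgebra B \<longleftrightarrow> 1 \<in> B \<and> (\<forall>S\<in>B. \<forall>T\<in>B. S + T \<in> B) \<and>
    (\<forall>S\<in>B. \<forall>T\<in>B. S * T \<in> B) \<and> (\<forall>a. \<forall>T\<in>B. a *\<^sub>C T \<in> B)"

definition free_subalgebras ::
    "('h::chilbert_space bounded_op \<Rightarrow> complex) \<Rightarrow> ('i \<Rightarrow> 'h bounded_op set) \<Rightarrow> bool"
  where "free_subalgebras \<phi> B \<longleftrightarrow>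
    (\<forall>ws :: ('i \<times> 'h bounded_op) list. ws \<noteq> [] \<longrightarrow>
      (\<forall>(i, T)\<in>set ws. T \<in> B i \<and> \<phi> T = 0) \<longrightarrow>
      (\<forall>k. Suc k < length ws \<longrightarrow> fst (ws ! k) \<noteq> fst (ws ! Suc k)) \<longrightarrow>
      \<phi> (prod_list (map snd ws)) = 0)"

definition free ::
    "('h::chilbert_space bounded_op \<Rightarrow> complex) \<Rightarrow> 'h bounded_op \<Rightarrow> 'h bounded_op \<Rightarrow> bool"
  where "free \<phi> U V \<longleftrightarrow>
    free_subalgebras \<phi> (\<lambda>i::bool. unital_subalgebra hull {if i then U else V})"

section \<open>Distributions\<close>

definition has_distribution ::
    "('h::chilbert_space bounded_op \<Rightarrow> complex) \<Rightarrow> 'h bounded_op \<Rightarrow> real measure \<Rightarrow> bool"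
  where "has_distribution \<phi> X M \<longleftrightarrow>
    adj X = X \<and> prob_space M \<and> sets M = sets borel \<and> (\<exists>K. AE x in M. \<bar>x\<bar> \<le> K) \<and>
    (\<forall>n::nat. \<phi> (X ^ n) = complex_of_real (\<integral>x. x ^ n \<partial>M))"

definition atoms_and_density :: "real \<Rightarrow> real \<Rightarrow> (real \<Rightarrow> real) \<Rightarrow> real measure"
  where "atoms_and_density p q f = measure_of UNIV (sets borel)
    (\<lambda>B. ennreal p * indicator B 0 + ennreal q * indicator B 1 + (\<integral>\<^sup>+x\<in>B. ennreal (f x) \<partial>lborel))"

text \<open>The set function above is a measure.\<close>

lemma emeasure_atoms_and_density:
  assumes f[measurable]: "f \<in> borel_measurable borel" and B: "B \<in> sets borel"
  shows "emeasure (atoms_and_density p q f) B =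
    ennreal p * indicator B 0 + ennreal q * indicator B 1 + (\<integral>\<^sup>+x\<in>B. ennreal (f x) \<partial>lborel)"
proof (rule emeasure_measure_of[OF atoms_and_density_def])
  let ?m = "\<lambda>B. ennreal p * indicator B 0 + ennreal q * indicator B 1
    + (\<integral>\<^sup>+x\<in>B. ennreal (f x) \<partial>lborel)"
  show "positive (sets (atoms_and_density p q f)) ?m"
    by (simp add: positive_def)
  show "countably_additive (sets (atoms_and_density p q f)) ?m"
  proof (rule countably_additiveI)
    fix F :: "nat \<Rightarrow> real set"
    assume "range F \<subseteq> sets (atoms_and_density p q f)" and dis: "disjoint_family F"
    then have F: "range F \<subseteq> sets borel"
      by (simp add: atoms_and_density_def sigma_algebra.sigma_sets_eq[OF sets.sigma_algebra_axioms[of borel], simplified])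
    have dens: "(\<integral>\<^sup>+x\<in>G. ennreal (f x) \<partial>lborel) = emeasure (density lborel (\<lambda>x. ennreal (f x))) G"
      if "G \<in> sets borel" for G
      using that by (subst emeasure_density) auto
    have "(\<Sum>i. \<integral>\<^sup>+x\<in>F i. ennreal (f x) \<partial>lborel) = (\<integral>\<^sup>+x\<in>\<Union>(range F). ennreal (f x) \<partial>lborel)"
    proof -
      have "(\<Sum>i. \<integral>\<^sup>+x\<in>F i. ennreal (f x) \<partial>lborel)
          = (\<Sum>i. emeasure (density lborel (\<lambda>x. ennreal (f x))) (F i))"
        using F by (intro suminf_cong dens) auto
      also have "\<dots> = emeasure (density lborel (\<lambda>x. ennreal (f x))) (\<Union>(range F))"
        using F dis by (intro suminf_emeasure) auto
      also have "\<dots> = (\<integral>\<^sup>+x\<in>\<Union>(range F). ennreal (f x) \<partial>lborel)"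
        using F by (intro dens[symmetric]) auto
      finally show ?thesis .
    qed
    moreover have "(\<Sum>i. indicator (F i) x :: ennreal) = indicator (\<Union>(range F)) x" for x
      by (rule suminf_indicator[OF dis])
    ultimately show "(\<Sum>i. ?m (F i)) = ?m (\<Union>(range F))"
      by (simp add: suminf_add[symmetric] ennreal_suminf_cmult)
  qed
  show "B \<in> sets (atoms_and_density p q f)"
    using B by (simp add: atoms_and_density_def sigma_algebra.sigma_sets_eq[OF sets.sigma_algebra_axioms[of borel], simplified])
qed simp

definition free_poisson :: "real \<Rightarrow> real \<Rightarrow> real measure"
  where "free_poisson a l = atoms_and_density (max 0 (1 - l)) 0
    (\<lambda>x. if a * (1 - sqrt l)\<^sup>2 < x \<and> x < a * (1 + sqrt l)\<^sup>2
         then 1 / (2 * pi * a * x) * sqrt (4 * l * a\<^sup>2 - (x - a * (1 + l))\<^sup>2) else 0)"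

definition free_binomial_lower :: "real \<Rightarrow> real \<Rightarrow> real"
  where "free_binomial_lower s t =
    (sqrt (s / (s + t) * (1 - 1 / (s + t))) - sqrt (1 / (s + t) * (1 - s / (s + t))))\<^sup>2"

definition free_binomial_upper :: "real \<Rightarrow> real \<Rightarrow> real"
  where "free_binomial_upper s t =
    (sqrt (s / (s + t) * (1 - 1 / (s + t))) + sqrt (1 / (s + t) * (1 - s / (s + t))))\<^sup>2"

definition free_binomial :: "real \<Rightarrow> real \<Rightarrow> real measure"
  where "free_binomial s t = atoms_and_density
    (if 0 < s \<and> s < 1 then 1 - s else 0) (if 0 < t \<and> t < 1 then 1 - t else 0)
    (\<lambda>x. if free_binomial_lower s t < x \<and> x < free_binomial_upper s t
         then (s + t) * (sqrt ((x - free_binomial_lower s t) * (free_binomial_upper s t - x))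
           / (2 * pi * x * (1 - x))) else 0)"

end

theory Submission
  imports Defs
begin

unbundle no vec_syntax
unbundle fps_syntax

text \<open>
  Invertibility of \<open>V\<^sup>1\<^sup>/\<^sup>2 (1 - U) V\<^sup>1\<^sup>/\<^sup>2\<close> makes \<open>V\<close> and \<open>1 - U\<close> invertible, and pairing the two
  conditional expectations with powers of \<open>V\<^sup>1\<^sup>/\<^sup>2 U V\<^sup>1\<^sup>/\<^sup>2\<close> turns the hypotheses into
  \<open>\<phi> (V (UV)\<^sup>n) = b m\<^sub>n + m\<^sub>n\<^sub>+\<^sub>1\<close> and \<open>\<phi> ((1 - U)\<^sup>-\<^sup>1 U (VU)\<^sup>n) = c m\<^sub>n\<^sub>+\<^sub>1\<close>, where
  \<open>m\<^sub>n = \<phi> ((UV)\<^sup>n)\<close>. Freeness enters through formal subordination: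
  \<open>\<Sum> \<phi> (x (VU)\<^sup>n) \<zeta>\<^sup>n = \<Sum> \<phi> (x U\<^sup>n) u\<^sup>n\<close> for \<open>x\<close> in the algebra of \<open>U\<close>, where \<open>u\<close>, \<open>v\<close> invert the
  moment series of \<open>U\<close>, \<open>V\<close> and \<open>X \<zeta> = u v (1 + X)\<close>. The two hypotheses become linear equations for
  \<open>u\<close> and \<open>\<zeta>\<close>, so both moment series satisfy explicit quadratic equations, which have only one solution.
  The moment series of the two target laws solve them as well, by the Stieltjes transform of the
  semicircle density. Finally \<open>bc > 1\<close> is the strict Cauchy--Schwarz inequality: equality would make
  \<open>(1 - U) V\<close> a scalar, and free operators with scalar product are scalars.
\<close>

section \<open>Bounded operators as a Banach algebra\<close>

text \<open>Freeness is given for the algebras of polynomials in \<open>U\<close> and in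
  \<open>V\<close>, but the second condition involves \<open>(1 - U)^{-1}\<close>, which need not be
  a polynomial in \<open>U\<close>. The gap is closed by a Cauchy--Schwarz limit: invertibility
  keeps \<open>U\<close> below some \<open>q < 1\<close>, so \<open>U ^ n\<close> tends to 0. The
  rest of the freeness argument is algebra on coefficients, so no domain of convergence of a
  subordination function has to be controlled. The relation between \<open>u\<close>,
  \<open>v\<close> and \<open>\<zeta>\<close> is multiplicativity of the S-transform with
  denominators cleared: up to the factor \<open>(1 + X) / X\<close>, the three series are the
  S-transforms of \<open>U\<close>, \<open>V\<close> and their product. On the operator side,
  \<open>adj\<close> and \<open>op_sqrt\<close> are definite descriptions and say nothing until
  existence is shown. Self-adjointness is therefore carried as a relation, and roots are built from
  norm convergent series, which is why a Banach algebra comes first. On the side of the laws,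
  transforms are evaluated only at \<open>w < 0\<close>, where \<open>1 - w * x\<close> stays away
  from 0 on the support.\<close>

instance chilbert_space \<subseteq> banach ..

instantiation bounded_op :: (chilbert_space) real_normed_algebra_1
begin

definition norm_bounded_op :: "'a bounded_op \<Rightarrow> real"
  where "norm_bounded_op T = onorm (op_apply T)"

definition dist_bounded_op :: "'a bounded_op \<Rightarrow> 'a bounded_op \<Rightarrow> real"
  where "dist_bounded_op S T = norm (S - T)"

definition sgn_bounded_op :: "'a bounded_op \<Rightarrow> 'a bounded_op"
  where "sgn_bounded_op T = T /\<^sub>R norm T"

definition uniformity_bounded_op :: "('a bounded_op \<times> 'a bounded_op) filter"
  where "uniformity_bounded_op = (INF e\<in>{0<..}. principal {(S, T). dist S T < e})"

definition open_bounded_op :: "'a bounded_op set \<Rightarrow> bool"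
  where "open_bounded_op D \<longleftrightarrow> (\<forall>S\<in>D. \<forall>\<^sub>F (S', T) in uniformity. S' = S \<longrightarrow> T \<in> D)"

instance
proof
  fix S T :: "'a bounded_op" and r :: real
  have bl: "bounded_linear (op_apply R)" for R :: "'a bounded_op"
    by (rule op_apply_bounded_linear)
  show "norm T = 0 \<longleftrightarrow> T = 0"
    using onorm_eq_0[OF bl[of T]] by (auto simp: norm_bounded_op_def zero_bounded_op.rep_eq intro: op_eqI)
  show "norm (S + T) \<le> norm S + norm T"
    using onorm_triangle[OF bl bl, of S T] by (simp add: norm_bounded_op_def plus_bounded_op.rep_eq)
  show "norm (r *\<^sub>R T) = \<bar>r\<bar> * norm T"
    using onorm_scaleR[OF bl, of r T] by (simp add: norm_bounded_op_def op_apply_scaleR[abs_def])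
  show "norm (S * T) \<le> norm S * norm T"
    using onorm_compose[OF bl bl, of S T] by (simp add: norm_bounded_op_def times_bounded_op.rep_eq o_def)
  obtain x :: 'a where "x \<noteq> 0" using ex_nonzero by blast
  then show "norm (1 :: 'a bounded_op) = 1"
    by (auto simp: norm_bounded_op_def one_bounded_op.rep_eq onorm_def
        intro!: cSup_eq_maximum exI[of _ x] image_eqI[of _ _ x])
qed (simp_all add: dist_bounded_op_def sgn_bounded_op_def uniformity_bounded_op_def open_bounded_op_def)

end

lemma norm_op_apply_le: "norm (op_apply T x) \<le> norm T * norm x"
  using onorm[OF op_apply_bounded_linear] by (simp add: norm_bounded_op_def)

lemma norm_bounded_op_le:
  fixes T :: "'a::chilbert_space bounded_op"
  assumes "\<And>x. norm (op_apply T x) \<le> r * norm x"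
  shows "norm T \<le> r"
proof -
  obtain x :: 'a where "x \<noteq> 0" using ex_nonzero by blast
  then have "0 \<le> r"
    using order_trans[OF norm_ge_zero assms[of x]] by (simp add: zero_le_mult_iff)
  then show ?thesis
    unfolding norm_bounded_op_def using assms by (rule onorm_bound)
qed

lemma op_apply_scaleC_right: "op_apply T (a *\<^sub>C x) = a *\<^sub>C op_apply T x"
  using op_apply[of T] by simp

text \<open>The embedding into \<open>blinfun\<close> is isometric, so a Cauchy sequence has a real
  linear limit. Norm limits are pointwise limits, hence the limit is again complex linear.\<close>

instance bounded_op :: (chilbert_space) banach
proof
  fix X :: "nat \<Rightarrow> 'a bounded_op"
  assume X: "Cauchy X"
  define F where "F n = Blinfun (op_apply (X n))" for n
  have F: "blinfun_apply (F n) = op_apply (X n)" for n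
    by (simp add: F_def bounded_linear_Blinfun_apply op_apply_bounded_linear)
  have dF: "dist (F m) (F n) = dist (X m) (X n)" for m n
    by (simp add: dist_norm norm_blinfun.rep_eq norm_bounded_op_def minus_blinfun.rep_eq
        minus_bounded_op.rep_eq F)
  then have "Cauchy F"
    using X by (simp add: Cauchy_def)
  then have "convergent F"
    by (rule Cauchy_convergent)
  then obtain L where L: "F \<longlonglongrightarrow> L"
    by (auto simp: convergent_def)
  have Lx: "(\<lambda>n. op_apply (X n) x) \<longlonglongrightarrow> blinfun_apply L x" for x
    using blinfun.tendsto[OF L tendsto_const[of x]] by (simp add: F)
  have "blinfun_apply L (a *\<^sub>C x) = a *\<^sub>C blinfun_apply L x" for a x
  proof (rule LIMSEQ_unique[OF Lx])
    show "(\<lambda>n. op_apply (X n) (a *\<^sub>C x)) \<longlonglongrightarrow> a *\<^sub>C blinfun_apply L x"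
      unfolding op_apply_scaleC_right by (rule bounded_linear.tendsto[OF bounded_linear_scaleC Lx])
  qed
  then have L': "op_apply (Abs_bounded_op (blinfun_apply L)) = blinfun_apply L"
    by (intro Abs_bounded_op_inverse) (auto intro: blinfun.bounded_linear_right)
  have "dist (X n) (Abs_bounded_op (blinfun_apply L)) = dist (F n) L" for n
    by (simp add: dist_norm norm_blinfun.rep_eq norm_bounded_op_def minus_blinfun.rep_eq
        minus_bounded_op.rep_eq F L')
  then have "X \<longlonglongrightarrow> Abs_bounded_op (blinfun_apply L)"
    using L by (simp add: tendsto_dist_iff[of X] tendsto_dist_iff[of F])
  then show "convergent X"
    by (auto simp: convergent_def)
qed

text \<open>\<open>adj\<close> yields nothing until an adjoint is exhibited; this relation lets
  explicit adjoints be carried along. The real inner product is enough for complex linear operators,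
  because replacing \<open>y\<close> by \<open>(- \<i>) *\<^sub>C y\<close> recovers the imaginary
  part.\<close>

definition is_adjoint :: "'h::chilbert_space bounded_op \<Rightarrow> 'h bounded_op \<Rightarrow> bool"
  where "is_adjoint S T \<longleftrightarrow> (\<forall>x y. inner (op_apply S x) y = inner x (op_apply T y))"

lemma is_adjointD: "is_adjoint S T \<Longrightarrow> inner (op_apply S x) y = inner x (op_apply T y)"
  by (simp add: is_adjoint_def)

lemma Im_cinner: "Im (cinner x y) = inner x ((- \<i>) *\<^sub>C y)"
  by (simp add: inner_eq_Re_cinner cinner_scaleC_right)

lemma is_adjoint_cinner:
  assumes "is_adjoint S T"
  shows "cinner (op_apply S x) y = cinner x (op_apply T y)"
  using is_adjointD[OF assms, of x y] is_adjointD[OF assms, of x "(- \<i>) *\<^sub>C y"]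
  by (simp add: complex_eq_iff Im_cinner inner_eq_Re_cinner[symmetric] op_apply_scaleC_right)

lemma is_adjoint_unique:
  assumes "is_adjoint S T" "is_adjoint S' T"
  shows "S = S'"
proof (rule op_eqI)
  fix x
  have "inner (op_apply S x - op_apply S' x) y = 0" for y
    using assms by (simp add: is_adjoint_def inner_diff_left)
  then show "op_apply S x = op_apply S' x"
    by (metis inner_eq_zero_iff right_minus_eq)
qed

lemma adj_eqI:
  assumes "is_adjoint S T"
  shows "adj T = S"
  unfolding adj_def
proof (rule the_equality)
  show "\<forall>x y. cinner (op_apply S x) y = cinner x (op_apply T y)"
    using is_adjoint_cinner[OF assms] by blast
  show "S' = S" if "\<forall>x y. cinner (op_apply S' x) y = cinner x (op_apply T y)" for S'
    using that assms by (intro is_adjoint_unique[of S' T S]) (auto simp: is_adjoint_def inner_eq_Re_cinner)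
qed

lemma is_adjoint_mult: "is_adjoint S T \<Longrightarrow> is_adjoint S' T' \<Longrightarrow> is_adjoint (S' * S) (T * T')"
  by (simp add: is_adjoint_def times_bounded_op.rep_eq)

lemma is_adjoint_add: "is_adjoint S T \<Longrightarrow> is_adjoint S' T' \<Longrightarrow> is_adjoint (S + S') (T + T')"
  by (simp add: is_adjoint_def plus_bounded_op.rep_eq inner_add_left inner_add_right)

lemma is_adjoint_diff: "is_adjoint S T \<Longrightarrow> is_adjoint S' T' \<Longrightarrow> is_adjoint (S - S') (T - T')"
  by (simp add: is_adjoint_def minus_bounded_op.rep_eq inner_diff_left inner_diff_right)

lemma is_adjoint_one: "is_adjoint 1 1"
  by (simp add: is_adjoint_def one_bounded_op.rep_eq)

lemma is_adjoint_scaleR: "is_adjoint S T \<Longrightarrow> is_adjoint (r *\<^sub>R S) (r *\<^sub>R T)"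
  by (simp add: is_adjoint_def op_apply_scaleR)

lemma is_adjoint_scaleC:
  assumes "is_adjoint S T"
  shows "is_adjoint (cnj a *\<^sub>C S) (a *\<^sub>C T)"
  using is_adjoint_cinner[OF assms]
  by (simp add: is_adjoint_def scaleC_bounded_op.rep_eq inner_eq_Re_cinner cinner_scaleC_left
      cinner_scaleC_right)

lemma is_adjoint_power: "is_adjoint S T \<Longrightarrow> is_adjoint (S ^ n) (T ^ n)"
proof (induction n)
  case (Suc n)
  then have "is_adjoint (S ^ n * S) (T * T ^ n)"
    by (intro is_adjoint_mult)
  then show ?case by (simp add: power_commutes)
qed (simp add: is_adjoint_one)

lemma is_adjoint_sym: "is_adjoint S T \<Longrightarrow> is_adjoint T S"
  by (metis is_adjoint_def inner_commute)

lemma is_adjoint_inverse: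
  assumes W: "is_adjoint W W" and y: "y * W = 1" "W * y = 1"
  shows "is_adjoint y y"
proof -
  have "inner (op_apply y u) v = inner u (op_apply y v)" for u v
  proof -
    have "op_apply (W * y) v = v" "op_apply (W * y) u = u"
      by (simp_all add: y one_bounded_op.rep_eq)
    then show ?thesis
      using is_adjointD[OF W, of "op_apply y u" "op_apply y v"] by (simp add: times_bounded_op.rep_eq)
  qed
  then show ?thesis by (simp add: is_adjoint_def)
qed

lemma is_adjoint_tendsto:
  assumes "\<And>n. is_adjoint (X n) (X n)" "X \<longlonglongrightarrow> T"
  shows "is_adjoint T T"
proof -
  have lim: "(\<lambda>n. op_apply (X n) x) \<longlonglongrightarrow> op_apply T x" for x
  proof (rule LIM_zero_cancel, rule Lim_null_comparison)
    show "\<forall>\<^sub>F n in sequentially. norm (op_apply (X n) x - op_apply T x) \<le> norm (X n - T) * norm x"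
      using norm_op_apply_le[of "X _ - T" x] by (simp add: minus_bounded_op.rep_eq)
    show "(\<lambda>n. norm (X n - T) * norm x) \<longlonglongrightarrow> 0"
      using tendsto_mult_right[OF tendsto_norm[OF LIM_zero[OF assms(2)]], of "norm x"] by simp
  qed
  have "inner (op_apply T x) y = inner x (op_apply T y)" for x y
  proof (rule LIMSEQ_unique)
    show "(\<lambda>n. inner (op_apply (X n) x) y) \<longlonglongrightarrow> inner (op_apply T x) y"
      by (intro tendsto_inner lim tendsto_const)
    show "(\<lambda>n. inner (op_apply (X n) x) y) \<longlonglongrightarrow> inner x (op_apply T y)"
      unfolding is_adjointD[OF assms(1)] by (intro tendsto_inner lim tendsto_const)
  qed
  then show ?thesis by (simp add: is_adjoint_def)
qed

text \<open>Expanding the form at \<open>x + \<i> *\<^sub>C y\<close> and using that its imaginary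
  part is 0 gives the symmetry of \<open>T\<close>. The order thus becomes self-adjointness plus a
  real inequality.\<close>

lemma op_nonneg_iff:
  fixes T :: "'h::chilbert_space bounded_op"
  shows "0 \<le> T \<longleftrightarrow> is_adjoint T T \<and> (\<forall>x. 0 \<le> inner x (op_apply T x))"
proof
  assume T: "0 \<le> T"
  then have q: "Im (cinner x (op_apply T x)) = 0" "0 \<le> Re (cinner x (op_apply T x))" for x
    by (auto simp: less_eq_bounded_op_def complex_nonneg_Reals_iff)
  have "inner x (op_apply T y) = inner y (op_apply T x)" for x y
    using q(1)[of "x + \<i> *\<^sub>C y"] q(1)[of x] q(1)[of y]
    by (simp add: linear_simps[OF op_apply_bounded_linear] cinner_add_left cinner_add_right
        cinner_scaleC_left cinner_scaleC_right op_apply_scaleC_right inner_eq_Re_cinner)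
  then show "is_adjoint T T \<and> (\<forall>x. 0 \<le> inner x (op_apply T x))"
    using q(2) by (simp add: inner_eq_Re_cinner[symmetric] is_adjoint_def inner_commute)
next
  assume T: "is_adjoint T T \<and> (\<forall>x. 0 \<le> inner x (op_apply T x))"
  have "Im (cinner x (op_apply T x)) = 0" for x
  proof -
    have "cinner x (op_apply T x) = cnj (cinner x (op_apply T x))"
      using is_adjoint_cinner[of T T x x] T by (subst cinner_commute) simp
    then have "Im (cinner x (op_apply T x)) = Im (cnj (cinner x (op_apply T x)))"
      by (rule arg_cong)
    then show ?thesis by simp
  qed
  then show "0 \<le> T"
    using T by (auto simp: less_eq_bounded_op_def complex_nonneg_Reals_iff inner_eq_Re_cinner)
qed

lemma op_nonneg_is_adjoint: "0 \<le> T \<Longrightarrow> is_adjoint T T"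
  by (simp add: op_nonneg_iff)

lemma op_le_iff_diff_nonneg: "S \<le> T \<longleftrightarrow> 0 \<le> T - (S :: 'h::chilbert_space bounded_op)"
  by (simp add: less_eq_bounded_op_def)

lemma op_nonneg_scaleR: "0 \<le> r \<Longrightarrow> 0 \<le> T \<Longrightarrow> 0 \<le> r *\<^sub>R (T :: 'h::chilbert_space bounded_op)"
  by (auto simp: op_nonneg_iff is_adjoint_scaleR op_apply_scaleR)

lemma op_nonneg_conj:
  assumes "is_adjoint S' S" "0 \<le> T"
  shows "0 \<le> S' * T * S"
proof -
  have "is_adjoint (S' * (T * S)) (S' * T * S)"
    using assms by (intro is_adjoint_mult is_adjoint_sym[OF assms(1)] op_nonneg_is_adjoint) 
  moreover have "0 \<le> inner x (op_apply (S' * T * S) x)" for x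
    using assms(2) is_adjointD[OF assms(1), of "op_apply T (op_apply S x)" x]
    by (simp add: times_bounded_op.rep_eq op_nonneg_iff inner_commute)
  ultimately show ?thesis by (simp add: op_nonneg_iff mult.assoc)
qed

lemma op_one_nonneg: "0 \<le> (1 :: 'h::chilbert_space bounded_op)"
  by (simp add: op_nonneg_iff is_adjoint_one one_bounded_op.rep_eq)

lemma op_adjoint_mult_nonneg: "is_adjoint S' S \<Longrightarrow> 0 \<le> S' * S"
  using op_nonneg_conj[of S' S 1] op_one_nonneg by simp

text \<open>In operator form this is \<open>T * T \<le> r *\<^sub>R T\<close>, obtained without a
  square root: the form is nonnegative at \<open>x - l *\<^sub>R op_apply T x\<close>, and
  \<open>l = 1 / r\<close> is the best choice. For \<open>r \<le> 0\<close> the form vanishes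
  identically and \<open>l = 1\<close> gives \<open>op_apply T x = 0\<close>.\<close>

lemma norm_op_apply_sq_le:
  fixes T :: "'h::chilbert_space bounded_op"
  assumes "0 \<le> T" "T \<le> r *\<^sub>R 1"
  shows "(norm (op_apply T x))\<^sup>2 \<le> r * inner x (op_apply T x)"
proof -
  have T: "inner (op_apply T x) y = inner x (op_apply T y)" "0 \<le> inner x (op_apply T x)" for x y
    using assms(1) by (auto simp: op_nonneg_iff is_adjoint_def)
  have r: "inner x (op_apply T x) \<le> r * inner x x" for x
    using assms(2) by (simp add: op_le_iff_diff_nonneg[of T] op_nonneg_iff[of "_ - T"]
        minus_bounded_op.rep_eq op_apply_scaleR one_bounded_op.rep_eq inner_diff_right)
  have "0 \<le> inner x (op_apply T x) - 2 * l * (norm (op_apply T x))\<^sup>2 + l\<^sup>2 * (r * (norm (op_apply T x))\<^sup>2)" for l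
  proof -
    have "0 \<le> inner (x - l *\<^sub>R op_apply T x) (op_apply T (x - l *\<^sub>R op_apply T x))"
      by (rule T)
    also have "\<dots> = inner x (op_apply T x) - 2 * l * (norm (op_apply T x))\<^sup>2
        + l\<^sup>2 * inner (op_apply T x) (op_apply T (op_apply T x))"
      by (simp add: linear_simps[OF op_apply_bounded_linear] inner_diff_left inner_diff_right
          T(1)[of x "op_apply T x", symmetric] power2_norm_eq_inner[symmetric] algebra_simps)
        (simp add: power2_eq_square)
    also have "\<dots> \<le> inner x (op_apply T x) - 2 * l * (norm (op_apply T x))\<^sup>2 + l\<^sup>2 * (r * (norm (op_apply T x))\<^sup>2)"
      using r[of "op_apply T x"] by (intro add_left_mono mult_left_mono) (auto simp: power2_norm_eq_inner)
    finally show ?thesis .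
  qed
  note * = this
  show ?thesis
  proof (cases "r > 0")
    case True
    have "0 \<le> inner x (op_apply T x) - 2 * (1 / r) * (norm (op_apply T x))\<^sup>2 + (1 / r)\<^sup>2 * (r * (norm (op_apply T x))\<^sup>2)"
      by (rule *)
    also have "\<dots> = inner x (op_apply T x) - (norm (op_apply T x))\<^sup>2 / r"
      using True by (simp add: field_simps power2_eq_square)
    finally show ?thesis using True by (simp add: field_simps)
  next
    case False
    have z: "inner x (op_apply T x) = 0" for x
      using T(2)[of x] r[of x] False mult_nonpos_nonneg[of r "inner x x"] by simp
    have "(norm (op_apply T x))\<^sup>2 \<le> 0"
    proof -
      have "0 \<le> inner (x - op_apply T x) (op_apply T (x - op_apply T x))"
        by (rule T)
      then show ?thesis
        using z[of x] z[of "op_apply T x"] T(1)[of x "op_apply T x"]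
        by (simp add: linear_simps[OF op_apply_bounded_linear] inner_diff_left inner_diff_right
          power2_norm_eq_inner)
    qed
    then show ?thesis by (simp add: z)
  qed
qed

lemma norm_op_le:
  fixes T :: "'h::chilbert_space bounded_op"
  assumes "0 \<le> T" "T \<le> r *\<^sub>R 1" "0 \<le> r"
  shows "norm T \<le> r"
proof (rule norm_bounded_op_le)
  fix x
  have "0 \<le> inner x (op_apply (r *\<^sub>R 1 - T) x)"
    using assms(2) by (simp add: op_le_iff_diff_nonneg[of T] op_nonneg_iff[of "_ - T"])
  then have "inner x (op_apply T x) \<le> r * (norm x)\<^sup>2"
    by (simp add: minus_bounded_op.rep_eq op_apply_scaleR one_bounded_op.rep_eq inner_diff_right
        power2_norm_eq_inner)
  then have "(norm (op_apply T x))\<^sup>2 \<le> r * (r * (norm x)\<^sup>2)"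
    using norm_op_apply_sq_le[OF assms(1,2), of x] assms(3) by (meson mult_left_mono order_trans)
  then have "(norm (op_apply T x))\<^sup>2 \<le> (r * norm x)\<^sup>2"
    by (simp add: power2_eq_square mult_ac)
  then show "norm (op_apply T x) \<le> r * norm x"
    by (rule power2_le_imp_le) (simp add: assms(3))
qed

lemma op_le_norm:
  fixes T :: "'h::chilbert_space bounded_op"
  assumes "is_adjoint T T"
  shows "T \<le> norm T *\<^sub>R 1"
proof -
  have "inner x (op_apply T x) \<le> norm T * inner x x" for x
  proof -
    have "inner x (op_apply T x) \<le> norm x * norm (op_apply T x)"
      by (rule norm_cauchy_schwarz)
    also have "\<dots> \<le> norm x * (norm T * norm x)"
      by (intro mult_left_mono norm_op_apply_le) simp
    finally show ?thesis by (simp add: power2_norm_eq_inner[symmetric] power2_eq_square mult_ac)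
  qed
  then show ?thesis
    using assms by (simp add: op_le_iff_diff_nonneg[of T] op_nonneg_iff minus_bounded_op.rep_eq
        op_apply_scaleR one_bounded_op.rep_eq inner_diff_right is_adjoint_diff is_adjoint_scaleR is_adjoint_one)
qed

lemma selfadjoint_square_eq_0:
  assumes "is_adjoint T T" "T * T = 0"
  shows "T = 0"
proof (rule op_eqI)
  fix x
  have "inner (op_apply T x) (op_apply T x) = inner x (op_apply (T * T) x)"
    using assms(1) by (simp add: is_adjoint_def times_bounded_op.rep_eq)
  then show "op_apply T x = op_apply 0 x"
    by (simp add: assms(2) zero_bounded_op.rep_eq)
qed

section \<open>Square roots of positive operators\<close>

text \<open>The Taylor coefficients of \<open>sqrt (1 - x)\<close>. They sum absolutely, so the series also converges
  on the boundary of the unit ball, and no invertibility of the operator is needed.\<close>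

definition sqrt_coeff :: "nat \<Rightarrow> real"
  where "sqrt_coeff k = (1/2 gchoose k) * (-1) ^ k"

text \<open>Taking partial sums divides the generating function by \<open>1 - x\<close>, so these
  are the Taylor coefficients of \<open>(1 - x)^(-1/2)\<close>, all positive.\<close>

lemma sum_sqrt_coeff_nonneg: "0 \<le> (\<Sum>k\<le>n. sqrt_coeff k)"
proof -
  have "(\<Sum>k\<le>n. sqrt_coeff k) = pochhammer (1/2) n / fact n"
    unfolding sqrt_coeff_def gbinomial_sum_lower_neg unfolding gbinomial_pochhammer
    by (simp add: mult.assoc[symmetric] flip: power_mult_distrib)
  then show ?thesis
    by (simp add: pochhammer_pos less_imp_le)
qed

lemma sqrt_coeff_0: "sqrt_coeff 0 = 1"
  by (simp add: sqrt_coeff_def)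

lemma sqrt_coeff_Suc_le: "sqrt_coeff (Suc k) \<le> 0"
proof -
  have "(1 + real k) * (1/2 gchoose Suc k) = 1/2 * (-1/2 gchoose k)"
    using Suc_times_gbinomial[of k "-1/2::real"] by simp
  then have "(1 + real k) * sqrt_coeff (Suc k) = - (1/2) * ((-1) ^ k * (-1/2 gchoose k))"
    unfolding sqrt_coeff_def by (simp add: mult_ac)
  also have "(-1) ^ k * (-1/2 gchoose k) = pochhammer (1/2 :: real) k / fact k"
    unfolding gbinomial_pochhammer by (simp add: mult.assoc[symmetric] flip: power_mult_distrib)
  finally have "(1 + real k) * sqrt_coeff (Suc k) = - (1/2) * (pochhammer (1/2) k / fact k)" .
  moreover have "0 < pochhammer (1/2 :: real) k / fact k"
    by (simp add: pochhammer_pos)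
  ultimately have "(1 + real k) * sqrt_coeff (Suc k) \<le> 0" by simp
  then show ?thesis by (simp add: mult_le_0_iff)
qed

text \<open>Only the coefficient of index 0 is positive, so the absolute sum is 1 minus a
  nonnegative partial sum. The exact bound 1 is what later makes the square root a positive
  operator.\<close>

lemma sum_abs_sqrt_coeff_le: "(\<Sum>k<n. \<bar>sqrt_coeff (Suc k)\<bar>) \<le> 1"
proof -
  have "(\<Sum>k<n. \<bar>sqrt_coeff (Suc k)\<bar>) = - (\<Sum>k<n. sqrt_coeff (Suc k))"
    using sqrt_coeff_Suc_le by (simp add: abs_of_nonpos sum_negf)
  also have "\<dots> = 1 - (\<Sum>k\<le>n. sqrt_coeff k)"
    unfolding lessThan_Suc_atMost[symmetric] sum.lessThan_Suc_shift by (simp add: sqrt_coeff_0)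
  finally show ?thesis using sum_sqrt_coeff_nonneg[of n] by simp
qed

lemma summable_abs_sqrt_coeff_Suc: "summable (\<lambda>k. \<bar>sqrt_coeff (Suc k)\<bar>)"
  by (rule summableI_nonneg_bounded[OF _ sum_abs_sqrt_coeff_le]) simp

lemma sqrt_coeff_convolution:
  "(\<Sum>i\<le>k. sqrt_coeff i * sqrt_coeff (k - i)) = (if k = 0 then 1 else if k = 1 then -1 else 0)"
proof -
  have "(\<Sum>i\<le>k. sqrt_coeff i * sqrt_coeff (k - i))
      = (\<Sum>i\<le>k. (1/2 gchoose i) * (1/2 gchoose (k - i))) * (-1) ^ k"
    unfolding sum_distrib_right
  proof (rule sum.cong)
    fix i assume "i \<in> {..k}"
    then have "(-1 :: real) ^ i * (-1) ^ (k - i) = (-1) ^ k"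
      by (simp flip: power_add)
    then show "sqrt_coeff i * sqrt_coeff (k - i) = (1/2 gchoose i) * (1/2 gchoose (k - i)) * (-1) ^ k"
      by (simp add: sqrt_coeff_def mult_ac)
  qed simp
  also have "\<dots> = (1 gchoose k) * (-1) ^ k"
    using gbinomial_Vandermonde[of "1/2::real" "1/2" k] by (simp add: atMost_atLeast0)
  also have "(1 gchoose k) = (real (1 choose k))"
    using binomial_gbinomial[of 1 k, where 'a = real] by simp
  finally show ?thesis
    by (cases k) (auto simp: binomial_eq_0)
qed

theorem op_sqrt_exists_contraction:
  fixes X :: "'h::chilbert_space bounded_op"
  assumes X: "norm X \<le> 1" "is_adjoint X X"
  shows "\<exists>R\<ge>0. R * R = 1 - X \<and> (\<forall>S. S * X = X * S \<longrightarrow> S * R = R * S)"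
proof -
  define a where "a k = sqrt_coeff k *\<^sub>R X ^ k" for k
  have na: "norm (a k) \<le> \<bar>sqrt_coeff k\<bar>" for k
  proof -
    have "norm (X ^ k) \<le> 1"
      by (rule order_trans[OF norm_power_ineq]) (simp add: power_le_one X)
    then show ?thesis
      by (simp add: a_def mult_left_le)
  qed
  have sa: "summable (\<lambda>k. norm (a k))"
    using summable_abs_sqrt_coeff_Suc
    by (intro summable_comparison_test[OF _ iffD1[OF summable_Suc_iff summable_abs_sqrt_coeff_Suc]])
      (auto intro: na)
  define R where "R = (\<Sum>k. a k)"
  have aR: "a sums R"
    using summable_norm_cancel[OF sa] by (simp add: R_def summable_sums)
  have "(\<lambda>k. \<Sum>i\<le>k. a i * a (k - i)) sums (R * R)"
    unfolding R_def by (rule Cauchy_product_sums[OF sa sa])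
  moreover have "(\<Sum>i\<le>k. a i * a (k - i)) = (if k = 0 then 1 else if k = 1 then - X else 0)" for k
  proof -
    have "(\<Sum>i\<le>k. a i * a (k - i)) = (\<Sum>i\<le>k. (sqrt_coeff i * sqrt_coeff (k - i)) *\<^sub>R X ^ k)"
      by (rule sum.cong) (auto simp: a_def mult_ac simp flip: power_add)
    also have "\<dots> = (\<Sum>i\<le>k. sqrt_coeff i * sqrt_coeff (k - i)) *\<^sub>R X ^ k"
      by (simp add: scaleR_sum_left)
    finally show ?thesis by (simp add: sqrt_coeff_convolution)
  qed
  moreover have "(\<lambda>k. if k = 0 then 1 else if k = 1 then - X else 0) sums (1 - X)"
    using sums_finite[of "{0, 1}" "\<lambda>k::nat. if k = 0 then 1 else if k = 1 then - X else 0"] by simp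
  ultimately have RR: "R * R = 1 - X"
    using sums_unique2 by fastforce
  have adj: "is_adjoint (\<Sum>k<n. a k) (\<Sum>k<n. a k)" for n
  proof (induction n)
    case 0
    show ?case by (simp add: is_adjoint_def zero_bounded_op.rep_eq)
  next
    case (Suc n)
    then show ?case
      by (simp add: a_def is_adjoint_add is_adjoint_scaleR is_adjoint_power X)
  qed
  have Radj: "is_adjoint R R"
    using is_adjoint_tendsto[OF adj] aR by (simp add: sums_def)
  \<comment> \<open>Positivity comes from the distance to the identity: the form of \<open>R\<close>
    at \<open>x\<close> is at least
    \<open>(norm x)\<^sup>2 - norm (R - 1) * (norm x)\<^sup>2\<close>.\<close>
  have "norm (R - 1) \<le> 1"
  proof -
    have "(\<lambda>k. a (Suc k)) sums (R - 1)"
      using aR sums_Suc_iff[of a "R - 1"] by (simp add: a_def sqrt_coeff_0)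
    then have "R - 1 = (\<Sum>k. a (Suc k))" by (simp add: sums_iff)
    also have "norm \<dots> \<le> (\<Sum>k. norm (a (Suc k)))"
      using sa by (intro summable_norm) (simp add: summable_Suc_iff[of "\<lambda>k. norm (a k)"])
    also have "\<dots> \<le> (\<Sum>k. \<bar>sqrt_coeff (Suc k)\<bar>)"
      using sa by (intro suminf_le na summable_abs_sqrt_coeff_Suc)
        (simp add: summable_Suc_iff[of "\<lambda>k. norm (a k)"])
    also have "\<dots> \<le> 1"
      by (rule suminf_le_const[OF summable_abs_sqrt_coeff_Suc sum_abs_sqrt_coeff_le])
    finally show ?thesis .
  qed
  then have "0 \<le> inner x (op_apply R x)" for x
  proof -
    assume n: "norm (R - 1) \<le> 1"
    have "- inner x (op_apply (R - 1) x) \<le> norm x * norm (op_apply (R - 1) x)"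
      using norm_cauchy_schwarz[of x "- op_apply (R - 1) x"] by simp
    also have "\<dots> \<le> norm x * (norm (R - 1) * norm x)"
      by (intro mult_left_mono norm_op_apply_le) simp
    also have "\<dots> \<le> norm x * (1 * norm x)"
      using n by (intro mult_left_mono mult_right_mono) auto
    finally show ?thesis
      by (simp add: minus_bounded_op.rep_eq one_bounded_op.rep_eq inner_diff_right
          flip: power2_norm_eq_inner power2_eq_square)
  qed
  then have R0: "0 \<le> R" using Radj by (simp add: op_nonneg_iff)
  have "S * R = R * S" if S: "S * X = X * S" for S
  proof (rule sums_unique2)
    show "(\<lambda>k. S * a k) sums (S * R)"
      by (rule sums_mult[OF aR])
    have "S * X ^ k = X ^ k * S" for k
      by (induction k) (simp_all add: mult.assoc[symmetric] S, simp add: mult.assoc)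
    then show "(\<lambda>k. S * a k) sums (R * S)"
      using sums_mult2[OF aR, of S] by (simp add: a_def)
  qed
  with RR R0 show ?thesis by blast
qed

lemma op_sqrt_exists:
  fixes T :: "'h::chilbert_space bounded_op"
  assumes T: "0 \<le> T"
  shows "\<exists>R\<ge>0. R * R = T \<and> (\<forall>S. S * T = T * S \<longrightarrow> S * R = R * S)"
proof (cases "T = 0")
  case True
  then show ?thesis by (intro exI[of _ 0]) simp
next
  case False
  define r where "r = norm T"
  have r: "r > 0" using False by (simp add: r_def)
  \<comment> \<open>\<open>inverse r *\<^sub>R T\<close> lies between 0 and 1, hence so does
    \<open>X\<close>; this makes \<open>X\<close> a contraction with
    \<open>T = r *\<^sub>R (1 - X)\<close>.\<close>
  define X where "X = 1 - inverse r *\<^sub>R T"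
  have Tadj: "is_adjoint T T" using T by (rule op_nonneg_is_adjoint)
  have "0 \<le> r *\<^sub>R 1 - T"
    using op_le_norm[OF Tadj] by (simp add: op_le_iff_diff_nonneg[of T] r_def)
  then have "0 \<le> inverse r *\<^sub>R (r *\<^sub>R 1 - T)"
    using r by (intro op_nonneg_scaleR) auto
  then have "0 \<le> X"
    using r by (simp add: X_def scaleR_diff_right)
  moreover have "X \<le> 1 *\<^sub>R 1"
    unfolding op_le_iff_diff_nonneg[of X] using op_nonneg_scaleR[OF _ T, of "inverse r"] r
    by (simp add: X_def)
  ultimately have "norm X \<le> 1" by (rule norm_op_le) simp
  then obtain R where R: "0 \<le> R" "R * R = 1 - X" "\<And>S. S * X = X * S \<Longrightarrow> S * R = R * S"
    using op_sqrt_exists_contraction[OF _ op_nonneg_is_adjoint[OF \<open>0 \<le> X\<close>]] by blast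
  show ?thesis
  proof (intro exI[of _ "sqrt r *\<^sub>R R"] conjI allI impI)
    show "0 \<le> sqrt r *\<^sub>R R" using R(1) r by (intro op_nonneg_scaleR) auto
    show "(sqrt r *\<^sub>R R) * (sqrt r *\<^sub>R R) = T"
    proof -
      have "sqrt r * (sqrt r * inverse r) = 1"
        using r by (simp flip: mult.assoc)
      then show ?thesis by (simp add: R(2) X_def)
    qed
    show "S * (sqrt r *\<^sub>R R) = (sqrt r *\<^sub>R R) * S" if "S * T = T * S" for S
      using that R(3)[of S] by (simp add: X_def algebra_simps)
  qed
qed

lemma op_nonneg_add_eq_0:
  fixes S T :: "'h::chilbert_space bounded_op"
  assumes "0 \<le> S" "0 \<le> T" "S + T = 0"
  shows "S = 0"
proof -
  have "S = - T" using assms(3) by (simp add: eq_neg_iff_add_eq_0)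
  then have "S \<le> 0"
    unfolding op_le_iff_diff_nonneg[of S] using assms(2) by simp
  then show ?thesis using assms(1) by (rule antisym)
qed

text \<open>For the difference \<open>D\<close>, the positive operators \<open>D * R * D\<close> and
  \<open>D * S * D\<close> add up to \<open>D * ((R + S) * D)\<close>, which is 0 for commuting
  roots. Both vanish, hence so does their difference \<open>D ^ 3\<close>, and a self-adjoint
  nilpotent operator is 0.\<close>

lemma op_sqrt_unique:
  fixes R S :: "'h::chilbert_space bounded_op"
  assumes R: "0 \<le> R" and S: "0 \<le> S" "S * S = R * R" and comm: "S * R = R * S"
  shows "S = R"
proof -
  define D where "D = R - S"
  have D: "is_adjoint D D"
    unfolding D_def by (intro is_adjoint_diff op_nonneg_is_adjoint R S)
  have sum: "D * R * D + D * S * D = 0"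
  proof -
    have "D * R * D + D * S * D = D * ((R + S) * (R - S))"
      by (simp add: D_def algebra_simps)
    also have "(R + S) * (R - S) = 0"
      using S(2) comm by (simp add: algebra_simps)
    finally show ?thesis by simp
  qed
  have nn: "0 \<le> D * R * D" "0 \<le> D * S * D"
    by (intro op_nonneg_conj D R S)+
  have "D * R * D = 0"
    by (rule op_nonneg_add_eq_0[OF nn sum])
  moreover have "D * S * D = 0"
    using sum calculation by simp
  moreover have "D * D * D = D * R * D - D * S * D"
    by (simp add: D_def algebra_simps)
  ultimately have "(D * D) * (D * D) = 0"
    by (simp add: mult.assoc[symmetric])
  then have "D * D = 0"
    by (rule selfadjoint_square_eq_0[OF is_adjoint_mult[OF D D]])
  then have "D = 0"
    by (rule selfadjoint_square_eq_0[OF D])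
  then show ?thesis by (simp add: D_def)
qed

lemma
  fixes T :: "'h::chilbert_space bounded_op"
  assumes T: "0 \<le> T"
  shows op_sqrt_nonneg: "0 \<le> op_sqrt T"
    and op_sqrt_square: "op_sqrt T * op_sqrt T = T"
    and op_sqrt_commute: "S * T = T * S \<Longrightarrow> S * op_sqrt T = op_sqrt T * S"
proof -
  obtain R where R: "0 \<le> R" "R * R = T" "\<And>S. S * T = T * S \<Longrightarrow> S * R = R * S"
    using op_sqrt_exists[OF T] by blast
  have "op_sqrt T = R"
    unfolding op_sqrt_def
  proof (rule the_equality)
    fix S assume S: "0 \<le> S \<and> S * S = T"
    \<comment> \<open>A competing root commutes with its own square \<open>T\<close>, hence with
      \<open>R\<close> by the last clause of \<open>op_sqrt_exists\<close>; this supplies the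
      commutation that uniqueness asks for.\<close>
    then have "S * T = T * S" by (auto simp: mult.assoc)
    then have "S * R = R * S" by (rule R(3))
    with S show "S = R" by (intro op_sqrt_unique[OF R(1)]) (simp_all add: R(2))
  qed (simp add: R)
  then show "0 \<le> op_sqrt T" "op_sqrt T * op_sqrt T = T"
    "S * T = T * S \<Longrightarrow> S * op_sqrt T = op_sqrt T * S" by (simp_all add: R)
qed

lemma op_inverse_eqI:
  assumes "S * T = 1" "T * S = 1"
  shows "op_inverse T = S"
  unfolding op_inverse_def
proof (rule the_equality)
  fix S' assume "S' * T = 1 \<and> T * S' = 1"
  then show "S' = S"
    using assms by (metis mult.assoc mult_1 mult_1_right)
qed (simp add: assms)

section \<open>Traces and von Neumann algebras\<close>

lemma scaleC_op_mult_left: "(a *\<^sub>C S) * T = a *\<^sub>C (S * (T :: 'h::chilbert_space bounded_op))"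
  by (rule op_eqI) (simp add: times_bounded_op.rep_eq scaleC_bounded_op.rep_eq)

lemma scaleC_op_mult_right: "S * (a *\<^sub>C T) = a *\<^sub>C (S * (T :: 'h::chilbert_space bounded_op))"
  by (rule op_eqI) (simp add: times_bounded_op.rep_eq scaleC_bounded_op.rep_eq op_apply_scaleC_right)

lemma scaleC_op_add_right: "a *\<^sub>C (S + T) = a *\<^sub>C S + a *\<^sub>C (T :: 'h::chilbert_space bounded_op)"
  by (rule op_eqI) (simp add: plus_bounded_op.rep_eq scaleC_bounded_op.rep_eq scaleC_add_right)

lemma scaleC_op_add_left: "(a + b) *\<^sub>C T = a *\<^sub>C T + b *\<^sub>C (T :: 'h::chilbert_space bounded_op)"
  by (rule op_eqI) (simp add: plus_bounded_op.rep_eq scaleC_bounded_op.rep_eq scaleC_add_left)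

lemma scaleC_op_diff_right: "a *\<^sub>C (S - T) = a *\<^sub>C S - a *\<^sub>C (T :: 'h::chilbert_space bounded_op)"
  by (rule op_eqI) (simp add: minus_bounded_op.rep_eq scaleC_bounded_op.rep_eq scaleC_diff_right)

lemma scaleC_op_scaleC: "a *\<^sub>C b *\<^sub>C T = (a * b) *\<^sub>C (T :: 'h::chilbert_space bounded_op)"
  by (rule op_eqI) (simp add: scaleC_bounded_op.rep_eq scaleC_scaleC)

lemma scaleC_op_one [simp]: "1 *\<^sub>C T = (T :: 'h::chilbert_space bounded_op)"
  using scaleR_bounded_op_def[of 1 T] by simp

lemma scaleC_op_zero_right [simp]: "a *\<^sub>C (0 :: 'h::chilbert_space bounded_op) = 0"
  using scaleC_op_add_right[of a 0 "0 :: 'h bounded_op"] by simp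

lemma scaleC_op_zero_left [simp]: "0 *\<^sub>C T = (0 :: 'h::chilbert_space bounded_op)"
  using scaleC_op_add_left[of 0 0 T] by simp

lemma scaleC_op_minus_one: "(-1) *\<^sub>C T = - (T :: 'h::chilbert_space bounded_op)"
  using scaleC_op_add_left[of 1 "-1" T] by (simp add: eq_neg_iff_add_eq_0 add.commute)

lemma scaleC_op_sum_right: "a *\<^sub>C (\<Sum>i\<in>I. F i) = (\<Sum>i\<in>I. a *\<^sub>C (F i :: 'h::chilbert_space bounded_op))"
  by (induction I rule: infinite_finite_induct) (simp_all add: scaleC_op_add_right)

lemma scaleC_op_sum_left: "(\<Sum>i\<in>I. f i) *\<^sub>C T = (\<Sum>i\<in>I. f i *\<^sub>C (T :: 'h::chilbert_space bounded_op))"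
  by (induction I rule: infinite_finite_induct) (simp_all add: scaleC_op_add_left)

lemma unital_subalgebra_hull: "unital_subalgebra (unital_subalgebra hull G)"
proof (rule hull_in)
  show "unital_subalgebra (\<Inter>F)" if "Ball F unital_subalgebra" for F
    using that by (simp add: unital_subalgebra_def)
qed

context
  fixes B :: "'h::chilbert_space bounded_op set"
  assumes B: "unital_subalgebra B"
begin

lemma unital_subalgebra_one: "1 \<in> B"
  and unital_subalgebra_add: "S \<in> B \<Longrightarrow> T \<in> B \<Longrightarrow> S + T \<in> B"
  and unital_subalgebra_mult: "S \<in> B \<Longrightarrow> T \<in> B \<Longrightarrow> S * T \<in> B"
  and unital_subalgebra_scaleC: "T \<in> B \<Longrightarrow> a *\<^sub>C T \<in> B"
  using B by (auto simp: unital_subalgebra_def)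

lemma unital_subalgebra_zero: "0 \<in> B"
  using unital_subalgebra_scaleC[OF unital_subalgebra_one, of 0] by simp

lemma unital_subalgebra_uminus: "T \<in> B \<Longrightarrow> - T \<in> B"
  using unital_subalgebra_scaleC[of T "-1"] by (simp add: scaleC_op_minus_one)

lemma unital_subalgebra_diff: "S \<in> B \<Longrightarrow> T \<in> B \<Longrightarrow> S - T \<in> B"
  using unital_subalgebra_add[of S "- T"] unital_subalgebra_uminus by simp

lemma unital_subalgebra_scaleR: "T \<in> B \<Longrightarrow> r *\<^sub>R T \<in> B"
  by (simp add: scaleR_bounded_op_def unital_subalgebra_scaleC)

lemma unital_subalgebra_power: "T \<in> B \<Longrightarrow> T ^ n \<in> B"
  by (induction n) (auto intro: unital_subalgebra_one unital_subalgebra_mult)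

lemma unital_subalgebra_sum: "(\<And>i. i \<in> I \<Longrightarrow> F i \<in> B) \<Longrightarrow> (\<Sum>i\<in>I. F i) \<in> B"
  by (induction I rule: infinite_finite_induct) (auto intro: unital_subalgebra_zero unital_subalgebra_add)

lemmas unital_subalgebra_closed =
  unital_subalgebra_one unital_subalgebra_zero unital_subalgebra_add unital_subalgebra_diff
  unital_subalgebra_uminus unital_subalgebra_mult unital_subalgebra_scaleC unital_subalgebra_scaleR
  unital_subalgebra_power unital_subalgebra_sum

end

lemma unital_subalgebra_commutant: "unital_subalgebra (commutant B)"
  by (auto simp: unital_subalgebra_def commutant_def algebra_simps scaleC_op_mult_left scaleC_op_mult_right)
    (metis mult.assoc)

lemma von_neumann_algebra_unital_subalgebra: "von_neumann_algebra B \<Longrightarrow> unital_subalgebra B"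
  by (metis von_neumann_algebra_def unital_subalgebra_commutant)

lemma unital_subalgebra_hull_vn_generated: "unital_subalgebra hull G \<subseteq> vn_generated G"
  unfolding vn_generated_def hull_def
  using von_neumann_algebra_unital_subalgebra by blast

section \<open>Closure properties of the algebra, positivity and Cauchy--Schwarz for the
  trace\<close>

context wstar_prob_space
begin

lemma A_vn: "von_neumann_algebra A"
  using finite_vn by (simp add: finite_von_neumann_algebra_def)

lemma A_sub: "unital_subalgebra A"
  by (rule von_neumann_algebra_unital_subalgebra[OF A_vn])

lemmas A_closed = unital_subalgebra_closed[OF A_sub]

text \<open>Inverses and square roots commute with whatever commutes with the operator itself, so
  the bicommutant property puts them into \<open>A\<close> by pure algebra.\<close>

lemma A_bicommutant: "(\<And>S. (\<forall>R\<in>A. R * S = S * R) \<Longrightarrow> S * T = T * S) \<Longrightarrow> T \<in> A"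
  using A_vn by (auto simp: von_neumann_algebra_def commutant_def set_eq_iff)

lemma A_inverse:
  assumes "T \<in> A" "S * T = 1" "T * S = 1"
  shows "S \<in> A"
proof (rule A_bicommutant)
  fix R assume "\<forall>T\<in>A. T * R = R * T"
  then have "S * (T * R) * S = S * (R * T) * S"
    using assms(1) by simp
  then have "(S * T) * R * S = S * R * (T * S)"
    by (simp add: mult.assoc)
  then show "R * S = S * R"
    by (simp add: assms)
qed

lemma A_sqrt: "T \<in> A \<Longrightarrow> 0 \<le> T \<Longrightarrow> op_sqrt T \<in> A"
  by (rule A_bicommutant) (auto intro!: op_sqrt_commute)

lemma phi_zero: "\<phi> 0 = 0"
  using scale[OF A_closed(1), of 0] by simp

lemma phi_scaleR: "T \<in> A \<Longrightarrow> \<phi> (r *\<^sub>R T) = complex_of_real r * \<phi> T"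
  by (simp add: scaleR_bounded_op_def scale)

lemma phi_uminus: "T \<in> A \<Longrightarrow> \<phi> (- T) = - \<phi> T"
  using phi_scaleR[of T "-1"] by simp

lemma phi_diff: "S \<in> A \<Longrightarrow> T \<in> A \<Longrightarrow> \<phi> (S - T) = \<phi> S - \<phi> T"
  using add[of S "- T"] by (simp add: phi_uminus A_closed)

lemma phi_sum: "(\<And>i. i \<in> I \<Longrightarrow> F i \<in> A) \<Longrightarrow> \<phi> (\<Sum>i\<in>I. F i) = (\<Sum>i\<in>I. \<phi> (F i))"
  by (induction I rule: infinite_finite_induct) (simp_all add: phi_zero add A_closed)

lemma phi_positive:
  assumes "T \<in> A" "0 < T"
  shows "Im (\<phi> T) = 0" "0 < Re (\<phi> T)"
proof -
  have T: "0 \<le> T" "T \<noteq> 0" using assms(2) by auto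
  have im: "Im (\<phi> T) = 0" "0 \<le> Re (\<phi> T)"
    using positive[OF assms(1) T(1)] by (auto simp: complex_nonneg_Reals_iff)
  \<comment> \<open>Faithfulness speaks of \<open>adj S * S\<close>, so \<open>T\<close> is
    presented as the square of its self-adjoint root.\<close>
  have "\<phi> T \<noteq> 0"
  proof
    assume "\<phi> T = 0"
    moreover have "adj (op_sqrt T) = op_sqrt T"
      by (intro adj_eqI op_nonneg_is_adjoint op_sqrt_nonneg T)
    ultimately have "op_sqrt T = 0"
      by (intro faithful A_sqrt assms T) (simp add: op_sqrt_square T)
    then show False using op_sqrt_square[OF T(1)] T(2) by simp
  qed
  with im show "Im (\<phi> T) = 0" "0 < Re (\<phi> T)" by (auto simp: complex_eq_iff)
qed

text \<open>The Cauchy--Schwarz argument below avoids adjoints of arbitrary operators, so the Riesz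
  representation theorem is not needed.\<close>

lemma phi_eq_0_if_factors:
  assumes Z: "Z' \<in> A" "Z \<in> A" "is_adjoint Z' Z"
    and S: "\<And>n. S n \<in> A" "\<And>n. is_adjoint (S n) (S n)" "(\<lambda>n. Re (\<phi> (S n * S n))) \<longlonglongrightarrow> 0"
    and p: "\<And>n. \<phi> (S n * Z) = p"
  shows "p = 0"
proof (rule ccontr)
  assume p0: "p \<noteq> 0"
  define z where "z = Re (\<phi> (Z' * Z))"
  have pos: "0 \<le> Re (\<phi> T)" "Im (\<phi> T) = 0" if "T \<in> A" "0 \<le> T" for T
    using positive[OF that] by (auto simp: complex_nonneg_Reals_iff)
  have expand: "\<phi> ((S n + cnj e *\<^sub>C Z') * (S n + e *\<^sub>C Z)) =
      \<phi> (S n * S n) + e * p + cnj e * \<phi> (Z' * S n) + (cnj e * e) * \<phi> (Z' * Z)" for e n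
  proof -
    have "(S n + cnj e *\<^sub>C Z') * (S n + e *\<^sub>C Z)
        = S n * S n + e *\<^sub>C (S n * Z) + cnj e *\<^sub>C (Z' * S n) + (cnj e * e) *\<^sub>C (Z' * Z)"
      by (simp add: algebra_simps scaleC_op_mult_left scaleC_op_mult_right scaleC_op_scaleC scaleC_op_add_right)
    then show ?thesis by (simp add: add scale A_closed Z S p)
  qed
  have mem: "(S n + cnj e *\<^sub>C Z') * (S n + e *\<^sub>C Z) \<in> A" for e n
    by (intro A_closed Z S)
  have nn: "0 \<le> (S n + cnj e *\<^sub>C Z') * (S n + e *\<^sub>C Z)" for e n
    by (intro op_adjoint_mult_nonneg is_adjoint_add is_adjoint_scaleC Z S)
  have SS: "Im (\<phi> (S n * S n)) = 0" for n
    by (intro pos op_adjoint_mult_nonneg A_closed S)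
  have ZZ: "Im (\<phi> (Z' * Z)) = 0" "0 \<le> z"
    unfolding z_def by (intro pos op_adjoint_mult_nonneg A_closed Z)+
  \<comment> \<open>Reality of the trace at \<open>e = 1\<close> and at \<open>e = \<i>\<close>
    forces the two cross terms to be conjugate; this is how hermitian symmetry of
    \<open>\<phi>\<close> is obtained.\<close>
  have r: "\<phi> (Z' * S n) = cnj p" for n
  proof -
    have "Im (\<phi> ((S n + cnj e *\<^sub>C Z') * (S n + e *\<^sub>C Z))) = 0" for e
      by (rule pos[OF mem nn])
    from this[of 1] this[of \<i>] show ?thesis
      unfolding expand by (simp add: SS ZZ complex_eq_iff)
  qed
  have key: "2 * l * (cmod p)\<^sup>2 - l\<^sup>2 * (cmod p)\<^sup>2 * z \<le> Re (\<phi> (S n * S n))" for l n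
  proof -
    \<comment> \<open>With this phase both cross terms have real part
      \<open>- l * (cmod p)\<^sup>2\<close>.\<close>
    define e where "e = complex_of_real (- l) * cnj p"
    have ep: "Re (e * p) = - l * (cmod p)\<^sup>2"
      unfolding e_def cmod_power2 by (simp add: power2_eq_square algebra_simps)
    have ee: "cnj e * e = complex_of_real (l\<^sup>2 * (cmod p)\<^sup>2)"
      unfolding e_def cmod_power2 by (simp add: complex_eq_iff power2_eq_square algebra_simps)
    have "0 \<le> Re (\<phi> ((S n + cnj e *\<^sub>C Z') * (S n + e *\<^sub>C Z)))"
      by (rule pos[OF mem nn])
    also have "\<dots> = Re (\<phi> (S n * S n)) + Re (e * p) + Re (cnj (e * p)) + l\<^sup>2 * (cmod p)\<^sup>2 * z"
      unfolding expand ee r z_def by simp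
    finally show ?thesis unfolding cnj.simps ep by (simp add: algebra_simps)
  qed
  have "2 * l * (cmod p)\<^sup>2 - l\<^sup>2 * (cmod p)\<^sup>2 * z \<le> 0" for l
    by (rule LIMSEQ_le_const[OF S(3)]) (use key in blast)
  \<comment> \<open>The gain \<open>2 * l\<close> must beat the loss \<open>l\<^sup>2 * z\<close>;
    \<open>l = 1 / (z + 1)\<close> does so, also for \<open>z = 0\<close>.\<close>
  from this[of "1 / (z + 1)"] have "(z + 1)\<^sup>2 * (2 * (1 / (z + 1)) * (cmod p)\<^sup>2 - (1 / (z + 1))\<^sup>2 * (cmod p)\<^sup>2 * z) \<le> 0"
    by (intro mult_nonneg_nonpos) auto
  also have "(z + 1)\<^sup>2 * (2 * (1 / (z + 1)) * (cmod p)\<^sup>2 - (1 / (z + 1))\<^sup>2 * (cmod p)\<^sup>2 * z) = (cmod p)\<^sup>2 * (2 * (z + 1) - z)"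
    using ZZ(2) by (simp add: power2_eq_square field_simps add_nonneg_eq_0_iff)
  finally have "(cmod p)\<^sup>2 * (2 * (z + 1) - z) \<le> 0" .
  then show False
    using p0 ZZ(2) by (simp add: mult_le_0_iff)
qed

text \<open>Orthogonality to all powers of \<open>U\<close> is extended to
  \<open>y = (1 - U)^{-1}\<close>. Since \<open>U * y = y - 1\<close>, the value
  \<open>\<phi> (U ^ n * (y * D))\<close> does not depend on \<open>n\<close>, while
  \<open>\<phi> (U ^ n * U ^ n)\<close> tends to 0; \<open>phi_eq_0_if_factors\<close> then makes
  the constant value 0.\<close>

lemma phi_inverse_limit:
  fixes U y D :: "'h bounded_op"
  assumes U: "U \<in> A" "0 \<le> U" "U \<le> 1" and y: "y * (1 - U) = 1" "(1 - U) * y = 1"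
    and D: "D \<in> A" "D' \<in> A" "is_adjoint D' D"
    and 0: "\<And>k. \<phi> (U ^ k * D) = 0"
  shows "\<phi> (y * D) = 0"
proof -
  have yA: "y \<in> A" by (rule A_inverse[OF _ y]) (intro A_closed U)
  have Uadj: "is_adjoint U U" using U(2) by (rule op_nonneg_is_adjoint)
  have Wadj: "is_adjoint (1 - U) (1 - U)" by (intro is_adjoint_diff is_adjoint_one Uadj)
  have yadj: "is_adjoint y y" by (rule is_adjoint_inverse[OF Wadj y])
  define k where "k = max 1 (norm y)"
  have k: "k \<ge> 1" "norm y \<le> k" by (simp_all add: k_def)
  \<comment> \<open>The gap below 1: \<open>norm x \<le> k * norm (op_apply (1 - U) x)\<close>
    together with \<open>norm_op_apply_sq_le\<close> for \<open>1 - U\<close> gives \<open>(norm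
    x)\<^sup>2 \<le> k\<^sup>2 * inner x (op_apply (1 - U) x)\<close>. Taking
    \<open>k \<ge> 1\<close> keeps \<open>q\<close> nonnegative.\<close>
  define q where "q = 1 - 1 / k\<^sup>2"
  have q: "0 \<le> q" "q < 1" using k by (simp_all add: q_def)
  have "U \<le> q *\<^sub>R 1"
  proof -
    have "inner x (op_apply U x) \<le> q * inner x x" for x
    proof -
      have "op_apply (y * (1 - U)) x = x"
        by (simp only: y one_bounded_op.rep_eq)
      then have "norm x = norm (op_apply y (op_apply (1 - U) x))"
        by (simp add: times_bounded_op.rep_eq)
      also have "\<dots> \<le> norm y * norm (op_apply (1 - U) x)"
        by (rule norm_op_apply_le)
      also have "\<dots> \<le> k * norm (op_apply (1 - U) x)"
        using k by (intro mult_right_mono) auto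
      finally have "(norm x)\<^sup>2 \<le> k\<^sup>2 * (norm (op_apply (1 - U) x))\<^sup>2"
        using power_mono[of "norm x" "k * norm (op_apply (1 - U) x)" 2] by (simp add: power_mult_distrib)
      also have "(norm (op_apply (1 - U) x))\<^sup>2 \<le> 1 * inner x (op_apply (1 - U) x)"
        using U(2,3) by (intro norm_op_apply_sq_le) (simp_all add: op_le_iff_diff_nonneg[of U] op_le_iff_diff_nonneg[of "1 - U"])
      finally have "(norm x)\<^sup>2 \<le> k\<^sup>2 * inner x (op_apply (1 - U) x)"
        by (simp add: mult_left_mono)
      then show ?thesis
        using k by (simp add: q_def minus_bounded_op.rep_eq one_bounded_op.rep_eq inner_diff_right
            power2_norm_eq_inner field_simps)
    qed
    then show ?thesis
      using Uadj by (simp add: op_le_iff_diff_nonneg[of U] op_nonneg_iff minus_bounded_op.rep_eq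
        op_apply_scaleR one_bounded_op.rep_eq inner_diff_right is_adjoint_diff is_adjoint_scaleR is_adjoint_one)
  qed
  then have nU: "norm U \<le> q" using U q by (intro norm_op_le)
  have lim: "(\<lambda>n. Re (\<phi> (U ^ n * U ^ n))) \<longlonglongrightarrow> 0"
  proof (rule tendsto_sandwich[OF _ _ tendsto_const])
    have Un: "is_adjoint (U ^ n) (U ^ n)" for n by (rule is_adjoint_power[OF Uadj])
    show "\<forall>\<^sub>F n in sequentially. 0 \<le> Re (\<phi> (U ^ n * U ^ n))"
      using positive[OF _ op_adjoint_mult_nonneg[OF Un]]
      by (auto simp: complex_nonneg_Reals_iff A_closed U)
    show "\<forall>\<^sub>F n in sequentially. Re (\<phi> (U ^ n * U ^ n)) \<le> q ^ n"
    proof (intro always_eventually allI)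
      fix n
      have "norm (U ^ n * U ^ n) \<le> norm (U ^ n) * norm (U ^ n)" by (rule norm_mult_ineq)
      also have "\<dots> \<le> q ^ n * q ^ n"
        using nU q by (intro mult_mono order_trans[OF norm_power_ineq] power_mono) auto
      also have "\<dots> \<le> q ^ n" using q by (intro mult_left_le power_le_one) auto
      finally have n: "norm (U ^ n * U ^ n) \<le> q ^ n" .
      have "0 \<le> norm (U ^ n * U ^ n) *\<^sub>R 1 - U ^ n * U ^ n"
        using op_le_norm[OF is_adjoint_mult[OF Un Un]] by (simp only: op_le_iff_diff_nonneg[of "_ * _"])
      then have "0 \<le> Re (\<phi> (norm (U ^ n * U ^ n) *\<^sub>R 1 - U ^ n * U ^ n))"
        using positive[of "norm (U ^ n * U ^ n) *\<^sub>R 1 - U ^ n * U ^ n"]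
        by (simp add: complex_nonneg_Reals_iff A_closed U)
      then show "Re (\<phi> (U ^ n * U ^ n)) \<le> q ^ n"
        using n by (simp add: phi_diff phi_scaleR unital A_closed U)
    qed
    show "(\<lambda>n. q ^ n) \<longlonglongrightarrow> 0" using q by (intro LIMSEQ_power_zero) auto
  qed
  have step: "\<phi> (U ^ n * (y * D)) = \<phi> (y * D)" for n
  proof (induction n)
    case (Suc n)
    have Uy: "U * y = y - 1" using y by (simp add: algebra_simps)
    have "U ^ Suc n * (y * D) = U ^ n * ((U * y) * D)"
      by (simp only: power_Suc2 mult.assoc)
    also have "\<dots> = U ^ n * (y * D) - U ^ n * D"
      unfolding Uy by (simp add: algebra_simps)
    finally have "U ^ Suc n * (y * D) = U ^ n * (y * D) - U ^ n * D" .
    then show ?case by (simp add: Suc phi_diff A_closed U D yA 0 del: power_Suc)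
  qed simp
  show ?thesis
    by (rule phi_eq_0_if_factors[OF _ _ is_adjoint_mult[OF yadj D(3)] _ is_adjoint_power[OF Uadj] lim step])
      (intro A_closed D yA U)+
qed

end

section \<open>Formal power series of free operators\<close>

text \<open>Scalar series are embedded as central elements of the ring of operator valued series.\<close>

definition fps_emb :: "complex fps \<Rightarrow> 'h::chilbert_space bounded_op fps"
  where "fps_emb f = Abs_fps (\<lambda>n. (f $ n) *\<^sub>C 1)"

lemma fps_emb_nth [simp]: "fps_emb f $ n = (f $ n) *\<^sub>C 1"
  by (simp add: fps_emb_def)

lemma fps_emb_mult_nth: "(fps_emb f * F) $ n = (\<Sum>i=0..n. (f $ i) *\<^sub>C (F $ (n - i)))"
  by (simp add: fps_mult_nth scaleC_op_mult_left)

lemma fps_emb_add: "fps_emb (f + g) = fps_emb f + fps_emb g"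
  by (rule fps_ext) (simp add: scaleC_op_add_left)

lemma fps_emb_mult: "fps_emb (f * g) = fps_emb f * fps_emb g"
  by (rule fps_ext) (simp add: fps_emb_mult_nth scaleC_op_scaleC fps_mult_nth[of f] scaleC_op_sum_left)

lemma fps_emb_1: "fps_emb 1 = 1"
  by (rule fps_ext) simp

lemma fps_emb_X: "fps_emb fps_X = fps_X"
  by (rule fps_ext) (simp add: fps_X_def)

lemma fps_emb_commute: "F * fps_emb f = fps_emb f * F"
proof (rule fps_ext)
  fix n
  have "(F * fps_emb f) $ n = (\<Sum>i=0..n. (f $ (n - i)) *\<^sub>C (F $ i))"
    by (simp add: fps_mult_nth scaleC_op_mult_right)
  also have "\<dots> = (\<Sum>i=0..n. (f $ i) *\<^sub>C (F $ (n - i)))"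
    by (subst sum.atLeastAtMost_rev) (auto intro: sum.cong)
  finally show "(F * fps_emb f) $ n = (fps_emb f * F) $ n"
    by (simp add: fps_emb_mult_nth)
qed

lemma fps_emb_left_commute: "F * (fps_emb f * G) = fps_emb f * (F * G)"
  by (metis fps_emb_commute mult.assoc)

text \<open>The formal resolvent \<open>(1 - f T)^{-1}\<close>. If \<open>f\<close> has no constant
  term, then \<open>f ^ k\<close> starts in degree \<open>k\<close>, so cutting the sum at
  \<open>k = n\<close> loses nothing in degree \<open>n\<close>.\<close>

definition fps_geometric :: "complex fps \<Rightarrow> 'h::chilbert_space bounded_op \<Rightarrow> 'h bounded_op fps"
  where "fps_geometric f T = Abs_fps (\<lambda>n. \<Sum>k=0..n. ((f ^ k) $ n) *\<^sub>C T ^ k)"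

lemma fps_geometric_nth: "fps_geometric f T $ n = (\<Sum>k=0..n. ((f ^ k) $ n) *\<^sub>C T ^ k)"
  by (simp add: fps_geometric_def)

lemma fps_geometric_rec:
  assumes f: "f $ 0 = 0"
  shows "fps_geometric f T = 1 + fps_emb f * (fps_const T * fps_geometric f T)"
proof (rule fps_ext)
  fix n
  have vanish: "f ^ k $ m = 0" if "m < k" for k m
    using startsby_zero_power_prefix[OF f] that by blast
  have ext: "fps_geometric f T $ m = (\<Sum>k=0..n. (f ^ k $ m) *\<^sub>C T ^ k)" if "m \<le> n" for m
    unfolding fps_geometric_nth using that by (intro sum.mono_neutral_left) (auto simp: vanish)
  have "(fps_emb f * (fps_const T * fps_geometric f T)) $ n
      = (\<Sum>i=0..n. (f $ i) *\<^sub>C (T * (\<Sum>k=0..n. (f ^ k $ (n - i)) *\<^sub>C T ^ k)))"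
    by (simp add: fps_emb_mult_nth ext)
  also have "\<dots> = (\<Sum>i=0..n. \<Sum>k=0..n. (f $ i * f ^ k $ (n - i)) *\<^sub>C T ^ Suc k)"
    by (simp add: sum_distrib_left scaleC_op_mult_right scaleC_op_sum_right scaleC_op_scaleC)
  also have "\<dots> = (\<Sum>k=0..n. (f ^ Suc k $ n) *\<^sub>C T ^ Suc k)"
    by (subst sum.swap) (simp add: fps_mult_nth[of f] scaleC_op_sum_left)
  also have "\<dots> = (\<Sum>k=1..Suc n. ((f ^ k) $ n) *\<^sub>C T ^ k)"
    by (simp only: One_nat_def sum.shift_bounds_cl_Suc_ivl)
  also have "\<dots> = (\<Sum>k=1..n. ((f ^ k) $ n) *\<^sub>C T ^ k)"
    by (simp add: vanish del: power_Suc)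
  finally have *: "(fps_emb f * (fps_const T * fps_geometric f T)) $ n = (\<Sum>k=1..n. ((f ^ k) $ n) *\<^sub>C T ^ k)" .
  show "fps_geometric f T $ n = (1 + fps_emb f * (fps_const T * fps_geometric f T)) $ n"
    unfolding fps_add_nth * fps_geometric_nth by (simp add: sum.atLeast_Suc_atMost)
qed

lemma fps_geometric_commute: "fps_geometric f T * fps_const T = fps_const T * fps_geometric f T"
  by (rule fps_ext)
    (simp add: fps_geometric_nth sum_distrib_left sum_distrib_right scaleC_op_mult_left
      scaleC_op_mult_right power_commutes)

lemma fps_geometric_inverse:
  assumes "f $ 0 = 0"
  shows "(1 - fps_emb f * fps_const T) * fps_geometric f T = 1"
    and "fps_geometric f T * (1 - fps_emb f * fps_const T) = 1"
  using fps_geometric_rec[OF assms, of T]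
  by (simp_all add: algebra_simps fps_emb_left_commute fps_geometric_commute)

definition fps_valued :: "'h::chilbert_space bounded_op set \<Rightarrow> 'h bounded_op fps set"
  where "fps_valued B = {F. \<forall>n. F $ n \<in> B}"

lemma fps_valued_mono: "B \<subseteq> C \<Longrightarrow> F \<in> fps_valued B \<Longrightarrow> F \<in> fps_valued C"
  by (auto simp: fps_valued_def)

lemma fps_valued_shift: "F \<in> fps_valued B \<Longrightarrow> fps_shift k F \<in> fps_valued B"
  by (simp add: fps_valued_def)

lemma fps_valued_closed:
  assumes B: "unital_subalgebra B"
  shows "F \<in> fps_valued B \<Longrightarrow> G \<in> fps_valued B \<Longrightarrow> F + G \<in> fps_valued B"
    and "F \<in> fps_valued B \<Longrightarrow> G \<in> fps_valued B \<Longrightarrow> F - G \<in> fps_valued B"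
    and "F \<in> fps_valued B \<Longrightarrow> G \<in> fps_valued B \<Longrightarrow> F * G \<in> fps_valued B"
    and "fps_emb f \<in> fps_valued B"
    and "1 \<in> fps_valued B"
    and "fps_X \<in> fps_valued B"
    and "T \<in> B \<Longrightarrow> fps_const T \<in> fps_valued B"
    and "T \<in> B \<Longrightarrow> fps_geometric f T \<in> fps_valued B"
  by (auto simp: fps_valued_def fps_mult_nth fps_geometric_nth fps_X_def fps_one_def
      intro!: unital_subalgebra_closed[OF B])

lemma fps_valued_power:
  assumes "unital_subalgebra B" "F \<in> fps_valued B"
  shows "F ^ n \<in> fps_valued B"
  by (induction n) (auto intro: fps_valued_closed assms)

context wstar_prob_space
begin

definition Phi :: "'h bounded_op fps \<Rightarrow> complex fps"
  where "Phi F = Abs_fps (\<lambda>n. \<phi> (F $ n))"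

lemma Phi_nth [simp]: "Phi F $ n = \<phi> (F $ n)"
  by (simp add: Phi_def)

lemma Phi_add: "F \<in> fps_valued A \<Longrightarrow> G \<in> fps_valued A \<Longrightarrow> Phi (F + G) = Phi F + Phi G"
  by (rule fps_ext) (simp add: fps_valued_def add)

lemma Phi_diff: "F \<in> fps_valued A \<Longrightarrow> G \<in> fps_valued A \<Longrightarrow> Phi (F - G) = Phi F - Phi G"
  by (rule fps_ext) (simp add: fps_valued_def phi_diff)

lemma Phi_emb_mult: "F \<in> fps_valued A \<Longrightarrow> Phi (fps_emb f * F) = f * Phi F"
  by (rule fps_ext)
    (simp add: fps_emb_mult_nth fps_valued_def phi_sum A_closed scale fps_mult_nth scaleC_op_mult_left)

lemma Phi_emb: "Phi (fps_emb f) = f"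
  by (rule fps_ext) (simp add: scale A_closed unital)

lemma Phi_X_mult: "F \<in> fps_valued A \<Longrightarrow> Phi (fps_X * F) = fps_X * Phi F"
  using Phi_emb_mult[of F fps_X] by (simp add: fps_emb_X)

lemma Phi_tracial:
  assumes "F \<in> fps_valued A" "G \<in> fps_valued A"
  shows "Phi (F * G) = Phi (G * F)"
proof (rule fps_ext)
  fix n
  have "Phi (F * G) $ n = (\<Sum>i=0..n. \<phi> (F $ i * G $ (n - i)))"
    using assms by (simp add: fps_mult_nth phi_sum fps_valued_def A_closed)
  also have "\<dots> = (\<Sum>i=0..n. \<phi> (G $ (n - i) * F $ i))"
    using assms by (intro sum.cong tracial) (auto simp: fps_valued_def)
  also have "\<dots> = (\<Sum>i=0..n. \<phi> (G $ i * F $ (n - i)))"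
    by (subst sum.atLeastAtMost_rev) (auto intro: sum.cong)
  also have "\<dots> = Phi (G * F) $ n"
    using assms by (simp add: fps_mult_nth phi_sum fps_valued_def A_closed)
  finally show "Phi (F * G) $ n = Phi (G * F) $ n" .
qed

text \<open>Taking the trace of a formal resolvent amounts to substitution into a moment series.
  With \<open>x = 1\<close>, the condition \<open>Phi (fps_geometric u S) = 1 + fps_X\<close>
  therefore says that \<open>u\<close> inverts the moment series of \<open>S\<close>.\<close>

lemma Phi_geometric:
  assumes "x \<in> A" "T \<in> A"
  shows "Phi (fps_const x * fps_geometric f T) = Abs_fps (\<lambda>k. \<phi> (x * T ^ k)) oo f"
  by (rule fps_ext)
    (simp add: fps_compose_nth fps_geometric_nth sum_distrib_left phi_sum assms A_closed
      scaleC_op_mult_right scale mult.commute)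

end

section \<open>Alternating words in two free algebras, and formal subordination\<close>

locale free_algebras = wstar_prob_space A \<phi>
  for A :: "'h::chilbert_space bounded_op set" and \<phi> +
  fixes alg :: "bool \<Rightarrow> 'h bounded_op set"
  assumes alg_sub: "unital_subalgebra (alg i)"
    and alg_A: "alg i \<subseteq> A"
    and free_alg: "free_subalgebras \<phi> alg"
begin

text \<open>\<open>alternating i P\<close>: \<open>P\<close> is a sum of alternating products of centred elements whose first factors
  all lie in \<open>alg i\<close>.\<close>

inductive alternating :: "bool \<Rightarrow> 'h bounded_op \<Rightarrow> bool" where
  single: "x \<in> alg i \<Longrightarrow> \<phi> x = 0 \<Longrightarrow> alternating i x"
| cons: "x \<in> alg i \<Longrightarrow> \<phi> x = 0 \<Longrightarrow> alternating (\<not> i) P \<Longrightarrow> alternating i (x * P)"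
| plus: "alternating i P \<Longrightarrow> alternating i Q \<Longrightarrow> alternating i (P + Q)"

definition word :: "(bool \<times> 'h bounded_op) list \<Rightarrow> bool"
  where "word ws \<longleftrightarrow> (\<forall>(i, T)\<in>set ws. T \<in> alg i \<and> \<phi> T = 0) \<and>
    (\<forall>k. Suc k < length ws \<longrightarrow> fst (ws ! k) \<noteq> fst (ws ! Suc k))"

lemma word_snoc:
  assumes "word ws" "ws \<noteq> [] \<Longrightarrow> fst (last ws) \<noteq> i" "x \<in> alg i" "\<phi> x = 0"
  shows "word (ws @ [(i, x)])"
  unfolding word_def
proof (intro conjI allI impI)
  show "\<forall>(j, T)\<in>set (ws @ [(i, x)]). T \<in> alg j \<and> \<phi> T = 0"
    using assms by (auto simp: word_def)
  fix k assume k: "Suc k < length (ws @ [(i, x)])"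
  show "fst ((ws @ [(i, x)]) ! k) \<noteq> fst ((ws @ [(i, x)]) ! Suc k)"
  proof (cases "Suc k < length ws")
    case True
    then show ?thesis using assms(1) by (simp add: word_def nth_append)
  next
    case False
    with k have k': "Suc k = length ws" "ws \<noteq> []" by auto
    then have "last ws = ws ! k" by (metis last_conv_nth diff_Suc_1)
    then show ?thesis using assms(2) k' by (simp add: nth_append)
  qed
qed

lemma alternating_A: "alternating i P \<Longrightarrow> P \<in> A"
  by (induction rule: alternating.induct) (use alg_A in \<open>auto intro: A_closed\<close>)

lemma word_A: "word ws \<Longrightarrow> prod_list (map snd ws) \<in> A"
proof (induction ws)
  case (Cons w ws)
  have "word ws"
    using Cons.prems by (force simp: word_def)
  moreover have "snd w \<in> A"
    using Cons.prems alg_A by (auto simp: word_def split: prod.splits)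
  ultimately show ?case using Cons.IH by (auto intro: A_closed)
qed (simp add: A_closed)

text \<open>The prefix \<open>ws\<close> makes the induction work: \<open>cons\<close> moves its
  first factor to the end of the word, and at \<open>single\<close> the whole product is one word to
  which freeness applies.\<close>

lemma phi_word_alternating:
  "alternating i P \<Longrightarrow> word ws \<Longrightarrow> (ws \<noteq> [] \<Longrightarrow> fst (last ws) \<noteq> i)
    \<Longrightarrow> \<phi> (prod_list (map snd ws) * P) = 0"
proof (induction arbitrary: ws rule: alternating.induct)
  case (single x i)
  then have "word (ws @ [(i, x)])" by (intro word_snoc)
  then have "\<phi> (prod_list (map snd (ws @ [(i, x)]))) = 0"
    using free_alg unfolding free_subalgebras_def word_def by blast
  then show ?case by simp
next
  case (cons x i P)
  then have "word (ws @ [(i, x)])" by (intro word_snoc)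
  then have "\<phi> (prod_list (map snd (ws @ [(i, x)])) * P) = 0"
    by (intro cons.IH) auto
  then show ?case by (simp add: mult.assoc)
next
  case (plus i P Q)
  then show ?case
    by (simp add: distrib_left add A_closed word_A alternating_A)
qed

lemma phi_alternating: "alternating i P \<Longrightarrow> \<phi> P = 0"
  using phi_word_alternating[of i P "[]"] by (simp add: word_def)

lemma alternating_zero: "alternating i 0"
  by (rule single) (simp_all add: phi_zero unital_subalgebra_closed[OF alg_sub])

lemma alternating_sum: "(\<And>j. j \<in> J \<Longrightarrow> alternating i (F j)) \<Longrightarrow> alternating i (\<Sum>j\<in>J. F j)"
  by (induction J rule: infinite_finite_induct) (auto intro: alternating_zero plus)

definition fps_alternating :: "bool \<Rightarrow> 'h bounded_op fps \<Rightarrow> bool"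
  where "fps_alternating i F \<longleftrightarrow> (\<forall>n. alternating i (F $ n))"

lemma valued_A: "F \<in> fps_valued (alg i) \<Longrightarrow> F \<in> fps_valued A"
  by (rule fps_valued_mono[OF alg_A])

lemma fps_alternating_A: "fps_alternating i F \<Longrightarrow> F \<in> fps_valued A"
  by (auto simp: fps_alternating_def fps_valued_def intro: alternating_A)

lemma Phi_alternating: "fps_alternating i F \<Longrightarrow> Phi F = 0"
  by (rule fps_ext) (auto simp: fps_alternating_def intro: phi_alternating)

lemma fps_alternating_single: "F \<in> fps_valued (alg i) \<Longrightarrow> Phi F = 0 \<Longrightarrow> fps_alternating i F"
  by (auto simp: fps_alternating_def fps_valued_def fps_eq_iff intro: single)

lemma fps_alternating_cons:
  "F \<in> fps_valued (alg i) \<Longrightarrow> Phi F = 0 \<Longrightarrow> fps_alternating (\<not> i) G \<Longrightarrow> fps_alternating i (F * G)"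
  by (auto simp: fps_alternating_def fps_valued_def fps_eq_iff fps_mult_nth
      intro!: alternating_sum cons)

text \<open>Splitting off the central scalar \<open>Phi F\<close> leaves a centred factor, whose
  product with \<open>G\<close> is alternating; the scalar part only multiplies
  \<open>Phi G\<close>, which is 0.\<close>

lemma Phi_mult_alternating:
  assumes F: "F \<in> fps_valued (alg i)" and G: "fps_alternating (\<not> i) G"
  shows "Phi (F * G) = 0"
proof -
  let ?F = "F - fps_emb (Phi F)"
  have F': "?F \<in> fps_valued (alg i)"
    by (intro fps_valued_closed alg_sub F)
  have "Phi ?F = 0"
    using F by (simp add: Phi_diff Phi_emb valued_A fps_valued_closed[OF A_sub])
  then have alt: "fps_alternating i (?F * G)"
    by (intro fps_alternating_cons F' G)
  have "F * G = ?F * G + fps_emb (Phi F) * G"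
    by (simp add: algebra_simps)
  also have "Phi \<dots> = Phi (?F * G) + Phi F * Phi G"
    using alt G by (simp add: Phi_add Phi_emb_mult fps_alternating_A fps_valued_closed[OF A_sub])
  finally show ?thesis
    using Phi_alternating[OF alt] Phi_alternating[OF G] by simp
qed

lemma phi_mult_free:
  assumes x: "x \<in> alg i" and z: "z \<in> alg (\<not> i)"
  shows "\<phi> (x * z) = \<phi> x * \<phi> z"
proof -
  let ?x = "x - \<phi> x *\<^sub>C 1" and ?z = "z - \<phi> z *\<^sub>C 1"
  have A: "x \<in> A" "z \<in> A" using x z alg_A by auto
  have "\<phi> ?x = 0" "\<phi> ?z = 0"
    using A by (simp_all add: phi_diff scale A_closed unital)
  moreover have "?x \<in> alg i" "?z \<in> alg (\<not> i)"
    using x z by (auto intro!: unital_subalgebra_closed[OF alg_sub])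
  ultimately have 0: "\<phi> (?x * ?z) = 0"
    using phi_alternating[OF cons[OF _ _ single], of ?x i ?z] by simp
  have "x * z = ?x * ?z + \<phi> x *\<^sub>C z + \<phi> z *\<^sub>C x - (\<phi> x * \<phi> z) *\<^sub>C 1"
    by (simp add: algebra_simps scaleC_op_mult_left scaleC_op_mult_right scaleC_op_scaleC
        scaleC_op_diff_right)
  also have "\<phi> \<dots> = \<phi> x * \<phi> z"
    using 0 A by (simp add: phi_diff add scale A_closed unital)
  finally show ?thesis .
qed

end

lemma (in wstar_prob_space) free_algebras_hull:
  assumes "U \<in> A" "V \<in> A" "free \<phi> U V"
  shows "free_algebras A \<phi> (\<lambda>i. unital_subalgebra hull {if i then U else V})"
proof
  show "unital_subalgebra (unital_subalgebra hull {if i then U else V})" for i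
    by (rule unital_subalgebra_hull)
  show "unital_subalgebra hull {if i then U else V} \<subseteq> A" for i
    by (rule hull_minimal) (use assms A_sub in auto)
  show "free_subalgebras \<phi> (\<lambda>i. unital_subalgebra hull {if i then U else V})"
    using assms(3) by (simp add: free_def)
qed

context free_algebras
begin

text \<open>Division by the trace \<open>1 + fps_X\<close> leaves a series of trace 1 whose constant
  coefficient is 1. Its excess over 1 is divisible by \<open>fps_X\<close>, and the quotient
  \<open>F\<close> is centred. The extracted \<open>fps_X\<close> is the source of the small factor
  in the later expansion.\<close>

lemma normalized_geometric:
  assumes S: "S \<in> alg i" and u: "u $ 0 = 0" and Phi_a: "Phi (fps_geometric u S) = 1 + fps_X"
  obtains F where "F \<in> fps_valued (alg i)" "Phi F = 0"
    "fps_geometric u S = fps_emb (1 + fps_X) * (1 + fps_X * F)"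
proof -
  let ?a = "fps_geometric u S" and ?g = "fps_emb (inverse (1 + fps_X))"
  define F where "F = fps_shift 1 (?g * ?a - 1)"
  have a: "?a \<in> fps_valued (alg i)"
    by (intro fps_valued_closed alg_sub S)
  have F: "F \<in> fps_valued (alg i)"
    unfolding F_def by (intro fps_valued_shift fps_valued_closed alg_sub a)
  have inv: "inverse (1 + fps_X) * (1 + fps_X) = (1 :: complex fps)"
    by (rule inverse_mult_eq_1) simp
  have "(?g * ?a - 1) $ 0 = 0"
    by (simp add: fps_geometric_nth)
  then have XF: "fps_X * F = ?g * ?a - 1"
    unfolding F_def by (intro fps_ext) (auto simp: fps_X_mult_nth)
  have "fps_emb (1 + fps_X) * (1 + fps_X * F) = fps_emb ((1 + fps_X) * inverse (1 + fps_X)) * ?a"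
    unfolding XF by (simp add: fps_emb_mult mult.assoc)
  then have eq: "?a = fps_emb (1 + fps_X) * (1 + fps_X * F)"
    using inv by (simp add: mult.commute[of _ "inverse _"] fps_emb_1)
  have "fps_X * Phi F = Phi (?g * ?a - fps_emb 1)"
    using F XF by (simp add: Phi_X_mult[symmetric] valued_A fps_emb_1)
  also have "\<dots> = 0"
    using a by (simp add: Phi_diff Phi_emb_mult Phi_emb valued_A fps_valued_closed[OF A_sub] Phi_a inv)
  finally have "Phi F = 0" by simp
  with that F eq show thesis by blast
qed

text \<open>A formal version of Haagerup's proof of the multiplicativity of the \<open>S\<close>-transform. The variable is
  the common value of the two moment series at \<open>u\<close> and \<open>v\<close>; write \<open>h = 1 + X\<close>. In terms of the
  centred series \<open>F\<close> and \<open>G\<close> one has \<open>b (1 - \<zeta> T S) a = h (1 - K)\<close> with \<open>K = X h G F\<close>. Expanding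
  in powers of \<open>K\<close> leaves only alternating words, up to cyclic permutation, besides the leading term.\<close>

theorem subordination:
  assumes S: "S \<in> alg i" and T: "T \<in> alg (\<not> i)" and x: "x \<in> alg i"
    and u: "u $ 0 = 0" "Phi (fps_geometric u S) = 1 + fps_X"
    and v: "v $ 0 = 0" "Phi (fps_geometric v T) = 1 + fps_X"
    and \<zeta>: "\<zeta> $ 0 = 0" "fps_X * \<zeta> = u * v * (1 + fps_X)"
  shows "Phi (fps_const x * fps_geometric \<zeta> (T * S)) = Phi (fps_const x * fps_geometric u S)"
proof -
  define a where "a = fps_geometric u S"
  define b where "b = fps_geometric v T"
  define P where "P = fps_geometric \<zeta> (T * S)"
  define h :: "'h bounded_op fps" where "h = fps_emb (1 + fps_X)"
  define e :: "'h bounded_op fps" where "e = fps_X"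
  have h: "h = 1 + e"
    by (simp add: h_def e_def fps_emb_add fps_emb_1 fps_emb_X)
  obtain F where F: "F \<in> fps_valued (alg i)" "Phi F = 0" and aF: "a = h * (1 + e * F)"
    unfolding a_def h_def e_def using normalized_geometric[OF S u] by blast
  obtain G where G: "G \<in> fps_valued (alg (\<not> i))" "Phi G = 0" and bG: "b = h * (1 + e * G)"
    unfolding b_def h_def e_def using normalized_geometric[OF T v] by blast
  have e_comm: "Y * e = e * Y" "Y * (e * Z) = e * (Y * Z)" for Y Z :: "'h bounded_op fps"
    unfolding e_def by (metis fps_mult_fps_X_commute, metis fps_mult_fps_X_commute mult.assoc)
  have e_cancel: "Y = Z" if "e * Y = e * Z" for Y Z :: "'h bounded_op fps"
    using that fps_shift_times_fps_X'[of Y] fps_shift_times_fps_X'[of Z]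
    by (simp add: e_def fps_mult_fps_X_commute)
  have h_cancel: "Y = Z" if "h * Y = h * Z" for Y Z :: "'h bounded_op fps"
  proof -
    have "fps_emb (inverse (1 + fps_X)) * h = fps_emb (inverse (1 + fps_X) * (1 + fps_X))"
      by (simp only: h_def fps_emb_mult)
    also have "inverse (1 + fps_X) * (1 + fps_X) = (1 :: complex fps)"
      by (rule inverse_mult_eq_1) simp
    finally have "fps_emb (inverse (1 + fps_X)) * h = 1"
      by (simp add: fps_emb_1)
    then show ?thesis using that by (metis mult.assoc mult_1)
  qed
  \<comment> \<open>Since \<open>P = a * Q\<close>, the claim reduces to
    \<open>Phi (Y * Q) = Phi Y\<close> for \<open>Y = fps_const x * a\<close>.\<close>
  define Q where "Q = (1 - fps_emb u * fps_const S) * P"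
  have aQ: "a * Q = P"
    unfolding Q_def a_def mult.assoc[symmetric] fps_geometric_inverse(2)[OF u(1)] by simp
  have ua: "fps_emb u * fps_const S * a = a - 1"
    using fps_geometric_inverse(1)[OF u(1), of S] by (simp add: a_def algebra_simps)
  have bv: "b * (fps_emb v * fps_const T) = b - 1"
    using fps_geometric_inverse(2)[OF v(1), of T] by (simp add: b_def algebra_simps)
  have "b * ((1 - fps_emb \<zeta> * fps_const (T * S)) * P) = b"
    unfolding P_def fps_geometric_inverse(1)[OF \<zeta>(1)] by simp
  then have bP: "(b * (1 - fps_emb \<zeta> * fps_const (T * S)) * a) * Q = b"
    by (simp add: mult.assoc aQ)
  define K where "K = e * h * (G * F)"
  \<comment> \<open>The extra factor \<open>e\<close>, cancelled at the end, lets
    \<open>\<zeta>\<close> enter through \<open>fps_X * \<zeta>\<close>, the product given by the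
    hypothesis. The terms linear in \<open>F\<close> and in \<open>G\<close> then cancel, which
    leaves \<open>K\<close>.\<close>
  have "e * (b * (1 - fps_emb \<zeta> * fps_const (T * S)) * a)
      = e * (b * a) - (e * fps_emb \<zeta>) * (b * (fps_const T * fps_const S) * a)"
    by (simp add: algebra_simps fps_emb_left_commute[of b])
  also have "e * fps_emb \<zeta> = fps_emb (v * u * (1 + fps_X))"
    using \<zeta>(2) by (simp only: e_def fps_emb_mult[symmetric] fps_emb_X[symmetric] mult.commute[of v])
  also have "\<dots> = fps_emb v * fps_emb u * h"
    by (simp only: fps_emb_mult h_def)
  also have "fps_emb v * fps_emb u * h * (b * (fps_const T * fps_const S) * a)
      = h * ((b * (fps_emb v * fps_const T)) * (fps_emb u * fps_const S * a))"
    by (simp only: mult.assoc fps_emb_left_commute[of b] fps_emb_left_commute[of "fps_const T"]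
        fps_emb_left_commute[of h])
  also have "\<dots> = h * ((b - 1) * (a - 1))"
    by (simp only: ua bv)
  also have "e * (b * a) - h * ((b - 1) * (a - 1)) = e * (h * (1 - K))"
    unfolding aF bG K_def h by (simp add: algebra_simps e_comm(1)[of F] e_comm(1)[of G] e_comm(2)[of F] e_comm(2)[of G])
  finally have main: "b * (1 - fps_emb \<zeta> * fps_const (T * S)) * a = h * (1 - K)"
    by (rule e_cancel)
  have "h * ((1 - K) * Q) = b"
    using bP unfolding main by (simp only: mult.assoc)
  then have "h * ((1 - K) * Q) = h * (1 + e * G)"
    unfolding bG .
  from h_cancel[OF this] have Q: "Q = 1 + e * G + K * Q"
    by (simp add: algebra_simps)
  have FG_A: "F \<in> fps_valued A" "G \<in> fps_valued A"
    using F G by (auto intro: valued_A)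
  have e_A: "e \<in> fps_valued A" "h \<in> fps_valued A"
    unfolding e_def h_def by (intro fps_valued_closed A_sub)+
  have S_A: "S \<in> A" "T \<in> A" "x \<in> A"
    using S T x alg_A by auto
  have P_A: "P \<in> fps_valued A" "a \<in> fps_valued A" "a \<in> fps_valued (alg i)"
    unfolding P_def a_def by (intro fps_valued_closed A_sub alg_sub A_closed S_A S)+
  have Q_A: "Q \<in> fps_valued A"
    unfolding Q_def by (intro fps_valued_closed A_sub P_A S_A)
  have K_A: "K ^ n \<in> fps_valued A" for n
    unfolding K_def by (intro fps_valued_power fps_valued_closed A_sub e_A FG_A)
  define Y where "Y = fps_const x * a"
  have Y: "Y \<in> fps_valued (alg i)" "Y \<in> fps_valued A"
    unfolding Y_def by (intro fps_valued_closed alg_sub A_sub P_A x S_A)+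
  have alt: "fps_alternating (\<not> i) ((G * F) ^ n * G)" for n
  proof (induction n)
    case 0
    then show ?case using G by (simp add: fps_alternating_single)
  next
    case (Suc n)
    have "fps_alternating i (F * ((G * F) ^ n * G))"
      by (rule fps_alternating_cons[OF F Suc])
    then have "fps_alternating (\<not> i) (G * (F * ((G * F) ^ n * G)))"
      by (intro fps_alternating_cons[OF G]) simp
    then show ?case by (simp add: mult.assoc)
  qed
  have zero1: "Phi (Y * ((G * F) ^ n * G)) = 0" for n
    by (rule Phi_mult_alternating[OF Y(1) alt])
  \<comment> \<open>Traciality moves the last \<open>F\<close> to the front, where it merges with
    \<open>Y\<close> inside \<open>alg i\<close>; what follows is alternating and starts in the
    other algebra.\<close>
  have zero2: "Phi (Y * (G * F) ^ Suc n) = 0" for n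
  proof -
    have "Y * (G * F) ^ Suc n = (Y * ((G * F) ^ n * G)) * F"
      by (simp only: power_Suc2 mult.assoc)
    also have "Phi \<dots> = Phi ((F * Y) * ((G * F) ^ n * G))"
      unfolding mult.assoc by (subst Phi_tracial)
        (auto simp: mult.assoc intro!: fps_valued_closed A_sub Y FG_A fps_valued_power)
    also have "\<dots> = 0"
      by (rule Phi_mult_alternating[OF _ alt]) (intro fps_valued_closed alg_sub F Y)
    finally show ?thesis .
  qed
  have K_power: "K ^ n = fps_emb ((fps_X * (1 + fps_X)) ^ n) * (G * F) ^ n" for n
  proof (induction n)
    case (Suc n)
    have K': "K = fps_emb (fps_X * (1 + fps_X)) * (G * F)"
      by (simp add: K_def e_def h_def fps_emb_mult fps_emb_X)
    have "K ^ Suc n = fps_emb (fps_X * (1 + fps_X)) * (G * F) * (fps_emb ((fps_X * (1 + fps_X)) ^ n) * (G * F) ^ n)"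
      by (subst power_Suc, subst Suc) (simp only: K')
    also have "\<dots> = fps_emb ((fps_X * (1 + fps_X)) ^ Suc n) * (G * F) ^ Suc n"
      by (simp only: power_Suc fps_emb_mult mult.assoc fps_emb_left_commute[of F] fps_emb_left_commute[of G])
    finally show ?case .
  qed (simp add: fps_emb_1)
  have step: "Phi (Y * K ^ n * Q) = (if n = 0 then Phi Y else 0) + Phi (Y * K ^ Suc n * Q)" for n
  proof -
    let ?c = "(fps_X * (1 + fps_X)) ^ n :: complex fps"
    have "Y * K ^ n * Q = Y * K ^ n * (1 + e * G) + Y * K ^ Suc n * Q"
      by (subst (1) Q) (simp add: algebra_simps power_Suc2 del: power_Suc)
    moreover have "Phi \<dots> = Phi (Y * K ^ n * (1 + e * G)) + Phi (Y * K ^ Suc n * Q)"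
      by (rule Phi_add) (intro fps_valued_closed A_sub Y K_A Q_A e_A FG_A)+
    moreover have "Y * K ^ n * (1 + e * G)
        = fps_emb ?c * (Y * (G * F) ^ n + e * (Y * ((G * F) ^ n * G)))"
      unfolding K_power by (simp add: algebra_simps fps_emb_left_commute[of Y] e_comm(2)[of Y] e_comm(2)[of "(G * F) ^ n"])
    moreover have "Phi \<dots> = ?c * (Phi (Y * (G * F) ^ n) + fps_X * Phi (Y * ((G * F) ^ n * G)))"
    proof -
      have 1: "Y * (G * F) ^ n \<in> fps_valued A" "Y * ((G * F) ^ n * G) \<in> fps_valued A"
        by (intro fps_valued_closed fps_valued_power A_sub Y FG_A)+
      then show ?thesis
        by (simp add: Phi_emb_mult Phi_add Phi_X_mult e_def fps_valued_closed[OF A_sub])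
    qed
    ultimately show ?thesis
      using zero1[of n] zero2 by (cases n) auto
  qed
  have tail: "Phi (Y * K * Q) = Phi (Y * K ^ Suc n * Q)" for n
  proof (induction n)
    case (Suc n)
    then show ?case using step[of "Suc n"] by simp
  qed simp
  \<comment> \<open>After \<open>n\<close> further iterations the factor
    \<open>fps_X ^ Suc n\<close> stands in front, so the coefficient of degree \<open>n\<close> is
    exactly 0; no limit is taken.\<close>
  have "Phi (Y * K * Q) $ n = 0" for n
  proof -
    have "Y * K ^ Suc n * Q = fps_emb ((fps_X * (1 + fps_X)) ^ Suc n) * (Y * (G * F) ^ Suc n * Q)"
      unfolding K_power by (simp only: mult.assoc fps_emb_left_commute[of Y])
    moreover have "Phi \<dots> = (fps_X * (1 + fps_X)) ^ Suc n * Phi (Y * (G * F) ^ Suc n * Q)"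
      by (intro Phi_emb_mult fps_valued_closed fps_valued_power A_sub Y FG_A Q_A)
    moreover have "\<dots> = fps_X ^ Suc n * ((1 + fps_X) ^ Suc n * Phi (Y * (G * F) ^ Suc n * Q))"
      by (simp only: power_mult_distrib mult.assoc)
    ultimately show ?thesis
      unfolding tail[of n] by (simp only: fps_X_power_mult_nth) simp
  qed
  then have "Phi (Y * K * Q) = 0"
    by (intro fps_ext) simp
  then have "Phi (Y * Q) = Phi Y"
    using step[of 0] by simp
  moreover have "Y * Q = fps_const x * P"
    by (simp add: Y_def mult.assoc aQ)
  ultimately show ?thesis
    by (simp add: Y_def P_def a_def)
qed

end

section \<open>The equations for the moment series\<close>

context wstar_prob_space
begin

text \<open>\<open>phi_inverse_limit\<close> asks for an adjoint inside \<open>A\<close>. This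
  predicate passes such adjoints through the algebra operations up to the coefficients of formal
  resolvents.\<close>

definition adjointable :: "'h bounded_op \<Rightarrow> bool"
  where "adjointable T \<longleftrightarrow> T \<in> A \<and> (\<exists>S\<in>A. is_adjoint S T)"

lemma adjointable_self: "T \<in> A \<Longrightarrow> is_adjoint T T \<Longrightarrow> adjointable T"
  by (auto simp: adjointable_def)

lemma adjointable_mult: "adjointable S \<Longrightarrow> adjointable T \<Longrightarrow> adjointable (S * T)"
  unfolding adjointable_def by (meson A_closed is_adjoint_mult)

lemma adjointable_add: "adjointable S \<Longrightarrow> adjointable T \<Longrightarrow> adjointable (S + T)"
  unfolding adjointable_def by (meson A_closed is_adjoint_add)

lemma adjointable_diff: "adjointable S \<Longrightarrow> adjointable T \<Longrightarrow> adjointable (S - T)"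
  unfolding adjointable_def by (meson A_closed is_adjoint_diff)

lemma adjointable_scaleC: "adjointable T \<Longrightarrow> adjointable (a *\<^sub>C T)"
  unfolding adjointable_def by (meson A_closed is_adjoint_scaleC)

lemma adjointable_one: "adjointable 1"
  by (intro adjointable_self A_closed is_adjoint_one)

lemma adjointable_power: "adjointable T \<Longrightarrow> adjointable (T ^ n)"
  by (induction n) (auto intro: adjointable_one adjointable_mult)

lemma adjointable_sum: "(\<And>i. i \<in> I \<Longrightarrow> adjointable (F i)) \<Longrightarrow> adjointable (\<Sum>i\<in>I. F i)"
  using adjointable_scaleC[OF adjointable_one, of 0]
  by (induction I rule: infinite_finite_induct) (auto intro: adjointable_add)

lemma adjointable_geometric: "adjointable T \<Longrightarrow> adjointable (fps_geometric f T $ n)"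
  unfolding fps_geometric_nth by (intro adjointable_sum adjointable_scaleC adjointable_power)

end

context free_algebras
begin

text \<open>\<open>y\<close> need not belong to \<open>alg i\<close>, so
  \<open>subordination\<close> is applied to the powers of \<open>S\<close> instead: in each degree
  the difference \<open>D\<close> of the two resolvents is orthogonal to every \<open>S ^ k\<close>,
  and \<open>phi_inverse_limit\<close> carries this over to \<open>y\<close>.\<close>

lemma subordination_inverse:
  assumes S: "S \<in> alg i" "0 \<le> S" "S \<le> 1" and T: "T \<in> alg (\<not> i)" "is_adjoint T T"
    and y: "y * (1 - S) = 1" "(1 - S) * y = 1"
    and u: "u $ 0 = 0" "Phi (fps_geometric u S) = 1 + fps_X"
    and v: "v $ 0 = 0" "Phi (fps_geometric v T) = 1 + fps_X"
    and \<zeta>: "\<zeta> $ 0 = 0" "fps_X * \<zeta> = u * v * (1 + fps_X)"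
  shows "Phi (fps_const y * fps_geometric \<zeta> (T * S)) = Phi (fps_const y * fps_geometric u S)"
proof (rule fps_ext)
  fix n
  have A: "S \<in> A" "T \<in> A" using S T alg_A by auto
  have yA: "y \<in> A" by (rule A_inverse[OF _ y]) (intro A_closed A)
  define D where "D = fps_geometric \<zeta> (T * S) $ n - fps_geometric u S $ n"
  have geo: "adjointable (fps_geometric \<zeta> (T * S) $ n)" "adjointable (fps_geometric u S $ n)"
    using op_nonneg_is_adjoint[OF S(2)] T(2)
    by (intro adjointable_geometric adjointable_mult adjointable_self A; simp)+
  then have geoA: "fps_geometric \<zeta> (T * S) $ n \<in> A" "fps_geometric u S $ n \<in> A"
    by (auto simp: adjointable_def)
  have "adjointable D"
    unfolding D_def by (intro adjointable_diff geo)
  then obtain D' where D: "D \<in> A" "D' \<in> A" "is_adjoint D' D"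
    by (auto simp: adjointable_def)
  have diff: "\<phi> (z * D) = Phi (fps_const z * fps_geometric \<zeta> (T * S)) $ n
      - Phi (fps_const z * fps_geometric u S) $ n" if "z \<in> A" for z
    using that geoA by (simp add: D_def right_diff_distrib phi_diff A_closed)
  have "\<phi> (S ^ k * D) = 0" for k
    using subordination[OF S(1) T(1) _ u v \<zeta>, of "S ^ k"] S(1)
    by (subst diff) (simp_all add: A A_closed unital_subalgebra_closed[OF alg_sub])
  then have "\<phi> (y * D) = 0"
    by (intro phi_inverse_limit[OF A(1) S(2,3) y D])
  then show "Phi (fps_const y * fps_geometric \<zeta> (T * S)) $ n
      = Phi (fps_const y * fps_geometric u S) $ n"
    using diff[OF yA] by simp
qed

end

context wstar_prob_space
begin

text \<open>This is the transform \<open>M_T\<close> that enters the S-transform; without a constant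
  term it can be inverted under composition.\<close>

definition moment_series :: "'h bounded_op \<Rightarrow> complex fps"
  where "moment_series T = Abs_fps (\<lambda>n. if n = 0 then 0 else \<phi> (T ^ n))"

lemma Abs_fps_moments: "Abs_fps (\<lambda>n. \<phi> (T ^ n)) = 1 + moment_series T"
  by (rule fps_ext) (simp add: moment_series_def unital)

lemma moment_series_nth_0: "moment_series T $ 0 = 0"
  by (simp add: moment_series_def)

lemma phi_power_swap:
  assumes "S \<in> A" "T \<in> A"
  shows "\<phi> ((S * T) ^ n) = \<phi> ((T * S) ^ n)"
proof (cases n)
  case (Suc k)
  have comm: "(S * T) ^ k * S = S * (T * S) ^ k"
    by (induction k) (simp_all add: mult.assoc)
  have "\<phi> ((S * T) ^ n) = \<phi> ((S * (T * S) ^ k) * T)"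
    by (simp add: Suc comm[symmetric] power_Suc2 mult.assoc del: power_Suc)
  also have "\<dots> = \<phi> (T * (S * (T * S) ^ k))"
    using assms by (intro tracial A_closed)
  also have "\<dots> = \<phi> ((T * S) ^ n)"
    by (simp add: Suc mult.assoc)
  finally show ?thesis .
qed simp

lemma free_product_equations:
  fixes U V y :: "'h bounded_op" and b c :: complex
  assumes U: "U \<in> A" "0 \<le> U" "U \<le> 1" "\<phi> U \<noteq> 0" and V: "V \<in> A" "0 \<le> V" "\<phi> V \<noteq> 0"
    and free: "free \<phi> U V"
    and y: "y * (1 - U) = 1" "(1 - U) * y = 1"
    and h1: "\<And>n. \<phi> (V * (U * V) ^ n) = b * \<phi> ((U * V) ^ n) + \<phi> ((U * V) ^ Suc n)"
    and h2: "\<And>n. \<phi> (y * U * (V * U) ^ n) = c * \<phi> ((U * V) ^ Suc n)"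
  defines "\<alpha> \<equiv> \<phi> (y * U)"
  defines "\<beta> \<equiv> fps_const (b * c + \<alpha>)" and "\<gamma> \<equiv> fps_const (b * c - 1)"
  shows "fps_X * (1 + moment_series U) * (fps_const \<alpha> + \<gamma> * moment_series U)
      = moment_series U * (\<beta> + \<gamma> * moment_series U)"
    and "fps_const c * moment_series V = fps_X * (1 + moment_series V) * (\<beta> + \<gamma> * moment_series V)"
proof -
  define alg where "alg = (\<lambda>i. unital_subalgebra hull {if i then U else V})"
  interpret free_algebras A \<phi> alg
    unfolding alg_def using U(1) V(1) free by (rule free_algebras_hull)
  have UV: "U \<in> alg True" "V \<in> alg False"
    using hull_subset[of "{U}" unital_subalgebra] hull_subset[of "{V}" unital_subalgebra]
    by (auto simp: alg_def)
  have adj: "is_adjoint U U" "is_adjoint V V"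
    using U V by (auto intro: op_nonneg_is_adjoint)
  have yA: "y \<in> A" by (rule A_inverse[OF _ y]) (intro A_closed U)
  define pU where "pU = moment_series U"
  define pV where "pV = moment_series V"
  \<comment> \<open>The inverses exist because the linear coefficients \<open>\<phi> U\<close> and
    \<open>\<phi> V\<close> are nonzero.\<close>
  define u where "u = fps_inv pU"
  define v where "v = fps_inv pV"
  have p0: "pU $ 0 = 0" "pV $ 0 = 0" "pU $ 1 \<noteq> 0" "pV $ 1 \<noteq> 0"
    using U V by (simp_all add: pU_def pV_def moment_series_def)
  have uv0: "u $ 0 = 0" "v $ 0 = 0"
    by (simp_all add: u_def v_def fps_inv_def)
  have comp: "pU oo u = fps_X" "pV oo v = fps_X" "u oo pU = fps_X" "v oo pV = fps_X"
    using p0 by (simp_all add: u_def v_def fps_inv_right fps_inv)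
  have Phi_u: "Phi (fps_geometric u U) = 1 + fps_X"
    using Phi_geometric[of 1 U u] U(1)
    by (simp add: A_closed Abs_fps_moments fps_compose_add_distrib comp(1)[unfolded pU_def])
  have Phi_v: "Phi (fps_geometric v V) = 1 + fps_X"
    using Phi_geometric[of 1 V v] V(1)
    by (simp add: A_closed Abs_fps_moments fps_compose_add_distrib comp(2)[unfolded pV_def])
  \<comment> \<open>\<open>u * v\<close> starts in degree 2 or later, so division by
    \<open>fps_X\<close> still leaves no constant term.\<close>
  define \<zeta> where "\<zeta> = fps_shift 1 (u * v * (1 + fps_X))"
  have \<zeta>0: "\<zeta> $ 0 = 0"
    by (simp add: \<zeta>_def fps_mult_nth_1 uv0 del: One_nat_def)
  have "(u * v * (1 + fps_X)) $ 0 = 0"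
    by (simp add: uv0)
  then have X\<zeta>: "fps_X * \<zeta> = u * v * (1 + fps_X)"
    unfolding \<zeta>_def by (intro fps_ext) (auto simp: fps_X_mult_nth)
  then have X\<zeta>': "fps_X * \<zeta> = v * u * (1 + fps_X)"
    by (simp add: mult_ac)
  have dist: "(f * g) oo \<zeta> = (f oo \<zeta>) * (g oo \<zeta>)" for f g :: "complex fps"
    by (rule fps_compose_mult_distrib[OF \<zeta>0])
  have X\<zeta>_comp: "fps_X oo \<zeta> = \<zeta>"
    by (rule fps_X_fps_compose_startby0[OF \<zeta>0])

  define \<mu> where "\<mu> = Abs_fps (\<lambda>n. \<phi> ((V * U) ^ n))"
  \<comment> \<open>Subordination with \<open>x = 1\<close> shows that \<open>\<zeta>\<close>
    inverts the moment series of the product.\<close>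
  have \<mu>: "\<mu> oo \<zeta> = 1 + fps_X"
  proof -
    have "\<mu> oo \<zeta> = Phi (fps_const 1 * fps_geometric \<zeta> (V * U))"
      using Phi_geometric[of 1 "V * U" \<zeta>] U V by (simp add: \<mu>_def A_closed)
    also have "\<dots> = Phi (fps_const 1 * fps_geometric u U)"
      using UV by (intro subordination[of U True V 1 u v] uv0 Phi_u Phi_v \<zeta>0 X\<zeta>)
        (auto intro: unital_subalgebra_closed[OF alg_sub])
    finally show ?thesis by (simp add: Phi_u)
  qed
  have \<mu>_nth: "\<mu> $ n = \<phi> ((U * V) ^ n)" for n
    using phi_power_swap[of U V n] U V by (simp add: \<mu>_def)

  define N where "N = Abs_fps (\<lambda>n. \<phi> (V * (U * V) ^ n))"
  define NV where "NV = Abs_fps (\<lambda>n. \<phi> (V * V ^ n))"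
  have "N oo \<zeta> = Phi (fps_const V * fps_geometric \<zeta> (U * V))"
    using Phi_geometric[of V "U * V" \<zeta>] U V by (simp add: N_def A_closed)
  also have "\<dots> = Phi (fps_const V * fps_geometric v V)"
    using UV by (intro subordination[of V False U V v u] uv0 Phi_u Phi_v \<zeta>0 X\<zeta>') auto
  also have "\<dots> = NV oo v"
    using Phi_geometric[of V V v] V by (simp add: NV_def)
  finally have N: "N oo \<zeta> = NV oo v" .
  have "fps_X * NV = pV"
    by (rule fps_ext) (simp add: NV_def pV_def moment_series_def fps_X_mult_nth flip: power_Suc)
  then have "(fps_X * NV) oo v = fps_X"
    by (simp add: comp)
  then have NVv: "v * (NV oo v) = fps_X"
    by (simp add: fps_compose_mult_distrib[OF uv0(2)] fps_X_fps_compose_startby0[OF uv0(2)])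
  \<comment> \<open>The shift by \<open>fps_X\<close> aligns \<open>N\<close> with the moment of one
    order more in \<open>h1\<close>; the subtracted 1 is the zeroth moment.\<close>
  have "fps_X * N = fps_const b * (fps_X * \<mu>) + (\<mu> - 1)"
  proof (rule fps_ext)
    fix n
    show "(fps_X * N) $ n = (fps_const b * (fps_X * \<mu>) + (\<mu> - 1)) $ n"
      by (cases n) (simp_all add: N_def h1 \<mu>_nth unital del: power_Suc)
  qed
  then have "(fps_X * N) oo \<zeta> = (fps_const b * (fps_X * \<mu>) + (\<mu> - 1)) oo \<zeta>"
    by simp
  then have "\<zeta> * (NV oo v) = fps_const b * (\<zeta> * (1 + fps_X)) + fps_X"
    by (simp add: dist X\<zeta>_comp N fps_compose_add_distrib fps_compose_sub_distrib \<mu>)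
  then have "v * (\<zeta> * (NV oo v)) = v * (fps_const b * (\<zeta> * (1 + fps_X)) + fps_X)"
    by simp
  then have "v * (u * (1 + fps_X)) = v * (fps_const b * (\<zeta> * (1 + fps_X)) + fps_X)"
    using NVv X\<zeta>' by (simp add: mult_ac)
  moreover have "v \<noteq> 0"
    using NVv by auto
  ultimately have eq1: "u * (1 + fps_X) = fps_const b * (\<zeta> * (1 + fps_X)) + fps_X"
    by simp

  define L where "L = Abs_fps (\<lambda>n. \<phi> (y * (V * U) ^ n))"
  define H where "H = Abs_fps (\<lambda>n. \<phi> (y * U ^ n))"
  have "L oo \<zeta> = Phi (fps_const y * fps_geometric \<zeta> (V * U))"
    using Phi_geometric[of y "V * U" \<zeta>] U V yA by (simp add: L_def A_closed)
  also have "\<dots> = Phi (fps_const y * fps_geometric u U)"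
    using UV U adj
    by (intro subordination_inverse[of U True V y u v] y uv0 Phi_u Phi_v \<zeta>0 X\<zeta>) auto
  also have "\<dots> = H oo u"
    using Phi_geometric[of y U u] U yA by (simp add: H_def)
  finally have L: "L oo \<zeta> = H oo u" .
  have yU: "y * U = y - 1"
    using y by (simp add: algebra_simps)
  have \<alpha>: "\<phi> y = 1 + \<alpha>"
    unfolding \<alpha>_def yU by (simp add: phi_diff yA A_closed unital)
  \<comment> \<open>By \<open>y * U = y - 1\<close>, consecutive coefficients of \<open>H\<close>
    differ by a moment of \<open>U\<close>, so \<open>H\<close> is known up to its first coefficient
    \<open>\<phi> y = 1 + \<alpha>\<close>.\<close>
  have "(1 - fps_X) * H = fps_const (1 + \<alpha>) - fps_X * (1 + pU)"
  proof (rule fps_ext)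
    fix n
    have "y * U ^ Suc k = y * U ^ k - U ^ k" for k
      using arg_cong[OF yU, of "\<lambda>z. z * U ^ k"] by (simp add: mult.assoc left_diff_distrib)
    then have "\<phi> (y * U ^ Suc k) = \<phi> (y * U ^ k) - \<phi> (U ^ k)" for k
      by (simp only: phi_diff yA A_closed U)
    then show "((1 - fps_X) * H) $ n = (fps_const (1 + \<alpha>) - fps_X * (1 + pU)) $ n"
      by (cases n) (simp_all add: H_def \<alpha> left_diff_distrib Abs_fps_moments[symmetric] pU_def del: power_Suc)
  qed
  then have "((1 - fps_X) * H) oo u = (fps_const (1 + \<alpha>) - fps_X * (1 + pU)) oo u"
    by simp
  then have Hu: "(1 - u) * (H oo u) = fps_const (1 + \<alpha>) - u * (1 + fps_X)"
    by (simp add: fps_compose_mult_distrib[OF uv0(1)] fps_X_fps_compose_startby0[OF uv0(1)]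
        fps_compose_add_distrib fps_compose_sub_distrib comp)
  have "fps_X * L = fps_const c * (\<mu> - 1) + fps_X * \<mu>"
  proof (rule fps_ext)
    fix n
    have "y * (V * U) ^ k = y * U * (V * U) ^ k + (V * U) ^ k" for k
      unfolding yU by (simp add: algebra_simps)
    then have "\<phi> (y * (V * U) ^ k) = c * \<phi> ((U * V) ^ Suc k) + \<phi> ((V * U) ^ k)" for k
      by (simp only: add h2 yA A_closed U V)
    then show "(fps_X * L) $ n = (fps_const c * (\<mu> - 1) + fps_X * \<mu>) $ n"
      by (cases n) (simp_all add: L_def \<mu>_nth unital phi_power_swap[OF V(1) U(1)] del: power_Suc)
  qed
  then have "(fps_X * L) oo \<zeta> = (fps_const c * (\<mu> - 1) + fps_X * \<mu>) oo \<zeta>"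
    by simp
  then have L\<zeta>: "\<zeta> * (H oo u) = fps_const c * fps_X + \<zeta> * (1 + fps_X)"
    by (simp add: dist X\<zeta>_comp L fps_compose_add_distrib fps_compose_sub_distrib \<mu>)
  have "(1 - u) * (fps_const c * fps_X + \<zeta> * (1 + fps_X)) = \<zeta> * (fps_const (1 + \<alpha>) - u * (1 + fps_X))"
    unfolding L\<zeta>[symmetric] Hu[symmetric] by (simp only: mult_ac)
  moreover have "fps_const (1 + \<alpha>) = 1 + fps_const \<alpha>"
    by (simp flip: fps_const_add)
  ultimately have eq2: "\<zeta> * (fps_const \<alpha> - fps_X) = fps_const c * fps_X * (1 - u)"
    by (simp add: algebra_simps)

  define B C a :: "complex fps" where "B = fps_const b" and "C = fps_const c" and "a = fps_const \<alpha>"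
  have \<beta>: "\<beta> = B * C + a" and \<gamma>: "\<gamma> = B * C - 1"
    by (simp_all add: \<beta>_def \<gamma>_def B_def C_def a_def flip: fps_const_add fps_const_sub)
  have eq1': "u * (1 + fps_X) = B * (\<zeta> * (1 + fps_X)) + fps_X"
    and eq2': "\<zeta> * (a - fps_X) = C * fps_X * (1 - u)"
    using eq1 eq2 by (simp_all add: B_def C_def a_def)
  \<comment> \<open>Multiplication by \<open>1 + fps_X\<close> makes \<open>u\<close> appear as
    \<open>u * (1 + fps_X)\<close>, which \<open>eq1'\<close> eliminates.\<close>
  have "(1 + fps_X) * (\<zeta> * (a - fps_X)) = C * fps_X * ((1 + fps_X) - u * (1 + fps_X))"
    unfolding eq2' by (simp add: algebra_simps)
  then have E1: "(1 + fps_X) * \<zeta> * (a + \<gamma> * fps_X) = C * fps_X"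
    unfolding eq1' \<gamma> by (simp add: algebra_simps)
  have "u * (1 + fps_X) * (a + \<gamma> * fps_X) = B * ((1 + fps_X) * \<zeta> * (a + \<gamma> * fps_X)) + fps_X * (a + \<gamma> * fps_X)"
    unfolding eq1' by (simp add: algebra_simps)
  \<comment> \<open>For nonzero \<open>bc - 1\<close>, this says that the S-transform
    \<open>(1 + X) u / X\<close> of \<open>U\<close> is
    \<open>1 + bc / (\<alpha> + \<gamma> X)\<close>, the free binomial one with parameters
    \<open>\<alpha> / \<gamma>\<close> and \<open>bc / \<gamma>\<close>.\<close>
  then have E2: "u * (1 + fps_X) * (a + \<gamma> * fps_X) = fps_X * (\<beta> + \<gamma> * fps_X)"
    unfolding E1 \<beta> by (simp add: algebra_simps)
  have "fps_X * (C * fps_X) = (fps_X * \<zeta>) * (1 + fps_X) * (a + \<gamma> * fps_X)"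
    unfolding E1[symmetric] by (simp only: mult_ac)
  also have "\<dots> = v * (1 + fps_X) * (u * (1 + fps_X) * (a + \<gamma> * fps_X))"
    unfolding X\<zeta>' by (simp only: mult_ac)
  also have "\<dots> = fps_X * (v * (1 + fps_X) * (\<beta> + \<gamma> * fps_X))"
    unfolding E2 by (simp only: mult_ac)
  \<comment> \<open>Equivalently, the S-transform of \<open>V\<close> is
    \<open>c / (\<beta> + \<gamma> X)\<close>; comparison with the free Poisson form gives the
    parameters \<open>\<gamma> / c\<close> and \<open>\<beta> / \<gamma>\<close>.\<close>
  finally have E3: "C * fps_X = v * (1 + fps_X) * (\<beta> + \<gamma> * fps_X)"
    by simp
  \<comment> \<open>Substituting \<open>pU\<close> exchanges the roles: \<open>u\<close> becomes the
    variable and the variable becomes the moment series.\<close>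
  have "(u * (1 + fps_X) * (a + \<gamma> * fps_X)) oo pU = (fps_X * (\<beta> + \<gamma> * fps_X)) oo pU"
    by (simp only: E2)
  then show "fps_X * (1 + moment_series U) * (fps_const \<alpha> + \<gamma> * moment_series U)
      = moment_series U * (\<beta> + \<gamma> * moment_series U)"
    by (simp add: fps_compose_mult_distrib[OF p0(1)] fps_compose_add_distrib comp a_def \<beta>_def \<gamma>_def
        fps_X_fps_compose_startby0[OF p0(1)] flip: pU_def)
  have "(C * fps_X) oo pV = (v * (1 + fps_X) * (\<beta> + \<gamma> * fps_X)) oo pV"
    by (simp only: E3)
  then show "fps_const c * moment_series V = fps_X * (1 + moment_series V) * (\<beta> + \<gamma> * moment_series V)"
    by (simp add: fps_compose_mult_distrib[OF p0(2)] fps_compose_add_distrib comp C_def \<beta>_def \<gamma>_def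
        fps_X_fps_compose_startby0[OF p0(2)] flip: pV_def)
qed

end

section \<open>Integrals against the target densities\<close>

text \<open>An explicit antiderivative built from a root and two arcsines. The edge
  \<open>w = p\<close> is included because the free binomial law with first parameter 1 has its left
  endpoint at the pole 0.\<close>

lemma sqrt_quotient_has_integral:
  fixes p q w :: real
  assumes pq: "p < q" and w: "w \<le> p"
  shows "((\<lambda>x. sqrt ((x - p) * (q - x)) / (x - w)) has_integral
    pi * ((p + q) / 2 - w - sqrt ((p - w) * (q - w)))) {p..q}"
proof -
  define d where "d = (p - w) * (q - w)"
  \<comment> \<open>The Moebius map with pole \<open>w\<close> that takes \<open>p\<close> to -1 and
    \<open>q\<close> to 1, so that \<open>1 - (g x)\<^sup>2\<close> is a multiple of
    \<open>(x - p) * (q - x) / (x - w)\<^sup>2\<close>.\<close>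
  define g where "g x = (p + q - 2 * w) / (q - p) - 2 * d / ((x - w) * (q - p))" for x
  \<comment> \<open>The last term of the antiderivative vanishes for \<open>w = p\<close>, where \<open>g\<close> is singular.\<close>
  define F where "F x = sqrt ((x - p) * (q - x)) + ((p + q) / 2 - w) * arcsin ((2 * x - p - q) / (q - p))
    - sqrt d * (if w = p then 0 else arcsin (g x))" for x
  have d: "d \<ge> 0" "w < p \<Longrightarrow> d > 0"
    using pq w by (auto simp: d_def intro: mult_nonneg_nonneg)
  have common: "a / r - c / (y * r) = (a * y - c) / (y * r)" if "y \<noteq> 0" for a c r y :: real
    using that by (simp add: diff_divide_distrib)
  have one_minus: "1 - a / c = (c - a) / c" if "c \<noteq> 0" for a c :: real
    using that by (simp add: diff_divide_distrib)
  have g_sq: "1 - (g x)\<^sup>2 = 4 * d * ((x - p) * (q - x)) / ((x - w) * (q - p))\<^sup>2" if "x \<noteq> w" for x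
  proof -
    have 1: "g x = ((p + q - 2 * w) * (x - w) - 2 * d) / ((x - w) * (q - p))"
      unfolding g_def using that by (intro common) simp
    have 2: "((x - w) * (q - p))\<^sup>2 - ((p + q - 2 * w) * (x - w) - 2 * d)\<^sup>2 = 4 * d * ((x - p) * (q - x))"
      unfolding d_def by (simp add: power2_eq_square algebra_simps)
    have "1 - (g x)\<^sup>2 = (((x - w) * (q - p))\<^sup>2 - ((p + q - 2 * w) * (x - w) - 2 * d)\<^sup>2) / ((x - w) * (q - p))\<^sup>2"
      unfolding 1 power_divide using that pq by (intro one_minus) auto
    then show ?thesis unfolding 2 .
  qed
  have l_sq: "1 - ((2 * x - p - q) / (q - p))\<^sup>2 = 4 * ((x - p) * (q - x)) / (q - p)\<^sup>2" for x
  proof -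
    have "(q - p)\<^sup>2 - (2 * x - p - q)\<^sup>2 = 4 * ((x - p) * (q - x))"
      by (simp add: power2_eq_square algebra_simps)
    moreover have "1 - ((2 * x - p - q) / (q - p))\<^sup>2 = ((q - p)\<^sup>2 - (2 * x - p - q)\<^sup>2) / (q - p)\<^sup>2"
      unfolding power_divide using pq by (intro one_minus) auto
    ultimately show ?thesis by simp
  qed
  have g_le: "\<bar>g x\<bar> \<le> 1" if "p \<le> x" "x \<le> q" "w < p" for x
  proof -
    have "0 \<le> 1 - (g x)\<^sup>2"
      using that d(1) by (subst g_sq) auto
    then show ?thesis by (simp add: abs_square_le_1)
  qed
  have cont: "continuous_on {p..q} F"
  proof -
    have "continuous_on {p..q} (\<lambda>x. if w = p then 0 else arcsin (g x))"
    proof (cases "w = p")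
      case False
      then have "w < p" using w by simp
      have "continuous_on {p..q} g"
        unfolding g_def using \<open>w < p\<close> pq by (auto intro!: continuous_intros)
      moreover have "\<forall>x\<in>{p..q}. -1 \<le> g x \<and> g x \<le> 1"
        using g_le \<open>w < p\<close> by (force simp: abs_le_iff)
      ultimately show ?thesis
        unfolding if_not_P[OF False] by (rule continuous_on_arcsin)
    qed simp
    moreover have "continuous_on {p..q} (\<lambda>x. arcsin ((2 * x - p - q) / (q - p)))"
    proof (rule continuous_on_arcsin)
      show "continuous_on {p..q} (\<lambda>x. (2 * x - p - q) / (q - p))"
        using pq by (auto intro!: continuous_intros)
      show "\<forall>x\<in>{p..q}. -1 \<le> (2 * x - p - q) / (q - p) \<and> (2 * x - p - q) / (q - p) \<le> 1"
        using pq by (auto simp: field_simps)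
    qed
    ultimately show ?thesis
      unfolding F_def by (intro continuous_on_add continuous_on_diff continuous_on_mult
          continuous_on_real_sqrt continuous_on_const continuous_on_id)
  qed
  have deriv: "(F has_real_derivative sqrt ((x - p) * (q - x)) / (x - w)) (at x)"
    if x: "p < x" "x < q" for x
  proof -
    define Q where "Q = (x - p) * (q - x)"
    have Q: "Q > 0" using x by (simp add: Q_def)
    have xw: "x - w > 0" using x w by simp
    have sqrtQ: "sqrt Q * sqrt Q = Q" using Q by simp
    have 1: "((\<lambda>x. sqrt ((x - p) * (q - x))) has_real_derivative ((p + q) / 2 - x) / sqrt Q) (at x)"
      using Q unfolding Q_def by (auto intro!: derivative_eq_intros simp: field_simps)
    have 2: "((\<lambda>x. arcsin ((2 * x - p - q) / (q - p))) has_real_derivative 1 / sqrt Q) (at x)"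
    proof -
      let ?l = "(2 * x - p - q) / (q - p)"
      have "-1 < ?l" "?l < 1"
        using x pq by (auto simp: field_simps)
      moreover have "((\<lambda>x. (2 * x - p - q) / (q - p)) has_real_derivative 2 / (q - p)) (at x)"
        by (rule DERIV_cdivide) (auto intro!: derivative_eq_intros)
      ultimately have "((\<lambda>x. arcsin ((2 * x - p - q) / (q - p))) has_real_derivative inverse (sqrt (1 - ?l\<^sup>2)) * (2 / (q - p))) (at x)"
        by (intro DERIV_chain'[OF _ DERIV_arcsin])
      moreover have "sqrt (1 - ?l\<^sup>2) = 2 * sqrt Q / (q - p)"
        unfolding l_sq Q_def[symmetric] using pq by (simp add: real_sqrt_divide real_sqrt_mult)
      ultimately show ?thesis using pq Q by (simp add: field_simps)
    qed
    have 3: "((\<lambda>x. sqrt d * (if w = p then 0 else arcsin (g x))) has_real_derivative d / ((x - w) * sqrt Q)) (at x)"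
    proof (cases "w = p")
      case True
      then show ?thesis by (simp add: d_def)
    next
      case False
      then have d0: "d > 0" using d w by auto
      have g1: "1 - (g x)\<^sup>2 = 4 * d * Q / ((x - w) * (q - p))\<^sup>2"
        unfolding Q_def using xw by (intro g_sq) auto
      have "0 < 4 * d * Q / ((x - w) * (q - p))\<^sup>2"
        using d0 Q xw pq by (intro divide_pos_pos mult_pos_pos zero_less_power) auto
      then have "(g x)\<^sup>2 < 1" using g1 by linarith
      then have g_in: "-1 < g x" "g x < 1" by (auto simp: abs_square_less_1)
      have "(g has_real_derivative 2 * d / ((x - w)\<^sup>2 * (q - p))) (at x)"
      proof -
        have g_eq: "g = (\<lambda>x. (p + q - 2 * w) / (q - p) - 2 * d / (q - p) * inverse (x - w))"
          by (simp add: g_def fun_eq_iff divide_inverse mult_ac)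
        have "(g has_real_derivative 2 * d / (q - p) * (inverse (x - w) * inverse (x - w))) (at x)"
          unfolding g_eq using xw pq by (auto intro!: derivative_eq_intros)
        then show ?thesis by (simp add: divide_inverse power2_eq_square mult_ac)
      qed
      from DERIV_chain'[OF this DERIV_arcsin[OF g_in]]
      have "((\<lambda>x. arcsin (g x)) has_real_derivative inverse (sqrt (1 - (g x)\<^sup>2)) * (2 * d / ((x - w)\<^sup>2 * (q - p)))) (at x)"
        by simp
      moreover have "sqrt (1 - (g x)\<^sup>2) = 2 * sqrt d * sqrt Q / ((x - w) * (q - p))"
        unfolding g1 using xw pq by (simp add: real_sqrt_divide real_sqrt_mult)
      moreover have "inverse (2 * D * S / (z * r)) * (2 * (D * D) / (z\<^sup>2 * r)) = D / (z * S)"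
        if "D > 0" "S > 0" "z > 0" "r > 0" for D S z r :: real
        using that by (simp add: field_simps power2_eq_square)
      from this[of "sqrt d" "sqrt Q" "x - w" "q - p"]
      have "inverse (2 * sqrt d * sqrt Q / ((x - w) * (q - p))) * (2 * d / ((x - w)\<^sup>2 * (q - p)))
          = sqrt d / ((x - w) * sqrt Q)"
        using d0 Q xw pq by simp
      ultimately have "((\<lambda>x. arcsin (g x)) has_real_derivative sqrt d / ((x - w) * sqrt Q)) (at x)"
        by simp
      then have "((\<lambda>x. sqrt d * arcsin (g x)) has_real_derivative sqrt d * (sqrt d / ((x - w) * sqrt Q))) (at x)"
        by (rule DERIV_cmult)
      then show ?thesis using False d0 by simp
    qed
    have "(F has_real_derivative ((p + q) / 2 - x) / sqrt Q + ((p + q) / 2 - w) * (1 / sqrt Q) - d / ((x - w) * sqrt Q)) (at x)"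
      unfolding F_def[abs_def] by (intro DERIV_add DERIV_diff DERIV_cmult 1 2 3)
    moreover have "((p + q) / 2 - x) / sqrt Q + ((p + q) / 2 - w) * (1 / sqrt Q) - d / ((x - w) * sqrt Q) = sqrt Q / (x - w)"
    proof -
      have "((p + q) / 2 - x) / sqrt Q + ((p + q) / 2 - w) * (1 / sqrt Q) - d / ((x - w) * sqrt Q)
          = ((p + q - x - w) * (x - w) - d) / ((x - w) * sqrt Q)"
        using xw Q by (simp add: field_simps)
      also have "(p + q - x - w) * (x - w) - d = sqrt Q * sqrt Q"
        unfolding sqrtQ by (simp add: d_def Q_def algebra_simps)
      also have "(sqrt Q * sqrt Q) / ((x - w) * sqrt Q) = sqrt Q / (x - w)"
        using Q by (simp del: real_sqrt_mult_self)
      finally show ?thesis .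
    qed
    ultimately show ?thesis by (simp add: Q_def)
  qed
  have "((\<lambda>x. sqrt ((x - p) * (q - x)) / (x - w)) has_integral (F q - F p)) {p..q}"
    using pq deriv by (intro fundamental_theorem_of_calculus_interior cont)
      (auto simp: has_real_derivative_iff_has_vector_derivative)
  moreover have "F q - F p = pi * ((p + q) / 2 - w - sqrt d)"
  proof -
    have l: "(2 * q - p - q) / (q - p) = 1" "(2 * p - p - q) / (q - p) = -1"
      using pq by (auto simp: field_simps)
    have gq: "sqrt d * (if w = p then 0 else arcsin (g q)) = sqrt d * (pi / 2)"
      "sqrt d * (if w = p then 0 else arcsin (g p)) = sqrt d * (- (pi / 2))"
    proof -
      have "g q = 1" "g p = -1" if "w \<noteq> p"
      proof -
        have "2 * d / ((q - w) * (q - p)) = (2 * (p - w)) / (q - p)"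
          "2 * d / ((p - w) * (q - p)) = (2 * (q - w)) / (q - p)"
          using that pq w by (simp_all add: d_def)
        then have "g q = ((p + q - 2 * w) - 2 * (p - w)) / (q - p)"
          "g p = ((p + q - 2 * w) - 2 * (q - w)) / (q - p)"
          by (simp_all only: g_def diff_divide_distrib)
        moreover have "(p + q - 2 * w) - 2 * (p - w) = q - p" "(p + q - 2 * w) - 2 * (q - w) = - (q - p)"
          by simp_all
        ultimately show "g q = 1" "g p = -1"
          using pq by (simp_all only: minus_divide_left[symmetric] divide_self)
      qed
      then show "sqrt d * (if w = p then 0 else arcsin (g q)) = sqrt d * (pi / 2)"
        "sqrt d * (if w = p then 0 else arcsin (g p)) = sqrt d * (- (pi / 2))"
        by (auto simp: d_def)
    qed
    show ?thesis
      unfolding F_def gq l by (simp add: algebra_simps)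
  qed
  ultimately show ?thesis by (simp add: d_def)
qed

text \<open>The reflected integral, for the pole at 1 of the free binomial density, which lies to
  the right of the support.\<close>

lemma sqrt_quotient_has_integral_right:
  fixes p q w :: real
  assumes pq: "p < q" and w: "q \<le> w"
  shows "((\<lambda>x. sqrt ((x - p) * (q - x)) / (w - x)) has_integral
    pi * (w - (p + q) / 2 - sqrt ((w - p) * (w - q)))) {p..q}"
proof -
  have "((\<lambda>x. sqrt ((x - - q) * (- p - x)) / (x - - w)) has_integral
    pi * ((- q + - p) / 2 - - w - sqrt ((- q - - w) * (- p - - w)))) {- q..- p}"
    using assms by (intro sqrt_quotient_has_integral) auto
  moreover have "(x - - q) * (- p - x) = (- x - p) * (q - - x)" for x
    by (simp add: algebra_simps)
  moreover have "(- q - - w) * (- p - - w) = (w - p) * (w - q)"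
    by (simp add: algebra_simps)
  moreover have "(- q + - p) / 2 - - w = w - (p + q) / 2"
    by (simp add: field_simps)
  ultimately have "((\<lambda>x. (\<lambda>x. sqrt ((x - p) * (q - x)) / (w - x)) (- x)) has_integral
      pi * (w - (p + q) / 2 - sqrt ((w - p) * (w - q)))) {- q..- p}"
    by (simp only: diff_minus_eq_add add.commute[of w])
  then show ?thesis
    by (subst (asm) has_integral_reflect_real)
qed

section \<open>Integration against atoms plus a density, and passage to formal moment series\<close>

lemma sets_atoms_and_density [measurable_cong, simp]: "sets (atoms_and_density a b f) = sets borel"
  by (simp add: atoms_and_density_def sigma_algebra.sigma_sets_eq[OF sets.sigma_algebra_axioms[of borel], simplified])

lemma space_atoms_and_density [simp]: "space (atoms_and_density a b f) = UNIV"
  by (simp add: atoms_and_density_def)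

lemma nn_integral_atoms_and_density:
  assumes f[measurable]: "f \<in> borel_measurable borel" and h: "h \<in> borel_measurable borel"
  shows "(\<integral>\<^sup>+x. h x \<partial>atoms_and_density a b f)
    = ennreal a * h 0 + ennreal b * h 1 + (\<integral>\<^sup>+x. ennreal (f x) * h x \<partial>lborel)"
  using h
proof (induction rule: borel_measurable_induct)
  case (cong g h)
  then show ?case by (simp add: fun_eq_iff)
next
  case (set B)
  then show ?case
    by (simp add: emeasure_atoms_and_density[OF f] nn_integral_indicator mult.commute)
next
  case (mult u c)
  note [measurable] = mult(2)
  have "(\<integral>\<^sup>+x. ennreal (f x) * (c * u x) \<partial>lborel) = c * (\<integral>\<^sup>+x. ennreal (f x) * u x \<partial>lborel)"
    by (subst nn_integral_cmult[symmetric]) (auto simp: mult_ac)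
  with mult show ?case
    by (simp add: nn_integral_cmult distrib_left mult_ac)
next
  case (add u v)
  have [measurable]: "u \<in> borel_measurable borel" "v \<in> borel_measurable borel"
    using add by auto
  have "(\<integral>\<^sup>+x. ennreal (f x) * (v x + u x) \<partial>lborel)
      = (\<integral>\<^sup>+x. ennreal (f x) * v x \<partial>lborel) + (\<integral>\<^sup>+x. ennreal (f x) * u x \<partial>lborel)"
    by (subst nn_integral_add[symmetric]) (auto simp: distrib_left)
  with add show ?case
    by (simp add: nn_integral_add distrib_left add_ac)
next
  case (seq U)
  note [measurable] = seq(1)
  have mono: "incseq (\<lambda>i. U i x)" for x
    using seq(3) by (auto simp: incseq_def le_fun_def)
  have app: "(SUP i. U i) x = (SUP i. U i x)" for x
    by (simp add: image_comp)
  have "(\<integral>\<^sup>+x. (SUP i. U i) x \<partial>atoms_and_density a b f) = (SUP i. \<integral>\<^sup>+x. U i x \<partial>atoms_and_density a b f)"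
    unfolding app using seq(3) by (intro nn_integral_monotone_convergence_SUP) auto
  also have "\<dots> = (SUP i. ennreal a * U i 0 + ennreal b * U i 1 + (\<integral>\<^sup>+x. ennreal (f x) * U i x \<partial>lborel))"
    using seq by simp
  also have "\<dots> = ennreal a * (SUP i. U i 0) + ennreal b * (SUP i. U i 1)
      + (SUP i. \<integral>\<^sup>+x. ennreal (f x) * U i x \<partial>lborel)"
  proof -
    have m1: "incseq (\<lambda>i. k * U i x)" for k x
      using mono[of x] by (auto simp: incseq_def intro: mult_left_mono)
    have m2: "incseq (\<lambda>i. \<integral>\<^sup>+x. ennreal (f x) * U i x \<partial>lborel)"
      using m1 by (auto simp: incseq_def intro!: nn_integral_mono)
    have m3: "incseq (\<lambda>i. ennreal a * U i 0 + ennreal b * U i 1)"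
      using m1[of "ennreal a" 0] m1[of "ennreal b" 1] by (auto simp: incseq_def intro: add_mono)
    show ?thesis
      by (simp add: ennreal_SUP_add[OF m3 m2] ennreal_SUP_add[OF m1 m1] SUP_mult_left_ennreal)
  qed
  also have "(SUP i. \<integral>\<^sup>+x. ennreal (f x) * U i x \<partial>lborel) = (\<integral>\<^sup>+x. (SUP i. ennreal (f x) * U i x) \<partial>lborel)"
    using mono by (intro nn_integral_monotone_convergence_SUP[symmetric])
      (auto simp: incseq_def le_fun_def intro: mult_left_mono)
  finally show ?case
    unfolding app by (simp only: SUP_mult_left_ennreal)
qed

text \<open>After division by the leading power, the series is still 0 to the left of 0, and
  continuity at 0 kills its leading coefficient.\<close>

lemma fps_eq_0_if_eval_eq_0_left:
  fixes F :: "real fps"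
  assumes r: "0 < r" "ereal r \<le> fps_conv_radius F"
    and 0: "\<And>w. - r < w \<Longrightarrow> w < 0 \<Longrightarrow> eval_fps F w = 0"
  shows "F = 0"
proof (rule ccontr)
  assume F: "F \<noteq> 0"
  define n where "n = subdegree F"
  define G where "G = fps_shift n F"
  have rad: "ereal (norm w) < fps_conv_radius F" if "\<bar>w\<bar> < r" for w :: real
    using that by (intro less_le_trans[OF _ r(2)]) simp
  have G0: "eval_fps G w = 0" if "- r < w" "w < 0" for w
    using that F 0[of w] rad[of w] by (simp add: G_def n_def eval_fps_shift)
  have "isCont (eval_fps G) 0"
    using rad[of 0] r by (intro continuous_eval_fps) (simp add: G_def)
  then have "(eval_fps G \<longlongrightarrow> eval_fps G 0) (at_left 0)"
    unfolding isCont_def by (rule tendsto_mono[OF at_le, rotated]) simp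
  moreover have "(eval_fps G \<longlongrightarrow> 0) (at_left 0)"
  proof (rule tendsto_eventually)
    show "\<forall>\<^sub>F w in at_left 0. eval_fps G w = 0"
      unfolding eventually_at_left_field using r(1) by (intro exI[of _ "-r"]) (auto intro: G0)
  qed
  ultimately have "eval_fps G 0 = 0"
    by (intro tendsto_unique[of "at_left (0::real)"]) auto
  moreover have "eval_fps G 0 = F $ n"
    by (simp add: G_def eval_fps_at_0)
  ultimately show False
    using F by (simp add: n_def)
qed

text \<open>For these \<open>w\<close> the ratio \<open>w * x\<close> stays in
  \<open>(-1, 0]\<close>, where every partial geometric sum is bounded by 2; dominated convergence
  does the rest.\<close>

lemma moment_transform_sums:
  fixes M :: "real measure"
  assumes M: "prob_space M" "sets M = sets borel" and bd: "AE x in M. 0 \<le> x \<and> x \<le> K"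
    and w: "w \<le> 0" "- w * K < 1"
  shows "(\<lambda>n. (\<integral>x. x ^ n \<partial>M) * w ^ n) sums (\<integral>x. 1 / (1 - w * x) \<partial>M)"
proof -
  interpret prob_space M by fact
  note [measurable_cong] = M(2)
  have wx: "-1 < w * x" "w * x \<le> 0" if "0 \<le> x" "x \<le> K" for x
  proof -
    have "- w * x \<le> - w * K" using that w(1) by (intro mult_left_mono) auto
    then show "-1 < w * x" using w(2) by simp
    show "w * x \<le> 0" using that w(1) by (simp add: mult_nonpos_nonneg)
  qed
  have int: "integrable M (\<lambda>x. x ^ n)" for n
  proof (rule integrable_const_bound[where B = "\<bar>K\<bar> ^ n"])
    show "AE x in M. norm (x ^ n) \<le> \<bar>K\<bar> ^ n"
      using bd by eventually_elim (auto simp: power_abs intro!: power_mono)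
  qed measurable
  have "(\<lambda>N. \<integral>x. (\<Sum>n<N. (w * x) ^ n) \<partial>M) \<longlonglongrightarrow> (\<integral>x. 1 / (1 - w * x) \<partial>M)"
  proof (rule integral_dominated_convergence[where w = "\<lambda>_. 2"])
    show "AE x in M. (\<lambda>N. \<Sum>n<N. (w * x) ^ n) \<longlonglongrightarrow> 1 / (1 - w * x)"
      using bd
    proof eventually_elim
      case (elim x)
      then have "norm (w * x) < 1" using wx[of x] by simp
      then show ?case using geometric_sums[of "w * x"] by (simp add: sums_def)
    qed
    show "AE x in M. norm (\<Sum>n<N. (w * x) ^ n) \<le> 2" for N
      using bd
    proof eventually_elim
      case (elim x)
      then have y: "-1 < w * x" "w * x \<le> 0" by (auto intro: wx)
      have "\<bar>(w * x) ^ N\<bar> \<le> 1"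
        unfolding power_abs using y by (intro power_le_one) auto
      then have "\<bar>1 - (w * x) ^ N\<bar> \<le> 2" by linarith
      moreover have "1 \<le> 1 - w * x" using y by simp
      ultimately have "\<bar>1 - (w * x) ^ N\<bar> / (1 - w * x) \<le> 2 / 1"
        by (intro frac_le) auto
      then show ?case
        using y by (simp add: sum_gp_strict abs_divide)
    qed
  qed auto
  moreover have "(\<integral>x. (\<Sum>n<N. (w * x) ^ n) \<partial>M) = (\<Sum>n<N. (\<integral>x. x ^ n \<partial>M) * w ^ n)" for N
    using int by (simp add: power_mult_distrib mult.commute)
  ultimately show ?thesis by (simp add: sums_def)
qed

text \<open>The constant coefficient is \<open>0\<close> rather than the total mass, as for \<open>moment_series\<close>.\<close>

definition real_moment_series :: "real measure \<Rightarrow> real fps"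
  where "real_moment_series M = Abs_fps (\<lambda>n. if n = 0 then 0 else \<integral>x. x ^ n \<partial>M)"

text \<open>Near 0 the moment series converges to \<open>g\<close>, so the numerical relation says
  that a convergent series vanishes to the left of 0; hence it vanishes formally.\<close>

lemma real_moment_series_quadratic:
  fixes M :: "real measure"
  assumes M: "prob_space M" "sets M = sets borel" and bd: "AE x in M. 0 \<le> x \<and> x \<le> K"
    and eq: "\<And>w g. w < 0 \<Longrightarrow> g = (\<integral>x. 1 / (1 - w * x) \<partial>M) - 1
      \<Longrightarrow> a * g + b * g\<^sup>2 = w * (d + e * g + f * g\<^sup>2)"
  defines "G \<equiv> real_moment_series M"
  shows "fps_const a * G + fps_const b * G\<^sup>2 = fps_X * (fps_const d + fps_const e * G + fps_const f * G\<^sup>2)"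
proof -
  interpret prob_space M by fact
  \<comment> \<open>Chosen so that \<open>- w * K < 1\<close> whenever \<open>- r < w\<close> and
    \<open>w < 0\<close>.\<close>
  define r where "r = 1 / (\<bar>K\<bar> + 1)"
  have r: "r > 0" "r * (\<bar>K\<bar> + 1) = 1" by (simp_all add: r_def)
  have rK: "- w * K < 1" if "- r < w" "w < 0" for w
  proof -
    have "- w * K \<le> - w * \<bar>K\<bar>" using that by (intro mult_left_mono) auto
    also have "\<dots> < r * (\<bar>K\<bar> + 1)"
      using that by (intro mult_less_le_imp_less mult_strict_mono) auto
    finally show ?thesis using r by simp
  qed
  have sums: "(\<lambda>n. G $ n * w ^ n) sums ((\<integral>x. 1 / (1 - w * x) \<partial>M) - 1)" if "- r < w" "w < 0" for w
  proof -
    have "(\<lambda>n. (\<integral>x. x ^ n \<partial>M) * w ^ n - (if n = 0 then 1 else 0)) sums ((\<integral>x. 1 / (1 - w * x) \<partial>M) - 1)"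
      using that by (intro sums_diff moment_transform_sums[OF M bd] rK sums_single[of 0 "\<lambda>_. 1"]) auto
    moreover have "(\<integral>x. x ^ n \<partial>M) * w ^ n - (if n = 0 then 1 else 0) = G $ n * w ^ n" for n
      by (simp add: G_def real_moment_series_def prob_space)
    ultimately show ?thesis by simp
  qed
  have rad: "ereal r \<le> fps_conv_radius G"
    unfolding fps_conv_radius_def
  proof (rule conv_radius_geI_ex)
    fix s :: real assume "0 < s" "ereal s < ereal r"
    then show "\<exists>z. norm z = s \<and> summable (\<lambda>n. G $ n * z ^ n)"
      using sums[of "- s"] by (intro exI[of _ "- s"]) (auto simp: sums_iff)
  qed
  have rad_mult: "ereal r \<le> fps_conv_radius (F * H)"
    and rad_add: "ereal r \<le> fps_conv_radius (F + H)"
    and rad_diff: "ereal r \<le> fps_conv_radius (F - H)"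
    if "ereal r \<le> fps_conv_radius F" "ereal r \<le> fps_conv_radius H" for F H :: "real fps"
    using that fps_conv_radius_mult[of F H] fps_conv_radius_add[of F H] fps_conv_radius_diff[of F H]
    by (meson min.boundedI order_trans)+
  have rad_const: "ereal r \<le> fps_conv_radius (fps_const k)" "ereal r \<le> fps_conv_radius (fps_X :: real fps)" for k :: real
    by simp_all
  note rads = rad_mult rad_add rad_diff rad_const rad
  define F where "F = (fps_const a * G + fps_const b * (G * G))
    - fps_X * (fps_const d + fps_const e * G + fps_const f * (G * G))"
  have "F = 0"
  proof (rule fps_eq_0_if_eval_eq_0_left[OF r(1)])
    show "ereal r \<le> fps_conv_radius F"
      unfolding F_def by (intro rads)
    fix w :: real assume w: "- r < w" "w < 0"
    have lt: "ereal \<bar>w\<bar> < fps_conv_radius H" if "ereal r \<le> fps_conv_radius H" for H :: "real fps"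
      using w by (intro less_le_trans[OF _ that]) simp
    define g where "g = eval_fps G w"
    have g: "g = (\<integral>x. 1 / (1 - w * x) \<partial>M) - 1"
      using sums[OF w] by (simp add: g_def eval_fps_def sums_iff)
    have "eval_fps F w = (a * g + b * (g * g)) - w * (d + e * g + f * (g * g))"
      unfolding F_def g_def
      by (simp add: eval_fps_mult eval_fps_add eval_fps_diff lt rads)
    then show "eval_fps F w = 0"
      using eq[OF w(2) g] by (simp add: power2_eq_square)
  qed
  then show ?thesis by (simp add: F_def power2_eq_square)
qed

text \<open>The bridge from gauge integrals, delivered by antiderivatives, to integrals against the
  law; nonnegativity lets them pass through \<open>nn_integral\<close>. Only an atom at 0 is allowed
  for, since the second parameter of the free binomial law exceeds 1 in the application.\<close>

lemma
  fixes p q a I :: real and \<phi> h :: "real \<Rightarrow> real"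
  defines "f \<equiv> \<lambda>x. if p < x \<and> x < q then \<phi> x else 0"
  defines "M \<equiv> atoms_and_density a 0 f"
  assumes pq: "0 \<le> p" "p < q" and a: "0 \<le> a" and f: "f \<in> borel_measurable borel"
    and pos: "\<And>x. p < x \<Longrightarrow> x < q \<Longrightarrow> 0 \<le> \<phi> x"
  shows AE_atom_and_density: "AE x in M. 0 \<le> x \<and> x \<le> q"
    and integral_atom_and_density: "h \<in> borel_measurable borel \<Longrightarrow> (\<And>x. 0 \<le> x \<Longrightarrow> 0 \<le> h x)
      \<Longrightarrow> ((\<lambda>x. \<phi> x * h x) has_integral I) {p..q} \<Longrightarrow> (\<integral>x. h x \<partial>M) = a * h 0 + I"
    and prob_space_atom_and_density: "(\<phi> has_integral (1 - a)) {p..q} \<Longrightarrow> prob_space M"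
proof -
  have f0: "0 \<le> f x" for x using pos by (simp add: f_def)
  have "emeasure M {x. \<not> (0 \<le> x \<and> x \<le> q)} = 0"
  proof -
    have B: "{x. \<not> (0 \<le> x \<and> x \<le> q)} \<in> sets borel" by measurable
    have "(\<integral>\<^sup>+x\<in>{x. \<not> (0 \<le> x \<and> x \<le> q)}. ennreal (f x) \<partial>lborel) = (\<integral>\<^sup>+(x::real). 0 \<partial>lborel)"
      using pq by (intro nn_integral_cong) (auto simp: f_def indicator_def)
    then show ?thesis
      unfolding M_def emeasure_atoms_and_density[OF f B] using pq by simp
  qed
  then show AE: "AE x in M. 0 \<le> x \<and> x \<le> q"
    by (intro AE_I[of _ _ "{x. \<not> (0 \<le> x \<and> x \<le> q)}"]) (auto simp: M_def)
  have nn: "(\<integral>\<^sup>+x. ennreal (h x) \<partial>M) = ennreal (a * h 0 + I)" and I0: "0 \<le> I"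
    if h: "h \<in> borel_measurable borel" "\<And>x. 0 \<le> x \<Longrightarrow> 0 \<le> h x"
      and I: "((\<lambda>x. \<phi> x * h x) has_integral I) {p..q}" for h I
  proof -
    have fh: "0 \<le> f x * h x" for x
      using f0[of x] h(2)[of x] pq by (cases "p < x") (auto simp: f_def)
    have "((\<lambda>x. if x \<in> {p<..<q} then \<phi> x * h x else 0) has_integral I) UNIV"
      using I unfolding has_integral_restrict_UNIV by (simp add: has_integral_Icc_iff_Ioo)
    moreover have "(\<lambda>x. if x \<in> {p<..<q} then \<phi> x * h x else 0) = (\<lambda>x. f x * h x)"
      by (auto simp: f_def)
    ultimately have fI: "((\<lambda>x. f x * h x) has_integral I) UNIV" by simp
    then show "0 \<le> I" using fh by (rule has_integral_nonneg)
    have "(\<integral>\<^sup>+x. ennreal (f x) * ennreal (h x) \<partial>lborel) = (\<integral>\<^sup>+x. ennreal (f x * h x) \<partial>lborel)"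
      using f0 by (intro nn_integral_cong) (auto simp: ennreal_mult')
    also have "\<dots> = ennreal I"
      using f h fI fh by (intro nn_integral_has_integral_lborel) auto
    finally show "(\<integral>\<^sup>+x. ennreal (h x) \<partial>M) = ennreal (a * h 0 + I)"
      unfolding M_def using h a \<open>0 \<le> I\<close>
      by (subst nn_integral_atoms_and_density[OF f]) (auto simp: ennreal_mult ennreal_plus)
  qed
  show "(\<integral>x. h x \<partial>M) = a * h 0 + I"
    if h: "h \<in> borel_measurable borel" "\<And>x. 0 \<le> x \<Longrightarrow> 0 \<le> h x"
      and I: "((\<lambda>x. \<phi> x * h x) has_integral I) {p..q}"
  proof -
    have I_nonneg: "0 \<le> I"
      by (rule I0[OF h(1) _ I]) (rule h(2))
    have "(\<integral>x. h x \<partial>M) = enn2real (\<integral>\<^sup>+x. ennreal (h x) \<partial>M)"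
      using AE h by (intro integral_eq_nn_integral) (auto simp: M_def)
    also have "(\<integral>\<^sup>+x. ennreal (h x) \<partial>M) = ennreal (a * h 0 + I)"
      by (rule nn[OF h(1) _ I]) (rule h(2))
    also have "enn2real (ennreal (a * h 0 + I)) = a * h 0 + I"
      using a h(2)[of 0] I_nonneg by (intro enn2real_ennreal) simp
    finally show ?thesis .
  qed
  show "prob_space M" if "(\<phi> has_integral (1 - a)) {p..q}"
  proof
    have "emeasure M (space M) = (\<integral>\<^sup>+x. ennreal 1 \<partial>M)"
      by simp
    also have "\<dots> = ennreal (a * 1 + (1 - a))"
      using that by (intro nn) auto
    finally show "emeasure M (space M) = 1" by simp
  qed
qed

section \<open>Total mass and moment equation of the two target laws\<close>

lemma free_poisson_bounded_and_series:
  fixes a l :: real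
  assumes a: "0 < a" and l: "1 < l"
  defines "M \<equiv> free_poisson a l"
  defines "G \<equiv> real_moment_series M"
  shows "prob_space M" and "AE x in M. 0 \<le> x \<and> x \<le> a * (1 + sqrt l)\<^sup>2"
    and "G = fps_X * (fps_const (a * l) + fps_const (a * (1 + l)) * G + fps_const a * G\<^sup>2)"
proof -
  define p where "p = a * (1 - sqrt l)\<^sup>2"
  define q where "q = a * (1 + sqrt l)\<^sup>2"
  define \<phi> where "\<phi> x = 1 / (2 * pi * a * x) * sqrt (4 * l * a\<^sup>2 - (x - a * (1 + l))\<^sup>2)" for x
  have sl: "sqrt l > 1" "sqrt l * sqrt l = l" using l by auto
  have p: "0 < p" using a sl by (simp add: p_def)
  have "q - p = 4 * a * sqrt l"
    by (simp add: p_def q_def power2_eq_square algebra_simps)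
  then have pq: "p < q" using a sl(1) by (smt (verit) mult_pos_pos)
  have s: "p + q = 2 * a * (1 + l)"
    using sl(2) by (simp add: p_def q_def power2_eq_square algebra_simps)
  have prod: "p * q = (a * (l - 1))\<^sup>2"
  proof -
    have "p * q = (a * ((1 - sqrt l) * (1 + sqrt l)))\<^sup>2"
      by (simp add: p_def q_def power2_eq_square algebra_simps)
    also have "(1 - sqrt l) * (1 + sqrt l) = 1 - l"
      using sl(2) by (simp add: algebra_simps)
    finally show ?thesis by (simp add: power2_eq_square algebra_simps)
  qed
  \<comment> \<open>\<open>l > 1\<close> fixes the sign of the root; with it the density alone has
    mass 1, in agreement with the missing atom.\<close>
  have sqrt_prod: "sqrt (p * q) = a * (l - 1)"
    unfolding prod using a l by simp
  have Q: "4 * l * a\<^sup>2 - (x - a * (1 + l))\<^sup>2 = (x - p) * (q - x)" for x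
  proof -
    have "(x - p) * (q - x) = (p + q) * x - p * q - x\<^sup>2"
      by (simp add: power2_eq_square algebra_simps)
    then show ?thesis
      unfolding s prod by (simp add: power2_eq_square algebra_simps)
  qed
  have M: "M = atoms_and_density 0 0 (\<lambda>x. if p < x \<and> x < q then \<phi> x else 0)"
    unfolding M_def free_poisson_def p_def q_def \<phi>_def using l by simp
  have meas: "(\<lambda>x. if p < x \<and> x < q then \<phi> x else 0) \<in> borel_measurable borel"
    unfolding \<phi>_def by measurable
  have pos: "0 \<le> \<phi> x" if "p < x" "x < q" for x
    unfolding \<phi>_def Q using that p a by simp
  note facts = less_imp_le[OF p] pq order_refl meas pos
  have J0: "((\<lambda>x. sqrt ((x - p) * (q - x)) / x) has_integral 2 * pi * a) {p..q}"
  proof -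
    have "pi * ((p + q) / 2 - 0 - sqrt ((p - 0) * (q - 0))) = 2 * pi * a"
      unfolding s by (simp add: sqrt_prod algebra_simps)
    then show ?thesis
      using sqrt_quotient_has_integral[OF pq, of 0] p by (simp only: diff_0_right)
  qed
  have mass: "(\<phi> has_integral (1 - 0)) {p..q}"
  proof -
    have "((\<lambda>x. 1 / (2 * pi * a) * (sqrt ((x - p) * (q - x)) / x)) has_integral 1 / (2 * pi * a) * (2 * pi * a)) {p..q}"
      by (intro has_integral_mult_right J0)
    moreover have "1 / (2 * pi * a) * (sqrt ((x - p) * (q - x)) / x) = \<phi> x" for x
      unfolding \<phi>_def Q by simp
    ultimately show ?thesis using a by simp
  qed
  show prob: "prob_space M"
    unfolding M by (rule prob_space_atom_and_density[OF facts mass])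
  show AE: "AE x in M. 0 \<le> x \<and> x \<le> a * (1 + sqrt l)\<^sup>2"
    unfolding M q_def[symmetric] by (rule AE_atom_and_density[OF facts])
  have quad: "1 * g + 0 * g\<^sup>2 = w * (a * l + a * (1 + l) * g + a * g\<^sup>2)"
    if w: "w < 0" and g: "g = (\<integral>x. 1 / (1 - w * x) \<partial>M) - 1" for w g
  proof -
    have wx: "w * x \<le> 1" if "0 \<le> x" for x
      using w that mult_nonpos_nonneg[of w x] by simp
    \<comment> \<open>\<open>v\<close> is the zero of \<open>1 - w * x\<close>, so
      \<open>1 / (x * (1 - w * x))\<close> splits into \<open>1 / x - 1 / (x - v)\<close>. As
      \<open>w < 0\<close>, this pole lies to the left of the support.\<close>
    define v where "v = 1 / w"
    have v: "v < 0" "w * v = 1" using w by (auto simp: v_def)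
    define D where "D = (p - v) * (q - v)"
    have D: "D \<ge> 0" using v(1) p pq by (simp add: D_def)
    have J: "((\<lambda>x. sqrt ((x - p) * (q - x)) / (x - v)) has_integral pi * (a * (1 + l) - v - sqrt D)) {p..q}"
      using sqrt_quotient_has_integral[OF pq, of v] v p unfolding s by (simp add: D_def)
    have "((\<lambda>x. 1 / (2 * pi * a) * (sqrt ((x - p) * (q - x)) / x - sqrt ((x - p) * (q - x)) / (x - v)))
      has_integral 1 / (2 * pi * a) * (2 * pi * a - pi * (a * (1 + l) - v - sqrt D))) {p..q}"
      by (intro has_integral_mult_right has_integral_diff J0 J)
    then have "((\<lambda>x. \<phi> x * (1 / (1 - w * x)))
      has_integral 1 / (2 * pi * a) * (2 * pi * a - pi * (a * (1 + l) - v - sqrt D))) {p..q}"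
    proof (rule has_integral_eq[rotated])
      fix x assume "x \<in> {p..q}"
      then have x: "x > 0" "x - v > 0" using p v by auto
      have "1 / x - 1 / (x - v) = 1 / x * (1 / (1 - w * x))"
      proof -
        have "1 - w * x = (v - x) * w" using v(2) by (simp add: algebra_simps)
        then have "1 / x * (1 / (1 - w * x)) = v / (x * (v - x))"
          using v w x by (simp add: v_def)
        also have "\<dots> = 1 / x - 1 / (x - v)"
          using x by (simp add: field_simps)
        finally show ?thesis by simp
      qed
      then have "S / x - S / (x - v) = S * (1 / x * (1 / (1 - w * x)))" for S
        by (metis mult.right_neutral right_diff_distrib times_divide_eq_right)
      then show "1 / (2 * pi * a) * (sqrt ((x - p) * (q - x)) / x - sqrt ((x - p) * (q - x)) / (x - v)) = \<phi> x * (1 / (1 - w * x))"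
        unfolding \<phi>_def Q by simp
    qed
    then have "(\<integral>x. 1 / (1 - w * x) \<partial>M) = 0 * (1 / (1 - w * 0)) + 1 / (2 * pi * a) * (2 * pi * a - pi * (a * (1 + l) - v - sqrt D))"
      unfolding M using w by (intro integral_atom_and_density[OF facts]) (auto simp: wx)
    also have "\<dots> = 1 - (a * (1 + l) - v - sqrt D) / (2 * a)"
      using a by (simp add: field_simps)
    finally have "sqrt D = 2 * a * g + a * (1 + l) - v"
      using a by (simp add: g field_simps)
    then have "D = (2 * a * g + a * (1 + l) - v)\<^sup>2"
      using D by (metis real_sqrt_pow2)
    moreover have "D = p * q - (p + q) * v + v\<^sup>2"
      by (simp add: D_def power2_eq_square algebra_simps)
    ultimately have "4 * a * (a * g\<^sup>2 + (a * (1 + l) - v) * g + a * l) = 0"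
      unfolding prod s by (simp add: power2_eq_square algebra_simps)
    then have "a * g\<^sup>2 + (a * (1 + l) - v) * g + a * l = 0"
      using a by simp
    then have "w * (a * g\<^sup>2 + a * (1 + l) * g + a * l) = (w * v) * g"
      by (simp add: algebra_simps)
    then show ?thesis
      unfolding v(2) by (simp add: algebra_simps)
  qed
  have "fps_const 1 * G + fps_const 0 * G\<^sup>2 = fps_X * (fps_const (a * l) + fps_const (a * (1 + l)) * G + fps_const a * G\<^sup>2)"
    unfolding G_def by (rule real_moment_series_quadratic[OF prob _ AE quad]) (simp_all add: M)
  then show "G = fps_X * (fps_const (a * l) + fps_const (a * (1 + l)) * G + fps_const a * G\<^sup>2)"
    by simp
qed

lemma free_binomial_bounded_and_series:
  fixes \<sigma> \<theta> :: real
  assumes \<sigma>: "0 < \<sigma>" and \<theta>: "1 < \<theta>"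
  defines "M \<equiv> free_binomial \<sigma> \<theta>"
  defines "G \<equiv> real_moment_series M"
  shows "prob_space M" and "AE x in M. 0 \<le> x \<and> x \<le> free_binomial_upper \<sigma> \<theta>"
    and "fps_const (\<sigma> + \<theta>) * G + G\<^sup>2 = fps_X * (fps_const \<sigma> + fps_const (\<sigma> + 1) * G + G\<^sup>2)"
proof -
  define t where "t = \<sigma> + \<theta>"
  define p where "p = free_binomial_lower \<sigma> \<theta>"
  define q where "q = free_binomial_upper \<sigma> \<theta>"
  define \<phi> where "\<phi> x = t * (sqrt ((x - p) * (q - x)) / (2 * pi * x * (1 - x)))" for x
  define atom where "atom = (if 0 < \<sigma> \<and> \<sigma> < 1 then 1 - \<sigma> else 0)"
  have t: "t > 1" "t > \<sigma>" using \<sigma> \<theta> by (auto simp: t_def)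
  define b where "b = sqrt (\<sigma> / t * (1 - 1 / t))"
  define c where "c = sqrt (1 / t * (1 - \<sigma> / t))"
  have bc: "b > 0" "c > 0" "b\<^sup>2 = \<sigma> / t * (1 - 1 / t)" "c\<^sup>2 = 1 / t * (1 - \<sigma> / t)"
    using t \<sigma> by (auto simp: b_def c_def intro!: mult_pos_pos)
  have p_eq: "p = (b - c)\<^sup>2" and q_eq: "q = (b + c)\<^sup>2"
    by (simp_all add: p_def q_def free_binomial_lower_def free_binomial_upper_def b_def c_def t_def)
  have p: "0 \<le> p" by (simp add: p_eq)
  have "q - p = 4 * b * c"
    by (simp add: p_eq q_eq power2_eq_square algebra_simps)
  then have pq: "p < q" using bc(1,2) by (smt (verit) mult_pos_pos)
  have s: "t\<^sup>2 * (p + q) = 2 * (\<sigma> * (t - 1) + \<theta>)"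
  proof -
    have "p + q = 2 * (b\<^sup>2 + c\<^sup>2)"
      by (simp add: p_eq q_eq power2_eq_square algebra_simps)
    also have "t\<^sup>2 * \<dots> = 2 * (\<sigma> * (t - 1) + (t - \<sigma>))"
      unfolding bc using t by (simp add: field_simps power2_eq_square)
    finally show ?thesis by (simp add: t_def)
  qed
  have prod: "p * q = ((\<sigma> - 1) / t)\<^sup>2"
  proof -
    have "b\<^sup>2 - c\<^sup>2 = (\<sigma> * (t - 1) - (t - \<sigma>)) / t\<^sup>2"
      unfolding bc using t by (simp add: field_simps power2_eq_square)
    also have "\<sigma> * (t - 1) - (t - \<sigma>) = (\<sigma> - 1) * t"
      by (simp add: algebra_simps)
    also have "(\<sigma> - 1) * t / t\<^sup>2 = (\<sigma> - 1) / t"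
      using t by (simp add: power2_eq_square)
    finally have "b\<^sup>2 - c\<^sup>2 = (\<sigma> - 1) / t" .
    moreover have "p * q = (b\<^sup>2 - c\<^sup>2)\<^sup>2"
      by (simp add: p_eq q_eq power2_eq_square algebra_simps)
    ultimately show ?thesis by simp
  qed
  have t_prod: "t\<^sup>2 * (p * q) = (\<sigma> - 1)\<^sup>2"
    unfolding prod using t by (simp add: power_divide)
  \<comment> \<open>The absolute value accounts for the atom: the mass of the density drops below 1
    exactly for \<open>\<sigma> < 1\<close>.\<close>
  have sqrt_prod: "sqrt (p * q) = \<bar>\<sigma> - 1\<bar> / t"
    unfolding prod using t by simp
  have prod1: "(1 - p) * (1 - q) = ((\<theta> - 1) / t)\<^sup>2"
  proof -
    have "t\<^sup>2 * ((1 - p) * (1 - q)) = t\<^sup>2 - t\<^sup>2 * (p + q) + t\<^sup>2 * (p * q)"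
      by (simp add: algebra_simps)
    also have "\<dots> = (\<theta> - 1)\<^sup>2"
      unfolding s t_prod by (simp add: t_def power2_eq_square algebra_simps)
    finally show ?thesis using t by (simp add: power_divide field_simps)
  qed
  have sqrt_prod1: "sqrt ((1 - p) * (1 - q)) = (\<theta> - 1) / t"
    unfolding prod1 using t \<theta> by simp
  \<comment> \<open>Positivity of \<open>(1 - p) * (1 - q)\<close>, which uses
    \<open>\<theta> > 1\<close>, puts both endpoints on the same side of 1; \<open>p + q < 2\<close>
    selects the left side.\<close>
  have q1: "q < 1"
  proof -
    have "0 < ((\<theta> - 1) / t)\<^sup>2" using \<theta> t by (intro zero_less_power) simp
    then have 1: "0 < (1 - p) * (1 - q)" unfolding prod1 .
    have "2 * (\<sigma> * (t - 1) + \<theta>) < 2 * t\<^sup>2"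
    proof -
      have "t\<^sup>2 - (\<sigma> * (t - 1) + \<theta>) = \<theta> * (t - 1) + \<sigma>"
        by (simp add: t_def power2_eq_square algebra_simps)
      also have "\<dots> > 0" using \<theta> t \<sigma> by (intro add_pos_pos mult_pos_pos) auto
      finally show ?thesis by simp
    qed
    then have "t\<^sup>2 * (p + q) < t\<^sup>2 * 2" unfolding s by simp
    then have "p + q < 2" using t by simp
    then show ?thesis using 1 pq by (auto simp: zero_less_mult_iff)
  qed
  have M: "M = atoms_and_density atom 0 (\<lambda>x. if p < x \<and> x < q then \<phi> x else 0)"
    unfolding M_def free_binomial_def p_def q_def \<phi>_def atom_def t_def using \<theta> by simp
  have meas: "(\<lambda>x. if p < x \<and> x < q then \<phi> x else 0) \<in> borel_measurable borel"
    unfolding \<phi>_def by measurable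
  have pos: "0 \<le> \<phi> x" if "p < x" "x < q" for x
    unfolding \<phi>_def using that p q1 t by simp
  have atom0: "0 \<le> atom" by (simp add: atom_def)
  note facts = p pq atom0 meas pos
  have J0: "((\<lambda>x. sqrt ((x - p) * (q - x)) / x) has_integral pi * ((p + q) / 2 - \<bar>\<sigma> - 1\<bar> / t)) {p..q}"
    using sqrt_quotient_has_integral[OF pq p] by (simp add: sqrt_prod)
  have J1: "((\<lambda>x. sqrt ((x - p) * (q - x)) / (1 - x)) has_integral pi * (1 - (p + q) / 2 - (\<theta> - 1) / t)) {p..q}"
    using sqrt_quotient_has_integral_right[OF pq, of 1] q1 by (simp add: sqrt_prod1)
  have total: "t / (2 * pi) * (pi * ((p + q) / 2 - \<bar>\<sigma> - 1\<bar> / t) + pi * (1 - (p + q) / 2 - (\<theta> - 1) / t)) = 1 - atom"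
  proof -
    have "pi * ((p + q) / 2 - \<bar>\<sigma> - 1\<bar> / t) + pi * (1 - (p + q) / 2 - (\<theta> - 1) / t) = pi * (1 - \<bar>\<sigma> - 1\<bar> / t - (\<theta> - 1) / t)"
      by (simp add: algebra_simps)
    also have "t / (2 * pi) * \<dots> = (t - \<bar>\<sigma> - 1\<bar> - (\<theta> - 1)) / 2"
      using t by (simp add: field_simps)
    also have "\<dots> = 1 - atom"
      using \<sigma> by (auto simp: t_def atom_def)
    finally show ?thesis .
  qed
  have mass: "(\<phi> has_integral (1 - atom)) {p..q}"
  proof -
    have "((\<lambda>x. t / (2 * pi) * (sqrt ((x - p) * (q - x)) / x + sqrt ((x - p) * (q - x)) / (1 - x))) has_integral (1 - atom)) {p..q}"
      unfolding total[symmetric] by (intro has_integral_mult_right has_integral_add J0 J1)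
    then show ?thesis
    proof (rule has_integral_eq[rotated])
      fix x assume x: "x \<in> {p..q}"
      show "t / (2 * pi) * (sqrt ((x - p) * (q - x)) / x + sqrt ((x - p) * (q - x)) / (1 - x)) = \<phi> x"
      \<comment> \<open>This point lies in the interval only if \<open>p = 0\<close>; there the root
        is 0 and both sides vanish.\<close>
      proof (cases "x = 0")
        case True
        then have "p = 0" using x p by simp
        then show ?thesis by (simp add: \<phi>_def True)
      next
        case False
        have "S / x + S / (1 - x) = S / (x * (1 - x))" for S
          using False x q1 by (simp add: field_simps)
        then show ?thesis by (simp add: \<phi>_def mult.assoc)
      qed
    qed
  qed
  show prob: "prob_space M"
    unfolding M by (rule prob_space_atom_and_density[OF facts mass])
  show AE: "AE x in M. 0 \<le> x \<and> x \<le> free_binomial_upper \<sigma> \<theta>"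
    unfolding M q_def[symmetric] by (rule AE_atom_and_density[OF facts])
  have quad: "t * g + 1 * g\<^sup>2 = w * (\<sigma> + (\<sigma> + 1) * g + 1 * g\<^sup>2)"
    if w: "w < 0" and g: "g = (\<integral>x. 1 / (1 - w * x) \<partial>M) - 1" for w g
  proof -
    have wx: "w * x \<le> 1" if "0 \<le> x" for x
      using w that mult_nonpos_nonneg[of w x] by simp
    define v where "v = 1 / w"
    have v: "v < 0" "w * v = 1" using w by (auto simp: v_def)
    define D where "D = (p - v) * (q - v)"
    have D: "D \<ge> 0" using v(1) p pq by (simp add: D_def)
    define I0 where "I0 = pi * ((p + q) / 2 - \<bar>\<sigma> - 1\<bar> / t)"
    define I1 where "I1 = pi * (1 - (p + q) / 2 - (\<theta> - 1) / t)"
    define Iv where "Iv = pi * ((p + q) / 2 - v - sqrt D)"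
    have J: "((\<lambda>x. sqrt ((x - p) * (q - x)) / (x - v)) has_integral Iv) {p..q}"
      using sqrt_quotient_has_integral[OF pq, of v] v p by (simp add: D_def Iv_def)
    \<comment> \<open>The weights 1, \<open>1 / (1 - w)\<close> and \<open>w / (1 - w)\<close> come
      from the partial fractions of \<open>1 / (x * (1 - x) * (1 - w * x))\<close> at the poles 0, 1
      and \<open>v\<close>.\<close>
    have "((\<lambda>x. t / (2 * pi) * (sqrt ((x - p) * (q - x)) / x + 1 / (1 - w) * (sqrt ((x - p) * (q - x)) / (1 - x))
          + w / (1 - w) * (sqrt ((x - p) * (q - x)) / (x - v))))
      has_integral t / (2 * pi) * (I0 + 1 / (1 - w) * I1 + w / (1 - w) * Iv)) {p..q}"
      unfolding I0_def I1_def by (intro has_integral_mult_right has_integral_add J0 J1 J)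
    then have "((\<lambda>x. \<phi> x * (1 / (1 - w * x))) has_integral t / (2 * pi) * (I0 + 1 / (1 - w) * I1 + w / (1 - w) * Iv)) {p..q}"
    proof (rule has_integral_eq[rotated])
      fix x assume x: "x \<in> {p..q}"
      show "t / (2 * pi) * (sqrt ((x - p) * (q - x)) / x + 1 / (1 - w) * (sqrt ((x - p) * (q - x)) / (1 - x))
          + w / (1 - w) * (sqrt ((x - p) * (q - x)) / (x - v))) = \<phi> x * (1 / (1 - w * x))"
      proof (cases "x = 0")
        case True
        then have "p = 0" using x p by simp
        then show ?thesis by (simp add: \<phi>_def True)
      next
        case False
        have nz: "x > 0" "1 - x > 0" "x - v > 0" "1 - w > 0" "1 - w * x > 0"
          using False x p q1 v w mult_neg_pos[of w x] by auto
        have "1 / (x - v) = - w / (1 - w * x)"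
        proof -
          have "- w * (x - v) = 1 - w * x" using v(2) by (simp add: algebra_simps)
          then show ?thesis using nz by (simp add: field_simps)
        qed
        moreover have "1 / x + 1 / (1 - w) * (1 / (1 - x)) + w / (1 - w) * (- w / (1 - w * x))
            = 1 / (x * (1 - x)) * (1 / (1 - w * x))"
        proof -
          have "1 / (1 - w) * (1 / (1 - x)) + w / (1 - w) * (- w / (1 - w * x))
              = ((1 - w * x) - w * w * (1 - x)) / ((1 - w) * (1 - x) * (1 - w * x))"
            using nz by (simp add: diff_frac_eq divide_simps)
          also have "(1 - w * x) - w * w * (1 - x) = (1 - w) * (1 + w * (1 - x))"
            by (simp add: algebra_simps)
          also have "(1 - w) * (1 + w * (1 - x)) / ((1 - w) * (1 - x) * (1 - w * x)) = (1 + w * (1 - x)) / ((1 - x) * (1 - w * x))"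
            using nz by simp
          finally have e: "1 / (1 - w) * (1 / (1 - x)) + w / (1 - w) * (- w / (1 - w * x)) = (1 + w * (1 - x)) / ((1 - x) * (1 - w * x))" .
          have "1 / x + (1 + w * (1 - x)) / ((1 - x) * (1 - w * x))
              = ((1 - x) * (1 - w * x) + (1 + w * (1 - x)) * x) / (x * ((1 - x) * (1 - w * x)))"
            using nz by (subst add_frac_eq) simp_all
          also have "(1 - x) * (1 - w * x) + (1 + w * (1 - x)) * x = 1"
            by (simp add: algebra_simps)
          finally show ?thesis using e by (simp add: add.assoc)
        qed
        ultimately have "1 / x + 1 / (1 - w) * (1 / (1 - x)) + w / (1 - w) * (1 / (x - v)) = 1 / (x * (1 - x)) * (1 / (1 - w * x))"
          by simp
        then have "S * (1 / x + 1 / (1 - w) * (1 / (1 - x)) + w / (1 - w) * (1 / (x - v))) = S * (1 / (x * (1 - x)) * (1 / (1 - w * x)))" for S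
          by simp
        from this[of "t / (2 * pi) * sqrt ((x - p) * (q - x))"] show ?thesis
          by (simp add: \<phi>_def algebra_simps)
      qed
    qed
    then have "(\<integral>x. 1 / (1 - w * x) \<partial>M) = atom * (1 / (1 - w * 0)) + t / (2 * pi) * (I0 + 1 / (1 - w) * I1 + w / (1 - w) * Iv)"
      unfolding M using w by (intro integral_atom_and_density[OF facts]) (auto simp: wx)
    then have "g = atom + t / (2 * pi) * (I0 + 1 / (1 - w) * I1 + w / (1 - w) * Iv) - 1"
      by (simp add: g)
    \<comment> \<open>Subtracting the total mass removes the atom together with
      \<open>\<bar>\<sigma> - 1\<bar>\<close>, so \<open>\<sigma> < 1\<close> and
      \<open>\<sigma> \<ge> 1\<close> need no separate treatment from here on.\<close>
    also have "\<dots> = t / (2 * pi) * (I0 + 1 / (1 - w) * I1 + w / (1 - w) * Iv) - t / (2 * pi) * (I0 + I1)"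
      using total by (simp add: I0_def I1_def)
    also have "\<dots> = t / (2 * pi) * ((1 / (1 - w) - 1) * I1 + w / (1 - w) * Iv)"
      by (simp only: right_diff_distrib[symmetric]) (simp add: left_diff_distrib)
    also have "1 / (1 - w) - 1 = w / (1 - w)"
      using w by (simp add: field_simps)
    finally have "g = t / (2 * pi) * (w / (1 - w) * (I1 + Iv))"
      by (simp only: distrib_left)
    also have "I1 + Iv = pi * (1 - v - (\<theta> - 1) / t - sqrt D)"
      by (simp add: I1_def Iv_def algebra_simps)
    finally have "2 * (1 - w) * g = t * (w * (1 - v - (\<theta> - 1) / t - sqrt D))"
      using w by simp
    also have "\<dots> = t * (w - w * v) - w * (t * ((\<theta> - 1) / t)) - t * w * sqrt D"
      by (simp only: algebra_simps)
    also have "t * ((\<theta> - 1) / t) = \<theta> - 1"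
      using t by simp
    finally have "t * w * sqrt D = t * (w - 1) - w * (\<theta> - 1) - 2 * (1 - w) * g"
      unfolding v(2) by simp
    then have "(t * w * sqrt D)\<^sup>2 = (t * (w - 1) - w * (\<theta> - 1) - 2 * (1 - w) * g)\<^sup>2"
      by simp
    moreover have "(t * w * sqrt D)\<^sup>2 = t\<^sup>2 * (w\<^sup>2 * D)"
      using D by (simp add: power_mult_distrib)
    moreover have wD: "w\<^sup>2 * D = w\<^sup>2 * (p * q) - w * (w * v) * (p + q) + (w * v)\<^sup>2"
      by (simp add: D_def power2_eq_square algebra_simps)
    have "t\<^sup>2 * (w\<^sup>2 * D) = w\<^sup>2 * (t\<^sup>2 * (p * q)) - w * (t\<^sup>2 * (p + q)) + t\<^sup>2"
      unfolding wD v(2) by (simp add: algebra_simps)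
    ultimately have "w\<^sup>2 * (\<sigma> - 1)\<^sup>2 - w * (2 * (\<sigma> * (t - 1) + \<theta>)) + t\<^sup>2
        = (t * (w - 1) - w * (\<theta> - 1) - 2 * (1 - w) * g)\<^sup>2"
      unfolding s t_prod by simp
    then have "4 * (1 - w) * ((t * g + g\<^sup>2) - w * (\<sigma> + (\<sigma> + 1) * g + g\<^sup>2)) = 0"
      unfolding t_def by (simp add: power2_eq_square algebra_simps)
    then show ?thesis using w by simp
  qed
  have "fps_const t * G + fps_const 1 * G\<^sup>2 = fps_X * (fps_const \<sigma> + fps_const (\<sigma> + 1) * G + fps_const 1 * G\<^sup>2)"
    unfolding G_def by (rule real_moment_series_quadratic[OF prob _ AE quad]) (simp_all add: M)
  then show "fps_const (\<sigma> + \<theta>) * G + G\<^sup>2 = fps_X * (fps_const \<sigma> + fps_const (\<sigma> + 1) * G + G\<^sup>2)"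
    by (simp add: t_def)
qed

section \<open>Identification of the distributions\<close>

definition fps_complex :: "real fps \<Rightarrow> complex fps"
  where "fps_complex F = Abs_fps (\<lambda>n. complex_of_real (F $ n))"

lemma fps_complex_nth [simp]: "fps_complex F $ n = complex_of_real (F $ n)"
  by (simp add: fps_complex_def)

lemma fps_complex_simps:
  "fps_complex (F + G) = fps_complex F + fps_complex G"
  "fps_complex (F * G) = fps_complex F * fps_complex G"
  "fps_complex (F\<^sup>2) = (fps_complex F)\<^sup>2"
  "fps_complex (fps_const k) = fps_const (complex_of_real k)"
  "fps_complex fps_X = fps_X"
  by (auto simp: fps_eq_iff fps_mult_nth power2_eq_square fps_X_def)

text \<open>The difference of the two equations is \<open>F - G\<close> times a series with constant
  coefficient \<open>c\<close>, and formal series have no zero divisors.\<close>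

lemma fps_poisson_equation_unique:
  fixes F G :: "complex fps"
  assumes c: "c \<noteq> 0"
    and F: "fps_const c * F = fps_X * (1 + F) * (\<beta> + \<gamma> * F)"
    and G: "fps_const c * G = fps_X * (1 + G) * (\<beta> + \<gamma> * G)"
  shows "F = G"
proof -
  let ?H = "fps_const c - fps_X * (\<beta> + \<gamma> + \<gamma> * (F + G))"
  have "(F - G) * ?H = (fps_const c * F - fps_X * (1 + F) * (\<beta> + \<gamma> * F)) - (fps_const c * G - fps_X * (1 + G) * (\<beta> + \<gamma> * G))"
    by (simp add: algebra_simps)
  then have "(F - G) * ?H = 0"
    unfolding F G by simp
  moreover have "?H $ 0 \<noteq> 0" using c by simp
  then have "?H \<noteq> 0" by (metis fps_zero_nth)
  ultimately show ?thesis by simp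
qed

text \<open>In degree 0 the equation is quadratic in the constant coefficient; demanding that it be
  0 selects one root, and \<open>\<beta> $ 0 \<noteq> 0\<close> makes the cofactor of
  \<open>F - G\<close> nonzero.\<close>

lemma fps_binomial_equation_unique:
  fixes F G :: "complex fps"
  assumes \<beta>: "\<beta> $ 0 \<noteq> 0" and 0: "F $ 0 = 0" "G $ 0 = 0"
    and F: "fps_X * (1 + F) * (\<alpha> + \<gamma> * F) = F * (\<beta> + \<gamma> * F)"
    and G: "fps_X * (1 + G) * (\<alpha> + \<gamma> * G) = G * (\<beta> + \<gamma> * G)"
  shows "F = G"
proof -
  let ?H = "\<beta> + \<gamma> * (F + G) - fps_X * (\<alpha> + \<gamma> + \<gamma> * (F + G))"
  have "(F - G) * ?H = (F * (\<beta> + \<gamma> * F) - fps_X * (1 + F) * (\<alpha> + \<gamma> * F)) - (G * (\<beta> + \<gamma> * G) - fps_X * (1 + G) * (\<alpha> + \<gamma> * G))"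
    by (simp add: algebra_simps)
  then have "(F - G) * ?H = 0"
    unfolding F G by simp
  moreover have "?H $ 0 \<noteq> 0" using \<beta> 0 by simp
  then have "?H \<noteq> 0" by (metis fps_zero_nth)
  ultimately show ?thesis by simp
qed

section \<open>From moment series to distributions, and exclusion of the degenerate case\<close>

context wstar_prob_space
begin

lemma has_distributionI:
  assumes "is_adjoint X X" "prob_space M" "sets M = sets borel" "AE x in M. 0 \<le> x \<and> x \<le> K"
    and "moment_series X = fps_complex (real_moment_series M)"
  shows "has_distribution \<phi> X M"
  unfolding has_distribution_def
proof (intro conjI allI)
  show "adj X = X" using assms(1) by (rule adj_eqI)
  show "\<exists>K. AE x in M. \<bar>x\<bar> \<le> K"
  proof
    show "AE x in M. \<bar>x\<bar> \<le> K"
      using assms(4) by eventually_elim simp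
  qed
  interpret prob_space M by fact
  show "\<phi> (X ^ n) = complex_of_real (\<integral>x. x ^ n \<partial>M)" for n
    using arg_cong[OF assms(5), of "\<lambda>F. F $ n"]
    by (cases "n = 0") (simp_all add: unital prob_space moment_series_def real_moment_series_def)
qed (use assms in auto)

text \<open>If \<open>W V\<close> is a scalar, then \<open>W\<close> and \<open>V\<close> are at once free and functions of each other, which
  forces them to be scalars.\<close>

lemma free_scalar_product:
  assumes U: "U \<in> A" "0 \<le> U" "U \<le> 1" and V: "V \<in> A" "\<phi> V \<noteq> 0" and free: "free \<phi> U V"
    and s: "(1 - U) * V = s *\<^sub>R 1" "s \<noteq> 0"
  shows "\<exists>u v :: real. U = u *\<^sub>R 1 \<and> V = v *\<^sub>R 1"
proof -
  define alg where "alg = (\<lambda>i. unital_subalgebra hull {if i then U else V})"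
  interpret free_algebras A \<phi> alg
    unfolding alg_def by (rule free_algebras_hull) fact+
  have mem: "U \<in> alg True" "V \<in> alg False"
    using hull_subset[of "{U}" unital_subalgebra] hull_subset[of "{V}" unital_subalgebra]
    by (auto simp: alg_def)
  define w where "w = Re (\<phi> (1 - U))"
  have "\<phi> (1 - U) \<in> nonneg_Reals"
    using U by (intro positive A_closed) (simp_all add: op_le_iff_diff_nonneg[of U])
  then have w: "\<phi> (1 - U) = complex_of_real w"
    by (auto simp: w_def complex_nonneg_Reals_iff complex_eq_iff)
  define D where "D = (1 - U) - w *\<^sub>R 1"
  have D_mem: "D \<in> alg True" "D * (1 - U) \<in> alg True"
    unfolding D_def by (intro unital_subalgebra_closed[OF alg_sub] mem)+
  have D_A: "D \<in> A" using D_mem alg_A by auto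
  have D0: "\<phi> D = 0"
    unfolding D_def using w U by (simp add: phi_diff phi_scaleR A_closed unital)
  \<comment> \<open>The trace of \<open>D * (1 - U)\<close> is the variance of \<open>1 - U\<close>.
    Freeness factors out \<open>\<phi> V\<close>, while the scalar product turns the same expression
    into a multiple of \<open>\<phi> D = 0\<close>.\<close>
  have "\<phi> (D * (1 - U)) * \<phi> V = \<phi> (D * (1 - U) * V)"
    using D_mem(2) mem(2) by (intro phi_mult_free[of _ True, symmetric]) auto
  also have "\<dots> = \<phi> (s *\<^sub>R D)"
    by (simp add: mult.assoc s(1))
  also have "\<dots> = 0"
    using D_A by (simp add: phi_scaleR D0)
  finally have "\<phi> (D * (1 - U)) = 0"
    using V(2) by simp
  moreover have "D * (1 - U) = D * D + w *\<^sub>R D"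
    by (simp add: D_def algebra_simps)
  ultimately have "\<phi> (D * D) = 0"
    using D_A by (simp add: add phi_scaleR A_closed D0)
  moreover have "is_adjoint D D"
    unfolding D_def using op_nonneg_is_adjoint[OF U(2)]
    by (intro is_adjoint_diff is_adjoint_scaleR is_adjoint_one)
  ultimately have "D = 0"
    by (intro faithful D_A) (simp add: adj_eqI)
  then have W: "1 - U = w *\<^sub>R 1" by (simp add: D_def)
  then have wV: "w *\<^sub>R V = s *\<^sub>R 1" using s(1) by simp
  then have "w \<noteq> 0" using s(2) by auto
  then have "V = (s / w) *\<^sub>R 1"
    using arg_cong[OF wV, of "\<lambda>z. (1 / w) *\<^sub>R z"] by simp
  moreover have "U = (1 - w) *\<^sub>R 1"
    using W by (simp add: algebra_simps)
  ultimately show ?thesis by blast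
qed

end

text \<open>Scalars are excluded because \<open>U = u\<close> and \<open>V = v\<close> satisfy both
  conditions with \<open>b = v * (1 - u)\<close> and \<open>c = 1 / b\<close>, where
  \<open>b * c = 1\<close>. The strict order asserts only a nonzero difference, so invertibility is
  asked for separately.\<close>

theorem theorem4p1:
  fixes A :: "'h::chilbert_space bounded_op set" and \<phi> :: "'h bounded_op \<Rightarrow> complex"
    and U V :: "'h bounded_op" and E :: "'h bounded_op \<Rightarrow> 'h bounded_op" and b c :: real
  assumes "wstar_prob_space A \<phi>"
    and "U \<in> A" and "V \<in> A" and "free \<phi> U V"
    and "0 < U" and "U < 1" and "0 < V"
    and "\<not> (\<exists>u v :: real. U = u *\<^sub>R 1 \<and> V = v *\<^sub>R 1)"
    and "conditional_expectation A \<phi> (vn_generated {op_sqrt V * U * op_sqrt V, 1}) E"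
    and "E (op_sqrt V * (1 - U) * op_sqrt V) = b *\<^sub>R 1"
    and "op_invertible (op_sqrt V * (1 - U) * op_sqrt V)"
    and "E (op_inverse (op_sqrt V * (1 - U) * op_sqrt V)) = c *\<^sub>R 1"
  shows "b > 0 \<and> c > 0 \<and> b * c > 1 \<and>
    (\<exists>\<alpha>::real. \<phi> (U * op_inverse (1 - U)) = complex_of_real \<alpha> \<and> \<alpha> > 0 \<and>
      has_distribution \<phi> V (free_poisson ((b * c - 1) / c) ((b * c + \<alpha>) / (b * c - 1))) \<and>
      has_distribution \<phi> U (free_binomial (\<alpha> / (b * c - 1)) (b * c / (b * c - 1))))"
proof -
  interpret wstar_prob_space A \<phi> by fact
  note UA = \<open>U \<in> A\<close> and VA = \<open>V \<in> A\<close>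
  have U0: "0 \<le> U" "U \<le> 1" and V0: "0 \<le> V"
    using assms(5-7) by auto
  have W0: "0 \<le> 1 - U"
    using U0(2) by (simp only: op_le_iff_diff_nonneg[of U])
  have adj: "is_adjoint U U" "is_adjoint V V"
    using U0 V0 by (auto intro: op_nonneg_is_adjoint)
  define R where "R = op_sqrt V"
  have R: "0 \<le> R" "R * R = V" "R \<in> A" "is_adjoint R R"
    unfolding R_def
    by (rule op_sqrt_nonneg[OF V0], rule op_sqrt_square[OF V0], rule A_sqrt[OF VA V0],
        rule op_nonneg_is_adjoint[OF op_sqrt_nonneg[OF V0]])
  define T where "T = R * (1 - U) * R"
  have T_A: "T \<in> A" unfolding T_def by (intro A_closed R UA)
  obtain S where S: "S * T = 1" "T * S = 1"
    using assms(11) by (auto simp: op_invertible_def T_def R_def)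
  have invT: "op_inverse T = S" by (rule op_inverse_eqI[OF S])
  have S_A: "S \<in> A" by (rule A_inverse[OF T_A S])
  \<comment> \<open>A right inverse of \<open>R\<close>, read off from \<open>T * S = 1\<close>;
    \<open>S * T = 1\<close> gives a left inverse, and the two coincide. Thus \<open>N\<close> is
    the inverse of the root of \<open>V\<close>.\<close>
  define N where "N = (1 - U) * R * S"
  have RN: "R * N = 1"
    using S(2) by (simp add: N_def T_def mult.assoc)
  have left: "(S * R * (1 - U)) * R = 1"
    using S(1) by (simp add: T_def mult.assoc)
  have "N = ((S * R * (1 - U)) * R) * N"
    unfolding left by simp
  also have "\<dots> = S * R * (1 - U)"
    unfolding mult.assoc RN by simp
  finally have NR: "N * R = 1"
    using left by simp
  have N_A: "N \<in> A" unfolding N_def by (intro A_closed UA R S_A)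
  have NR': "N * (R * Z) = Z" and RN': "R * (N * Z) = Z" for Z
    using NR RN by (simp_all flip: mult.assoc)
  define y where "y = R * S * R"
  have W: "1 - U = N * T * N"
    by (simp add: T_def mult.assoc NR' RN)
  have y: "y * (1 - U) = 1" "(1 - U) * y = 1"
  proof -
    have ST': "S * (T * Z) = Z" "T * (S * Z) = Z" for Z
      using S by (simp_all flip: mult.assoc)
    show "y * (1 - U) = 1" "(1 - U) * y = 1"
      unfolding W y_def by (simp_all add: mult.assoc RN' NR' ST' RN NR)
  qed
  have y_A: "y \<in> A" unfolding y_def by (intro A_closed R S_A)
  have S_eq: "S = N * y * N"
    by (simp add: y_def mult.assoc NR' RN)

  define X where "X = R * U * R"
  define B where "B = vn_generated {X, 1}"
  have X_B: "X ^ n \<in> B" for n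
  proof -
    have "X ^ n \<in> unital_subalgebra hull {X, 1}"
      using hull_subset[of "{X, 1}" unital_subalgebra]
      by (intro unital_subalgebra_closed[OF unital_subalgebra_hull]) auto
    then show ?thesis
      unfolding B_def using unital_subalgebra_hull_vn_generated by blast
  qed
  have E: "\<phi> (Z * X ^ n) = complex_of_real k * \<phi> (X ^ n)" if "Z \<in> A" "E Z = k *\<^sub>R 1" for Z k n
  proof -
    have ce: "conditional_expectation A \<phi> B E"
      using assms(9) by (simp add: B_def X_def R_def)
    have X_A: "X ^ n \<in> A" unfolding X_def by (intro A_closed R UA)
    have "E (P * Z * Q) = P * E Z * Q" if "P \<in> B" "Q \<in> B" for P Q
      using ce that \<open>Z \<in> A\<close> unfolding conditional_expectation_def by blast
    from this[of 1 "X ^ n"] have "E (1 * Z * X ^ n) = 1 * E Z * X ^ n"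
      using X_B[of 0] X_B[of n] by simp
    then have "E (Z * X ^ n) = k *\<^sub>R X ^ n"
      by (simp add: that(2))
    moreover have "\<phi> (E (Z * X ^ n)) = \<phi> (Z * X ^ n)"
      using ce that(1) X_A unfolding conditional_expectation_def by (auto intro: A_closed)
    ultimately show ?thesis
      using X_A by (simp add: phi_scaleR)
  qed
  have ET: "E T = b *\<^sub>R 1" and ES: "E S = c *\<^sub>R 1"
    using assms(10,12) invT by (simp_all add: T_def R_def)
  \<comment> \<open>\<open>X\<close> is \<open>U * V\<close> conjugated by \<open>R\<close>, so by
    traciality the moments of the compressed operator are those of \<open>U * V\<close>.\<close>
  have X_power: "X ^ n = R * ((U * V) ^ n * N)" for n
    by (induction n) (simp_all add: RN X_def mult.assoc NR' flip: R(2))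
  have conj: "\<phi> (R * Z * N) = \<phi> Z" "\<phi> (N * Z * R) = \<phi> Z" if "Z \<in> A" for Z
    using tracial[of "R * Z" N] tracial[of "N * Z" R] that R(3) N_A
    by (simp_all add: A_closed NR' RN' flip: mult.assoc) (simp_all add: mult.assoc NR' RN')
  have m: "\<phi> (X ^ n) = \<phi> ((U * V) ^ n)" for n
    using conj(1)[of "(U * V) ^ n"] by (simp add: X_power A_closed UA VA mult.assoc)
  have h1: "\<phi> (V * (U * V) ^ n) = complex_of_real b * \<phi> ((U * V) ^ n) + \<phi> ((U * V) ^ Suc n)" for n
  proof -
    have "T * X ^ n = R * (V * (U * V) ^ n - (U * V) ^ Suc n) * N"
      unfolding X_power T_def R(2)[symmetric] by (simp add: algebra_simps)
    then have "\<phi> (T * X ^ n) = \<phi> (V * (U * V) ^ n - (U * V) ^ Suc n)"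
      by (simp only: conj A_closed UA VA)
    also have "\<dots> = \<phi> (V * (U * V) ^ n) - \<phi> ((U * V) ^ Suc n)"
      by (intro phi_diff A_closed UA VA)
    finally show ?thesis
      using E[OF T_A ET, of n] by (simp add: m algebra_simps)
  qed
  \<comment> \<open>Only positive powers of \<open>X\<close> are paired with \<open>S\<close>: one
    factor \<open>R\<close> on each side is used up in cancelling the two factors \<open>N\<close>
    of \<open>S\<close>, whence the shift to \<open>Suc n\<close>.\<close>
  have h2: "\<phi> (y * U * (V * U) ^ n) = complex_of_real c * \<phi> ((U * V) ^ Suc n)" for n
  proof -
    have swap: "(U * V) ^ n * U = U * (V * U) ^ n"
      by (induction n) (simp_all add: mult.assoc)
    have "(U * V) ^ Suc n = U * (V * U) ^ n * V"
      by (simp only: power_Suc2 swap[symmetric] mult.assoc)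
    then have "X ^ Suc n = R * (U * (V * U) ^ n) * R"
      unfolding X_power R(2)[symmetric] by (simp only: mult.assoc RN mult_1_right)
    then have "S * X ^ Suc n = N * (y * U * (V * U) ^ n) * R"
      unfolding S_eq by (simp only: mult.assoc NR')
    then have "\<phi> (S * X ^ Suc n) = \<phi> (y * U * (V * U) ^ n)"
      by (simp only: conj A_closed UA VA y_A)
    then show ?thesis
      using E[OF S_A ES, of "Suc n"] by (simp only: m)
  qed

  have T_nonneg: "0 \<le> T"
    unfolding T_def by (rule op_nonneg_conj[OF R(4) W0])
  have S_adj: "is_adjoint S S"
    by (rule is_adjoint_inverse[OF op_nonneg_is_adjoint[OF T_nonneg] S])
  have S_nonneg: "0 \<le> S"
    using op_nonneg_conj[OF S_adj T_nonneg] by (simp add: S)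
  have phi_T: "\<phi> T = complex_of_real b" and phi_S: "\<phi> S = complex_of_real c"
    using E[OF T_A ET, of 0] E[OF S_A ES, of 0] by (simp_all add: unital)
  have "0 < T" "0 < S"
    using T_nonneg S_nonneg S by (auto simp: less_le)
  then have b: "0 < b" and c: "0 < c"
    using phi_positive[OF T_A] phi_positive[OF S_A] by (simp_all add: phi_T phi_S)
  have pU: "Im (\<phi> U) = 0" "0 < Re (\<phi> U)" and pV: "Im (\<phi> V) = 0" "0 < Re (\<phi> V)"
    using phi_positive[OF UA] phi_positive[OF VA] assms(5,7) by auto
  then have nz: "\<phi> U \<noteq> 0" "\<phi> V \<noteq> 0" by auto

  have bc: "b * c > 1"
  proof -
    \<comment> \<open>The trace of \<open>(T - s) * S * (T - s)\<close> is
      \<open>b - 2 * s + s\<^sup>2 * c\<close>; \<open>s = 1 / c\<close> minimizes it, with value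
      \<open>(b * c - 1) / c\<close>.\<close>
    define s where "s = 1 / c"
    have s: "s > 0" using c by (simp add: s_def)
    define Z where "Z = T - s *\<^sub>R 1"
    have Z_adj: "is_adjoint Z Z"
      unfolding Z_def by (intro is_adjoint_diff op_nonneg_is_adjoint[OF T_nonneg] is_adjoint_scaleR is_adjoint_one)
    have Z_A: "Z \<in> A" unfolding Z_def by (intro A_closed T_A)
    define P where "P = Z * S * Z"
    have P: "P = T - (2 * s) *\<^sub>R 1 + (s * s) *\<^sub>R S"
    proof -
      have "P = T * S * T - s *\<^sub>R (T * S) - s *\<^sub>R (S * T) + (s * s) *\<^sub>R S"
        by (simp add: P_def Z_def algebra_simps)
      then show ?thesis by (simp add: S scaleR_2[symmetric] algebra_simps flip: scaleR_add_left)
    qed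
    have P_nonneg: "0 \<le> P"
      unfolding P_def by (rule op_nonneg_conj[OF Z_adj S_nonneg])
    have "P \<noteq> 0"
    proof
      assume "P = 0"
      have "P * T = Z * (S * (Z * T))"
        by (simp add: P_def mult.assoc)
      also have "Z * T = T * Z"
        by (simp add: Z_def algebra_simps)
      also have "S * (T * Z) = Z"
        by (simp add: S flip: mult.assoc)
      finally have "Z * Z = 0" using \<open>P = 0\<close> by simp
      then have "Z = 0" by (rule selfadjoint_square_eq_0[OF Z_adj])
      then have "T = s *\<^sub>R 1" by (simp add: Z_def)
      then have "(1 - U) * V = s *\<^sub>R 1"
        unfolding W R(2)[symmetric] by (simp add: mult.assoc NR NR')
      then show False
        using free_scalar_product[OF UA U0(1,2) VA nz(2) assms(4)] s assms(8) by auto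
    qed
    then have "0 < P" using P_nonneg by simp
    moreover have "P \<in> A" unfolding P_def by (intro A_closed Z_A S_A)
    ultimately have "0 < Re (\<phi> P)" by (intro phi_positive)
    also have "\<phi> P = complex_of_real (b - 2 * s + s * s * c)"
      unfolding P by (simp add: add phi_diff phi_scaleR A_closed T_A S_A phi_T phi_S unital)
    finally have "0 < b - 2 * s + s * s * c" by simp
    also have "b - 2 * s + s * s * c = (b * c - 1) / c"
      using c by (simp add: s_def field_simps)
    finally show ?thesis using c by (simp add: zero_less_divide_iff)
  qed

  \<comment> \<open>The case \<open>n = 0\<close> of \<open>h2\<close>, combined with freeness,
    gives \<open>\<phi> (y * U) = c * \<phi> U * \<phi> V\<close>, from which positivity is
    immediate.\<close>
  define \<alpha> where "\<alpha> = c * (Re (\<phi> U) * Re (\<phi> V))"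
  have \<alpha>0: "\<alpha> > 0" using c pU pV by (simp add: \<alpha>_def)
  have \<alpha>: "\<phi> (y * U) = complex_of_real \<alpha>"
  proof -
    interpret free_algebras A \<phi> "\<lambda>i. unital_subalgebra hull {if i then U else V}"
      using UA VA assms(4) by (rule free_algebras_hull)
    have "\<phi> (U * V) = \<phi> U * \<phi> V"
      using hull_subset[of "{U}" unital_subalgebra] hull_subset[of "{V}" unital_subalgebra]
      by (intro phi_mult_free[of _ True]) auto
    then show ?thesis
      using h2[of 0] pU pV by (simp add: \<alpha>_def complex_eq_iff)
  qed
  have "y * U = y - 1" "U * y = y - 1"
    using y by (simp_all add: algebra_simps)
  then have "U * op_inverse (1 - U) = y * U"
    unfolding op_inverse_eqI[OF y] by simp
  then have \<alpha>_inv: "\<phi> (U * op_inverse (1 - U)) = complex_of_real \<alpha>"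
    by (simp add: \<alpha>)

  define \<gamma> where "\<gamma> = b * c - 1"
  define \<beta> where "\<beta> = b * c + \<alpha>"
  have \<gamma>: "\<gamma> > 0" and \<beta>: "\<beta> > \<gamma>" using bc \<alpha>0 by (auto simp: \<gamma>_def \<beta>_def)
  note eqs = free_product_equations[OF UA U0(1,2) nz(1) VA V0 nz(2) assms(4) y h1 h2, unfolded \<alpha>]
  have const: "fps_const (complex_of_real b * complex_of_real c + complex_of_real \<alpha>) = fps_const (complex_of_real \<beta>)"
    "fps_const (complex_of_real b * complex_of_real c - 1) = fps_const (complex_of_real \<gamma>)"
    by (simp_all add: \<beta>_def \<gamma>_def)
  note eqs = eqs[unfolded const]

  have dV: "has_distribution \<phi> V (free_poisson (\<gamma> / c) (\<beta> / \<gamma>))"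
  proof -
    have al: "0 < \<gamma> / c" "1 < \<beta> / \<gamma>" using \<gamma> \<beta> c by simp_all
    note fp = free_poisson_bounded_and_series[OF al]
    define G where "G = real_moment_series (free_poisson (\<gamma> / c) (\<beta> / \<gamma>))"
    \<comment> \<open>Scaling by \<open>c\<close> turns the parameters of the law into the
      coefficients \<open>\<beta>\<close> and \<open>\<gamma>\<close> of the equation for
      \<open>V\<close>.\<close>
    have "fps_const c * G = fps_X * ((fps_const c * fps_const (\<gamma> / c * (\<beta> / \<gamma>)))
        + (fps_const c * fps_const (\<gamma> / c * (1 + \<beta> / \<gamma>))) * G + (fps_const c * fps_const (\<gamma> / c)) * G\<^sup>2)"
      using arg_cong[OF fp(3), of "\<lambda>F. fps_const c * F"] unfolding G_def[symmetric]
      by (simp only: algebra_simps)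
    also have "fps_const c * fps_const (\<gamma> / c * (\<beta> / \<gamma>)) = fps_const \<beta>"
      using c \<gamma> by simp
    also have "fps_const c * fps_const (\<gamma> / c * (1 + \<beta> / \<gamma>)) = fps_const (\<beta> + \<gamma>)"
      using c \<gamma> by (simp add: field_simps)
    also have "fps_const c * fps_const (\<gamma> / c) = fps_const \<gamma>"
      using c by simp
    finally have "fps_complex (fps_const c * G) = fps_complex (fps_X * (fps_const \<beta> + fps_const (\<beta> + \<gamma>) * G + fps_const \<gamma> * G\<^sup>2))"
      by simp
    then have cG: "fps_const (complex_of_real c) * fps_complex G
        = fps_X * (1 + fps_complex G) * (fps_const (complex_of_real \<beta>) + fps_const (complex_of_real \<gamma>) * fps_complex G)"
      unfolding fps_complex_simps
      by (simp add: algebra_simps power2_eq_square flip: fps_const_add)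
    have "moment_series V = fps_complex G"
      using c by (intro fps_poisson_equation_unique[OF _ eqs(2) cG]) simp
    then show ?thesis
      unfolding G_def
      by (intro has_distributionI[OF adj(2) fp(1) _ fp(2)]) (simp_all add: free_poisson_def)
  qed
  have dU: "has_distribution \<phi> U (free_binomial (\<alpha> / \<gamma>) (b * c / \<gamma>))"
  proof -
    have st: "0 < \<alpha> / \<gamma>" "1 < b * c / \<gamma>" using \<gamma> \<alpha>0 by (simp_all add: \<gamma>_def)
    note fb = free_binomial_bounded_and_series[OF st]
    define G where "G = real_moment_series (free_binomial (\<alpha> / \<gamma>) (b * c / \<gamma>))"
    have "(fps_const \<gamma> * fps_const (\<alpha> / \<gamma> + b * c / \<gamma>)) * G + fps_const \<gamma> * G\<^sup>2
      = fps_X * (fps_const \<gamma> * fps_const (\<alpha> / \<gamma>) + (fps_const \<gamma> * fps_const (\<alpha> / \<gamma> + 1)) * G + fps_const \<gamma> * G\<^sup>2)"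
      using arg_cong[OF fb(3), of "\<lambda>F. fps_const \<gamma> * F"] unfolding G_def[symmetric]
      by (simp only: algebra_simps)
    moreover have "fps_const \<gamma> * fps_const (\<alpha> / \<gamma> + b * c / \<gamma>) = fps_const \<beta>"
      using \<gamma> by (simp add: \<beta>_def field_simps)
    moreover have "fps_const \<gamma> * fps_const (\<alpha> / \<gamma>) = fps_const \<alpha>"
      using \<gamma> by simp
    moreover have "fps_const \<gamma> * fps_const (\<alpha> / \<gamma> + 1) = fps_const (\<alpha> + \<gamma>)"
      using \<gamma> by (simp add: field_simps)
    ultimately have "fps_complex (fps_const \<beta> * G + fps_const \<gamma> * G\<^sup>2)
        = fps_complex (fps_X * (fps_const \<alpha> + fps_const (\<alpha> + \<gamma>) * G + fps_const \<gamma> * G\<^sup>2))"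
      by simp
    then have cG: "fps_X * (1 + fps_complex G) * (fps_const (complex_of_real \<alpha>) + fps_const (complex_of_real \<gamma>) * fps_complex G)
        = fps_complex G * (fps_const (complex_of_real \<beta>) + fps_const (complex_of_real \<gamma>) * fps_complex G)"
      unfolding fps_complex_simps
      by (simp add: algebra_simps power2_eq_square flip: fps_const_add)
    have "moment_series U = fps_complex G"
      using \<gamma> \<beta> by (intro fps_binomial_equation_unique[OF _ _ _ eqs(1) cG])
        (simp_all add: moment_series_nth_0 G_def real_moment_series_def)
    then show ?thesis
      unfolding G_def
      by (intro has_distributionI[OF adj(1) fb(1) _ fb(2)]) (simp_all add: free_binomial_def)
  qed
  show ?thesis
    using b c bc \<alpha>_inv \<alpha>0 dV dU unfolding \<gamma>_def \<beta>_def by blast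
qed

end
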